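(* There exists a constant $A_2>0$, depending only on $d$, such that for all sufficiently small $r\in(0,1]$ (depending on $d$) and all $x\in\mathbb{R}^d$, $$\mu_r(x)\ \le\ A_2\,\delta_d(r)\,\|x\|_1 .$$
   Context: Frog model with Bernoulli initial configuration. Fix $d\ge2$ and $r\in(0,1]$. Let $\omega=(\omega(x))_{x\in\mathbb{Z}^d}$ be i.i.d. with $\mathbb{P}_r(\omega(x)=1)=1-\mathbb{P}_r(\omega(x)=0)=r$, and independently let $(S^x_k)_{k\ge0}$, $x\in\mathbb{Z}^d$, be independent simple random walks on $\mathbb{Z}^d$ with $S^x_0=x$; write $\mathbf P_r$ for the joint law. For $x,y\in\mathbb{Z}^d$ set $\tau(x,y):=\inf\{k\ge0:S^x_k=y\}$ if $\omega(x)=1$ and $\tau(x,y):=\infty$ if $\omega(x)=0$. The first passage time is $T(x,y):=\inf\{\sum_{i=0}^{m-1}\tau(x_i,x_{i+1}): m\in\mathbb{N},\ x_0,\dots,x_m\in\mathbb{Z}^d,\ x_0=x,\ x_m=y\}$. It is known that there is a deterministic norm $\mu_r$ on $\mathbb{R}^d$ (the time constant) such that $\mathbf P_r$-a.s. on $\{\omega(0)=1\}$, $\lim_{n\to\infty}T(0,nx)/n=\mu_r(x)$ for all $x\in\mathbb{Z}^d$. Define $\delta_d(r):=\sqrt{|\log r|/r}$ if $d=2$ and $\delta_d(r):=1/\sqrt r$ if $d\ge3$. $\|\cdot\|_1$ is the $\ell^1$-norm. *)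

theory Defs
  imports "HOL-Probability.Probability"
begin

type_synonym 'd site = "int ^ 'd"

definition srw_steps :: "('d::finite) site set" where
  "srw_steps = {v. \<exists>i. v = axis i 1 \<or> v = axis i (-1)}"

text \<open>Randomness attached to a site x: the Bernoulli variable omega(x) and the
  i.i.d. uniform increments of the walk started at x.\<close>
definition site_space :: "real \<Rightarrow> (bool \<times> (nat \<Rightarrow> ('d::finite) site)) measure" where
  "site_space r = measure_pmf (bernoulli_pmf r) \<Otimes>\<^sub>M
      (\<Pi>\<^sub>M k\<in>(UNIV::nat set). measure_pmf (pmf_of_set (srw_steps :: 'd site set)))"

definition frog_space :: "real \<Rightarrow> (('d::finite) site \<Rightarrow> bool \<times> (nat \<Rightarrow> 'd site)) measure" where
  "frog_space r = (\<Pi>\<^sub>M x\<in>(UNIV::'d site set). site_space r)"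

definition occ :: "(('d::finite) site \<Rightarrow> bool \<times> (nat \<Rightarrow> 'd site)) \<Rightarrow> 'd site \<Rightarrow> bool" where
  "occ w x = fst (w x)"

definition walk :: "(('d::finite) site \<Rightarrow> bool \<times> (nat \<Rightarrow> 'd site)) \<Rightarrow> 'd site \<Rightarrow> nat \<Rightarrow> 'd site" where
  "walk w x k = x + (\<Sum>i<k. snd (w x) i)"

definition tau :: "(('d::finite) site \<Rightarrow> bool \<times> (nat \<Rightarrow> 'd site)) \<Rightarrow> 'd site \<Rightarrow> 'd site \<Rightarrow> enat" where
  "tau w x y = (if occ w x \<and> (\<exists>k. walk w x k = y) then enat (LEAST k. walk w x k = y) else \<infinity>)"

definition passage_time :: "(('d::finite) site \<Rightarrow> bool \<times> (nat \<Rightarrow> 'd site)) \<Rightarrow> 'd site \<Rightarrow> 'd site \<Rightarrow> enat" where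
  "passage_time w x y = (INF ps \<in> {ps. ps \<noteq> [] \<and> hd ps = x \<and> last ps = y}.
      sum_list (map (\<lambda>(a, b). tau w a b) (zip ps (tl ps))))"

definition is_norm_fun :: "(real ^ ('d::finite) \<Rightarrow> real) \<Rightarrow> bool" where
  "is_norm_fun \<mu> \<longleftrightarrow> (\<forall>x. 0 \<le> \<mu> x) \<and> (\<forall>x. \<mu> x = 0 \<longleftrightarrow> x = 0) \<and>
     (\<forall>c x. \<mu> (c *\<^sub>R x) = \<bar>c\<bar> * \<mu> x) \<and> (\<forall>x y. \<mu> (x + y) \<le> \<mu> x + \<mu> y)"

definition int_to_real_vec :: "('d::finite) site \<Rightarrow> real ^ 'd" where
  "int_to_real_vec x = (\<chi> i. real_of_int (x $ i))"

definition is_time_constant :: "real \<Rightarrow> (real ^ ('d::finite) \<Rightarrow> real) \<Rightarrow> bool" where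
  "is_time_constant r \<mu> \<longleftrightarrow> is_norm_fun \<mu> \<and>
     (AE w in (frog_space r :: ('d site \<Rightarrow> bool \<times> (nat \<Rightarrow> 'd site)) measure).
        occ w 0 \<longrightarrow> (\<forall>x::'d site.
           (\<forall>\<^sub>F n in sequentially. passage_time w 0 (int n *s x) \<noteq> \<infinity>) \<and>
           ((\<lambda>n. real (the_enat (passage_time w 0 (int n *s x))) / real n)
              \<longlonglongrightarrow> \<mu> (int_to_real_vec x))))"

definition delta_d :: "nat \<Rightarrow> real \<Rightarrow> real" where
  "delta_d d r = (if d = 2 then sqrt (\<bar>ln r\<bar> / r) else 1 / sqrt r)"

definition l1_norm :: "real ^ ('d::finite) \<Rightarrow> real" where
  "l1_norm x = (\<Sum>i\<in>UNIV. \<bar>x $ i\<bar>)"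

end

theory Submission
  imports Defs "HOL-Real_Asymp.Real_Asymp"
begin

text \<open>
  A frog that walks for time \<open>h\<^sup>2\<close>, with \<open>h\<close> a large multiple of \<open>\<delta>\<^sub>d(r)\<close>, sees of order \<open>1 / r\<close> distinct
  sites within distance \<open>h\<close>, hence many frogs. To get from \<open>0\<close> to a target at distance \<open>N\<close>, shrink a
  Euclidean ball around the target, always keeping its inside unexplored and \<open>m\<close> awake frogs with
  unrevealed walks within distance \<open>2 h\<close> of its boundary. Each of these walkers tries, at the scales
  \<open>l\<^sub>i = 8 h m \<kappa>\<^sup>i\<close>, to wake \<open>m\<close> frogs in an annulus of width \<open>2 h\<close> reserved for that scale and walker. One
  walker fails at all scales below \<open>i\<close> with probability at most \<open>q\<^sup>i\<close>, which decays too slowly for a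
  finite mean waiting time, but \<open>m\<close> independent walkers give \<open>q\<^sup>i\<^sup>m\<close>, and \<open>m\<close> is chosen with
  \<open>q\<^sup>m \<kappa>\<^sup>2 \<le> 1 / 2\<close>. A stage then costs mean time \<open>O(h\<^sup>2)\<close>, gains at least \<open>2 h\<close>, and fails altogether from
  radius \<open>\<rho>\<close> with probability \<open>O(h\<^sup>2 / \<rho>\<^sup>2)\<close>, which is summable over the stages. A Laplace
  transform argument gives passage time \<open>O(h N)\<close> with probability bounded away from \<open>0\<close> in \<open>N\<close>; this
  bounds \<open>\<mu>\<close> on unit vectors, and the norm property does the rest.
\<close>

text \<open>The size of \<open>h\<close> comes from counting discovered sites. In \<open>n\<close>
  steps a walk sees of order n / G distinct sites, where G bounds the sum of its return
  probabilities up to time n. Asking for a large multiple of 1 / r of them makes n of order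
  \<delta>^2, because G is constant for d \<ge> 3 and logarithmic in n for d = 2; then h is of order
  sqrt n.

  A probability bounded away from 0 in N suffices because \<mu> is deterministic: events of
  probability at least \<eta> occur infinitely often with probability at least \<eta>, so some
  outcome in the almost sure convergence event sees infinitely many of them. Hence \<eta> may depend
  on r, while the constant in front of h N may not.

  The obstacle is fresh randomness. A frog is found by inspecting the occupation of its site, but
  its walk must remain unrevealed for the next stage. Occupations and walks are therefore separate
  coordinates of the environment, and each stage conditions on different sets of sites for the
  two.\<close>

abbreviation pexp :: "'a pmf \<Rightarrow> ('a \<Rightarrow> real) \<Rightarrow> real" where
  "pexp p f \<equiv> measure_pmf.expectation p f"

abbreviation pprob :: "'a pmf \<Rightarrow> 'a set \<Rightarrow> real" where
  "pprob p \<equiv> measure_pmf.prob p"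

section \<open>Expectations under laws with finite support, and a second-moment bound\<close>

lemma pexp_of_bool: "pexp p (\<lambda>x. of_bool (P x)) = pprob p {x. P x}"
proof -
  have "pexp p (\<lambda>x. of_bool (P x)) = pexp p (indicator {x. P x})"
    by (rule Bochner_Integration.integral_cong) (auto simp: indicator_def)
  then show ?thesis by simp
qed

lemma pexp_mono:
  assumes "finite (set_pmf p)" "\<And>x. x \<in> set_pmf p \<Longrightarrow> f x \<le> g x"
  shows "pexp p f \<le> pexp p g"
  by (rule integral_mono_AE)
    (auto intro!: integrable_measure_pmf_finite assms simp: AE_measure_pmf_iff)

lemma pexp_cong:
  assumes "\<And>x. x \<in> set_pmf p \<Longrightarrow> f x = g x"
  shows "pexp p f = pexp p g"
  by (rule integral_cong_AE) (auto simp: AE_measure_pmf_iff assms)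

lemma pexp_add:
  assumes "finite (set_pmf p)"
  shows "pexp p (\<lambda>x. f x + g x) = pexp p f + pexp p g"
  by (rule Bochner_Integration.integral_add) (auto intro!: integrable_measure_pmf_finite assms)

lemma pexp_sum:
  assumes "finite (set_pmf p)"
  shows "pexp p (\<lambda>x. \<Sum>i\<in>A. f i x) = (\<Sum>i\<in>A. pexp p (f i))"
  by (rule Bochner_Integration.integral_sum) (auto intro!: integrable_measure_pmf_finite assms)

lemma pexp_nonneg:
  assumes "\<And>x. x \<in> set_pmf p \<Longrightarrow> 0 \<le> f x"
  shows "0 \<le> pexp p f"
  by (rule integral_nonneg_AE) (auto simp: AE_measure_pmf_iff assms)

lemma pexp_bind:
  assumes "finite (set_pmf p)" "\<And>x. x \<in> set_pmf p \<Longrightarrow> finite (set_pmf (q x))"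
  shows "pexp (bind_pmf p q) f = pexp p (\<lambda>x. pexp (q x) f)"
proof -
  have "pexp (bind_pmf p q) f = (\<Sum>a\<in>set_pmf p. pmf p a *\<^sub>R pexp (q a) f)"
    using assms by (intro pmf_expectation_bind) auto
  also have "\<dots> = pexp p (\<lambda>x. pexp (q x) f)"
    using assms(1) by (subst integral_measure_pmf[of "set_pmf p"]) auto
  finally show ?thesis .
qed

lemma pexp_pair:
  assumes "finite (set_pmf p)" "finite (set_pmf q)"
  shows "pexp (pair_pmf p q) f = pexp p (\<lambda>x. pexp q (\<lambda>y. f (x, y)))"
  using assms by (simp add: pair_pmf_def pexp_bind)

lemma pexp_commute:
  assumes "finite (set_pmf p)" "finite (set_pmf q)"
  shows "pexp p (\<lambda>x. pexp q (f x)) = pexp q (\<lambda>y. pexp p (\<lambda>x. f x y))"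
proof -
  have "pexp p (\<lambda>x. pexp q (f x)) = pexp (pair_pmf p q) (\<lambda>(x, y). f x y)"
    using assms by (simp add: pexp_pair)
  also have "\<dots> = pexp (pair_pmf q p) (\<lambda>(y, x). f x y)"
    by (subst pair_commute_pmf) (auto simp: case_prod_unfold)
  finally show ?thesis using assms by (simp add: pexp_pair)
qed

lemma pexp_markov:
  assumes "finite (set_pmf p)" "\<And>x. x \<in> set_pmf p \<Longrightarrow> 0 \<le> f x" "0 < c"
  shows "pprob p {x. c < f x} \<le> pexp p f / c"
proof -
  have "c * pprob p {x. c < f x} = pexp p (\<lambda>x. c * of_bool (c < f x))"
    by (simp add: pexp_of_bool)
  also have "\<dots> \<le> pexp p f"
    using assms by (intro pexp_mono) auto
  finally show ?thesis using assms(3) by (simp add: field_simps)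
qed

lemma prob_mono:
  assumes "\<And>x. x \<in> set_pmf p \<Longrightarrow> P x \<Longrightarrow> Q x"
  shows "pprob p {x. P x} \<le> pprob p {x. Q x}"
  by (rule measure_pmf.finite_measure_mono_AE) (auto simp: AE_measure_pmf_iff assms)

text \<open>This is the second-moment method for \<open>f\<^sup>2\<close>. With kurtosis bound 4 and
  threshold 1/4 of the mean, Cauchy-Schwarz would give (3/4)^2 / 4 = 9/64; the AM-GM weight is tuned
  to lose nothing against it.\<close>

lemma paley_zygmund:
  assumes fin: "finite (set_pmf p)" and M2: "pexp p (\<lambda>x. (f x)\<^sup>2) = s"
    and M4: "pexp p (\<lambda>x. (f x) ^ 4) \<le> 4 * s\<^sup>2" and s: "s > 0"
  shows "pprob p {x. (f x)\<^sup>2 \<ge> s / 4} \<ge> 9 / 64"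
proof -
  define P where "P = pprob p {x. (f x)\<^sup>2 \<ge> s / 4}"
  \<comment> \<open>AM-GM replaces Cauchy--Schwarz: \<open>Z 1[Z \<ge> s/4] \<le> a Z\<^sup>2 + 1[Z \<ge> s/4] / (4 a)\<close>, with \<open>a = 3/(32 s)\<close>\<close>
  have "s = pexp p (\<lambda>x. (f x)\<^sup>2)" using M2 by simp
  also have "\<dots> \<le> pexp p (\<lambda>x. s / 4 + (3 / (32 * s) * (f x) ^ 4 + 8 * s / 3 * of_bool ((f x)\<^sup>2 \<ge> s / 4)))"
  proof (rule pexp_mono[OF fin])
    fix x
    define z where "z = (f x)\<^sup>2"
    have z4: "(f x) ^ 4 = z\<^sup>2" by (simp add: z_def)
    have "0 \<le> (3 * z - 16 * s)\<^sup>2 / (96 * s)" using s by simp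
    also have "(3 * z - 16 * s)\<^sup>2 / (96 * s) = 3 / (32 * s) * z\<^sup>2 + 8 * s / 3 - z"
      using s by (simp add: power2_eq_square field_simps)
    finally have 1: "z \<le> 3 / (32 * s) * z\<^sup>2 + 8 * s / 3" by simp
    have 2: "0 \<le> 3 / (32 * s) * z\<^sup>2" using s by simp
    show "(f x)\<^sup>2 \<le> s / 4 + (3 / (32 * s) * (f x) ^ 4 + 8 * s / 3 * of_bool ((f x)\<^sup>2 \<ge> s / 4))"
    proof (cases "s / 4 \<le> z")
      case True
      then show ?thesis unfolding z4 z_def[symmetric] using 1 s by simp
    next
      case False
      then have "z \<le> s / 4 + 3 / (32 * s) * z\<^sup>2" using 2 by linarith
      then show ?thesis unfolding z4 z_def[symmetric] using False by simp
    qed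
  qed
  also have "\<dots> = s / 4 + (3 / (32 * s) * pexp p (\<lambda>x. (f x) ^ 4) + 8 * s / 3 * P)"
    using fin by (simp add: pexp_add P_def pexp_of_bool)
  also have "\<dots> \<le> s / 4 + (3 / (32 * s) * (4 * s\<^sup>2) + 8 * s / 3 * P)"
    using M4 s by (intro add_mono mult_left_mono order_refl) auto
  also have "\<dots> = 5 * s / 8 + 8 * s / 3 * P" using s by (simp add: power2_eq_square field_simps)
  finally have "s * (3 / 8) \<le> s * (8 / 3 * P)" by (simp add: field_simps)
  then have "3 / 8 \<le> 8 / 3 * P" using s by (metis mult_le_cancel_left_pos)
  then show ?thesis unfolding P_def by simp
qed

section \<open>Simple random walk\<close>

definition step_pmf :: "('d::finite) site pmf" where
  "step_pmf = pmf_of_set srw_steps"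

abbreviation rw_pmf :: "nat \<Rightarrow> ('d::finite) site list pmf" where
  "rw_pmf n \<equiv> replicate_pmf n step_pmf"

lemma srw_steps_eq: "srw_steps = (\<lambda>c. axis c 1) ` UNIV \<union> (\<lambda>c. axis c (-1)) ` UNIV"
  unfolding srw_steps_def by auto

lemma finite_srw_steps [simp]: "finite srw_steps"
  unfolding srw_steps_eq by simp

lemma srw_steps_nonempty [simp]: "srw_steps \<noteq> {}"
  unfolding srw_steps_eq by simp

lemma set_step_pmf [simp]: "set_pmf step_pmf = srw_steps"
  by (simp add: step_pmf_def)

lemma sum_srw_steps:
  fixes f :: "('d::finite) site \<Rightarrow> real"
  shows "sum f srw_steps = (\<Sum>c\<in>UNIV. f (axis c 1) + f (axis c (-1)))"
proof -
  have i: "inj (\<lambda>c::'d. axis c (1::int))" "inj (\<lambda>c::'d. axis c (-1::int))"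
    by (auto simp: inj_def axis_eq_axis)
  have "sum f srw_steps = sum f ((\<lambda>c::'d. axis c 1) ` UNIV) + sum f ((\<lambda>c. axis c (-1)) ` UNIV)"
    unfolding srw_steps_eq by (rule sum.union_disjoint) (auto simp: axis_eq_axis)
  also have "\<dots> = (\<Sum>c\<in>UNIV. f (axis c 1)) + (\<Sum>c\<in>UNIV. f (axis c (-1)))"
    using i by (simp add: sum.reindex)
  finally show ?thesis by (simp add: sum.distrib)
qed

lemma card_srw_steps: "card (srw_steps :: ('d::finite) site set) = 2 * CARD('d)"
proof -
  have "real (card (srw_steps :: 'd site set)) = sum (\<lambda>_. 1) (srw_steps :: 'd site set)" by simp
  also have "\<dots> = real (2 * CARD('d))" unfolding sum_srw_steps by simp
  finally show ?thesis by linarith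
qed

lemma pexp_step:
  fixes f :: "('d::finite) site \<Rightarrow> real"
  shows "pexp step_pmf f = (\<Sum>c\<in>UNIV. f (axis c 1) + f (axis c (-1))) / (2 * real CARD('d))"
  unfolding step_pmf_def
  by (subst integral_pmf_of_set) (simp_all add: sum_srw_steps card_srw_steps)

lemma finite_rw [simp]: "finite (set_pmf (rw_pmf n))"
  by (induction n) auto

lemma pexp_rw_Suc:
  "pexp (rw_pmf (Suc n)) f = pexp step_pmf (\<lambda>v. pexp (rw_pmf n) (\<lambda>xs. f (v # xs)))"
  by (simp add: pexp_bind)

lemma pexp_rw_add:
  "pexp (rw_pmf (m + n)) f = pexp (rw_pmf m) (\<lambda>xs. pexp (rw_pmf n) (\<lambda>ys. f (xs @ ys)))"
  by (simp add: replicate_pmf_distrib pexp_bind)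

lemma pexp_rw_snoc:
  "pexp (rw_pmf (Suc n)) f = pexp (rw_pmf n) (\<lambda>xs. pexp step_pmf (\<lambda>v. f (xs @ [v])))"
proof -
  have "pexp (rw_pmf (n + 1)) f = pexp (rw_pmf n) (\<lambda>xs. pexp step_pmf (\<lambda>v. f (xs @ [v])))"
    by (subst pexp_rw_add) (simp add: pexp_bind)
  then show ?thesis by simp
qed

lemma length_rw: "xs \<in> set_pmf (rw_pmf n) \<Longrightarrow> length xs = n"
  by (auto simp: set_replicate_pmf)

lemma set_rw: "xs \<in> set_pmf (rw_pmf n) \<Longrightarrow> set xs \<subseteq> srw_steps"
  by (auto simp: set_replicate_pmf in_lists_conv_set)

lemma int_to_real_vec_add: "int_to_real_vec (x + y) = int_to_real_vec x + int_to_real_vec y"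
  by (simp add: int_to_real_vec_def vec_eq_iff)

lemma int_to_real_vec_diff: "int_to_real_vec (x - y) = int_to_real_vec x - int_to_real_vec y"
  by (simp add: int_to_real_vec_def vec_eq_iff)

lemma int_to_real_vec_minus: "int_to_real_vec (- x) = - int_to_real_vec x"
  by (simp add: int_to_real_vec_def vec_eq_iff)

lemma int_to_real_vec_0 [simp]: "int_to_real_vec 0 = 0"
  by (simp add: int_to_real_vec_def vec_eq_iff)

lemma int_to_real_vec_axis: "int_to_real_vec (axis c a) = axis c (real_of_int a)"
  by (simp add: int_to_real_vec_def vec_eq_iff axis_def)

abbreviation rpos :: "('d::finite) site list \<Rightarrow> real ^ 'd" where
  "rpos xs \<equiv> int_to_real_vec (sum_list xs)"

lemma axis_minus: "axis c (- a :: 'a::group_add) = - axis c a"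
  by (simp add: axis_def vec_eq_iff)

lemma norm_srw_step: "v \<in> srw_steps \<Longrightarrow> norm (int_to_real_vec v) = 1"
  by (auto simp: srw_steps_eq int_to_real_vec_axis int_to_real_vec_minus norm_axis_1 axis_minus)

lemma sum_component_sq: "(\<Sum>c\<in>UNIV. (u $ c)\<^sup>2) = (norm (u :: real ^ 'd::finite))\<^sup>2"
  by (simp add: norm_vec_def L2_set_def sum_nonneg)

lemma rw_proj_moment1:
  "pexp (rw_pmf n) (\<lambda>xs. u \<bullet> rpos xs) = 0"
proof (induction n)
  case (Suc n)
  have "pexp (rw_pmf (Suc n)) (\<lambda>xs. u \<bullet> rpos xs) = pexp (rw_pmf n) (\<lambda>xs. u \<bullet> rpos xs)"
    unfolding pexp_rw_snoc
    by (simp add: pexp_step int_to_real_vec_add int_to_real_vec_axis inner_add_right inner_axis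
        sum.distrib field_simps)
  with Suc show ?case by simp
qed simp

lemma rw_proj_moment2:
  fixes u :: "real ^ 'd::finite"
  shows "pexp (rw_pmf n) (\<lambda>xs. (u \<bullet> rpos xs)\<^sup>2) = real n * (norm u)\<^sup>2 / CARD('d)"
proof (induction n)
  case (Suc n)
  have "pexp (rw_pmf (Suc n)) (\<lambda>xs. (u \<bullet> rpos xs)\<^sup>2)
    = pexp (rw_pmf n) (\<lambda>xs. (u \<bullet> rpos xs)\<^sup>2 + (norm u)\<^sup>2 / CARD('d))"
    unfolding pexp_rw_snoc
    by (intro pexp_cong) (simp add: pexp_step int_to_real_vec_add int_to_real_vec_axis inner_add_right inner_axis
        sum.distrib power2_sum power2_diff sum_component_sq[symmetric] add_divide_distrib
        sum_distrib_left[symmetric])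
  also have "\<dots> = real (Suc n) * (norm u)\<^sup>2 / CARD('d)"
    using Suc by (simp add: pexp_add field_simps)
  finally show ?case .
qed simp

text \<open>Odd powers cancel between the steps in opposite directions. The leading term is the
  Gaussian value; the linear term is absorbed once n is at least the dimension, giving the kurtosis
  bound 4.\<close>

lemma rw_proj_moment4:
  fixes u :: "real ^ 'd::finite"
  assumes "norm u = 1"
  shows "pexp (rw_pmf n) (\<lambda>xs. (u \<bullet> rpos xs) ^ 4) \<le> 3 * (real n / CARD('d))\<^sup>2 + real n / CARD('d)"
proof (induction n)
  case (Suc n)
  let ?d = "real CARD('d)"
  have d: "?d > 0" by simp
  have c4: "(\<Sum>c\<in>UNIV. (u $ c) ^ 4) \<le> 1"
  proof -
    have "\<bar>u $ c\<bar> \<le> 1" for c using component_le_norm_cart[of u c] assms by simp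
    then have "(u $ c)\<^sup>2 \<le> 1" for c by (simp add: abs_square_le_1)
    then have "(u $ c) ^ 4 \<le> (u $ c)\<^sup>2" for c
      using mult_left_le[of "(u $ c)\<^sup>2" "(u $ c)\<^sup>2"] by (simp add: power4_eq_xxxx power2_eq_square)
    then have "(\<Sum>c\<in>UNIV. (u $ c) ^ 4) \<le> (\<Sum>c\<in>UNIV. (u $ c)\<^sup>2)" by (intro sum_mono) auto
    then show ?thesis using assms by (simp add: sum_component_sq)
  qed
  have poly: "(y + a) ^ 4 + (y - a) ^ 4 = 2 * y ^ 4 + 12 * y\<^sup>2 * a\<^sup>2 + 2 * a ^ 4" for y a :: real
    by (simp add: power4_eq_xxxx power2_eq_square algebra_simps)
  have "pexp step_pmf (\<lambda>v. (u \<bullet> rpos (xs @ [v])) ^ 4) \<le>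
      (u \<bullet> rpos xs) ^ 4 + ((u \<bullet> rpos xs)\<^sup>2 * (6 / ?d) + 1 / ?d)" for xs
  proof -
    let ?y = "u \<bullet> rpos xs"
    have "pexp step_pmf (\<lambda>v. (u \<bullet> rpos (xs @ [v])) ^ 4)
      = (\<Sum>c\<in>UNIV. (?y + u $ c) ^ 4 + (?y - u $ c) ^ 4) / (2 * ?d)"
      by (simp add: pexp_step int_to_real_vec_add int_to_real_vec_axis inner_add_right inner_axis)
    also have "\<dots> = (2 * ?d * ?y ^ 4 + 12 * ?y\<^sup>2 + 2 * (\<Sum>c\<in>UNIV. (u $ c) ^ 4)) / (2 * ?d)"
      unfolding poly using assms
      by (simp add: sum.distrib sum_distrib_left[symmetric] sum_component_sq)
    also have "\<dots> \<le> (2 * ?d * ?y ^ 4 + 12 * ?y\<^sup>2 + 2 * 1) / (2 * ?d)"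
      using c4 by (intro divide_right_mono) auto
    also have "\<dots> = ?y ^ 4 + (?y\<^sup>2 * (6 / ?d) + 1 / ?d)" by (simp add: field_simps)
    finally show ?thesis .
  qed
  then have "pexp (rw_pmf (Suc n)) (\<lambda>xs. (u \<bullet> rpos xs) ^ 4)
    \<le> pexp (rw_pmf n) (\<lambda>xs. (u \<bullet> rpos xs) ^ 4 + ((u \<bullet> rpos xs)\<^sup>2 * (6 / ?d) + 1 / ?d))"
    unfolding pexp_rw_snoc by (intro pexp_mono) auto
  also have "\<dots> = pexp (rw_pmf n) (\<lambda>xs. (u \<bullet> rpos xs) ^ 4) + (real n / ?d * (6 / ?d) + 1 / ?d)"
    using assms by (simp add: pexp_add rw_proj_moment2)
  also have "\<dots> \<le> 3 * (real n / ?d)\<^sup>2 + real n / ?d + (real n / ?d * (6 / ?d) + 1 / ?d)"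
    using Suc by simp
  also have "\<dots> \<le> 3 * (real (Suc n) / ?d)\<^sup>2 + real (Suc n) / ?d"
    by (simp add: power2_eq_square field_simps)
  finally show ?case .
qed simp

lemma rw_norm_moment2: "pexp (rw_pmf n) (\<lambda>xs. (norm (a + rpos xs))\<^sup>2) = (norm (a::real ^ 'd::finite))\<^sup>2 + real n"
proof -
  have "pexp (rw_pmf n) (\<lambda>xs. (norm (a + rpos xs))\<^sup>2)
    = pexp (rw_pmf n) (\<lambda>xs. (norm a)\<^sup>2 + ((2 *\<^sub>R a) \<bullet> rpos xs + (\<Sum>c\<in>UNIV. (axis c 1 \<bullet> rpos xs)\<^sup>2)))"
    by (intro pexp_cong) (simp add: inner_axis' sum_component_sq, simp add: power2_norm_eq_inner
        inner_add_left inner_add_right inner_commute)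
  also have "\<dots> = (norm a)\<^sup>2 + (\<Sum>c\<in>(UNIV::'d set). real n / CARD('d))"
    unfolding pexp_add[OF finite_rw] pexp_sum[OF finite_rw] rw_proj_moment1 rw_proj_moment2
    by simp
  finally show ?thesis by simp
qed

lemma rw_uminus: "map_pmf (map uminus) (rw_pmf n) = (rw_pmf n :: ('d::finite) site list pmf)"
proof (induction n)
  case (Suc n)
  have s: "map_pmf uminus step_pmf = (step_pmf :: 'd site pmf)"
  proof -
    have "uminus ` srw_steps = (srw_steps :: 'd site set)"
    proof -
      have n: "- axis c (1::int) = axis c (-1)" "- axis c (-1::int) = axis c 1" for c :: 'd
        by (auto simp: axis_def vec_eq_iff)
      show ?thesis unfolding srw_steps_eq image_Un image_image n by auto
    qed
    then show ?thesis unfolding step_pmf_def by (subst map_pmf_of_set_inj) auto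
  qed
  have "map_pmf (map uminus) (rw_pmf (Suc n) :: 'd site list pmf)
    = bind_pmf (map_pmf uminus step_pmf) (\<lambda>x. bind_pmf (map_pmf (map uminus) (rw_pmf n)) (\<lambda>xs. return_pmf (x # xs)))"
    by (simp add: map_bind_pmf bind_map_pmf)
  also have "\<dots> = rw_pmf (Suc n)" unfolding s Suc by simp
  finally show ?case .
qed simp

lemma sum_list_uminus: "sum_list (map uminus xs) = - sum_list (xs :: ('d::finite) site list)"
  by (induction xs) auto

lemma rw_prob_symmetric:
  "pprob (rw_pmf n) {xs. P (- rpos xs)} = pprob (rw_pmf n) {xs. P (rpos xs)}"
proof -
  have "pprob (rw_pmf n) {xs. P (rpos xs)} = pprob (map_pmf (map uminus) (rw_pmf n)) {xs. P (rpos xs)}"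
    by (simp add: rw_uminus)
  also have "\<dots> = pprob (rw_pmf n) {xs. P (- rpos xs)}"
    by (simp add: vimage_def sum_list_uminus int_to_real_vec_minus)
  finally show ?thesis by simp
qed

text \<open>With variance s = n / d, the factor 36 is chosen so that (3 l)^2 \<le> s / 4, the
  threshold of \<open>paley_zygmund\<close>. Symmetry of the walk then halves 9/64 to get a
  prescribed sign.\<close>

lemma rw_proj_large:
  fixes u :: "real ^ 'd::finite" and l :: real
  assumes "norm u = 1" "36 * CARD('d) * l\<^sup>2 \<le> real n" "CARD('d) \<le> n" "l \<ge> 0"
  shows "pprob (rw_pmf n) {xs. u \<bullet> rpos xs \<ge> 3 * l} \<ge> 9 / 128"
proof -
  let ?d = "real CARD('d)"
  define s where "s = real n / ?d"
  have n: "n > 0" using assms(3) by (metis gr0I le_zero_eq zero_less_card_finite less_numeral_extra(3))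
  have s1: "s \<ge> 1" using assms(3) by (simp add: s_def)
  have "pprob (rw_pmf n) {xs. (u \<bullet> rpos xs)\<^sup>2 \<ge> s / 4} \<ge> 9 / 64"
  proof (rule paley_zygmund)
    show "pexp (rw_pmf n) (\<lambda>xs. (u \<bullet> rpos xs)\<^sup>2) = s" using assms(1) by (simp add: rw_proj_moment2 s_def)
    have "s \<le> s\<^sup>2" using s1 by (simp add: power2_eq_square)
    then show "pexp (rw_pmf n) (\<lambda>xs. (u \<bullet> rpos xs) ^ 4) \<le> 4 * s\<^sup>2"
      using rw_proj_moment4[OF assms(1), of n] by (simp add: s_def)
  qed (use s1 in auto)
  also have "pprob (rw_pmf n) {xs. (u \<bullet> rpos xs)\<^sup>2 \<ge> s / 4}
    \<le> pprob (rw_pmf n) ({xs. u \<bullet> rpos xs \<ge> 3 * l} \<union> {xs. u \<bullet> (- rpos xs) \<ge> 3 * l})"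
  proof (rule measure_pmf.finite_measure_mono, rule subsetI)
    fix xs assume "xs \<in> {xs. (u \<bullet> rpos xs)\<^sup>2 \<ge> s / 4}"
    then have *: "s / 4 \<le> (u \<bullet> rpos xs)\<^sup>2" by simp
    have "(3 * l)\<^sup>2 = (36 * CARD('d) * l\<^sup>2) / (4 * ?d)" by (simp add: power2_eq_square)
    also have "\<dots> \<le> real n / (4 * ?d)" using assms(2) by (intro divide_right_mono) auto
    also have "\<dots> = s / 4" by (simp add: s_def)
    finally have "(3 * l)\<^sup>2 \<le> (u \<bullet> rpos xs)\<^sup>2" using * by linarith
    then have "3 * l \<le> \<bar>u \<bullet> rpos xs\<bar>" using assms(4) by (metis abs_le_square_iff abs_of_nonneg mult_nonneg_nonneg zero_le_numeral)
    then show "xs \<in> {xs. u \<bullet> rpos xs \<ge> 3 * l} \<union> {xs. u \<bullet> (- rpos xs) \<ge> 3 * l}" by auto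
  qed simp
  also have "\<dots> \<le> pprob (rw_pmf n) {xs. u \<bullet> rpos xs \<ge> 3 * l}
      + pprob (rw_pmf n) {xs. u \<bullet> (- rpos xs) \<ge> 3 * l}"
    by (rule measure_Un_le) auto
  also have "pprob (rw_pmf n) {xs. u \<bullet> (- rpos xs) \<ge> 3 * l} = pprob (rw_pmf n) {xs. u \<bullet> rpos xs \<ge> 3 * l}"
    by (rule rw_prob_symmetric)
  finally show ?thesis by simp
qed

section \<open>Return probabilities and the range of the walk\<close>

fun srw1_kernel :: "nat \<Rightarrow> int \<Rightarrow> real" where
  "srw1_kernel 0 z = of_bool (z = 0)"
| "srw1_kernel (Suc n) z = (srw1_kernel n (z - 1) + srw1_kernel n (z + 1)) / 2"

lemma srw1_kernel_nonneg: "0 \<le> srw1_kernel n z"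
  by (induction n arbitrary: z) auto

lemma srw1_kernel_odd: "odd (int n + z) \<Longrightarrow> srw1_kernel n z = 0"
  by (induction n arbitrary: z) auto

lemma srw1_kernel_binomial:
  "srw1_kernel n (2 * j - int n) = (if j < 0 then 0 else real (n choose nat j)) / 2 ^ n"
proof (induction n arbitrary: j)
  case 0
  then show ?case by (cases "j = 0") (auto simp: binomial_eq_0)
next
  case (Suc n)
  have *: "2 * j - int (Suc n) - 1 = 2 * (j - 1) - int n" "2 * j - int (Suc n) + 1 = 2 * j - int n" by auto
  consider "j < 0" | "j = 0" | k where "j = int (Suc k)"
    by (metis not_less_iff_gr_or_eq zero_less_imp_eq_int gr0_implies_Suc of_nat_0_less_iff)
  then show ?case
  proof cases
    case 3
    have n: "nat (int (Suc k) - 1) = k" "nat (int (Suc k)) = Suc k" by auto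
    show ?thesis unfolding srw1_kernel.simps * Suc unfolding 3 n by (simp add: field_simps)
  next
    case 1
    then show ?thesis unfolding srw1_kernel.simps *  Suc by simp
  next
    case 2
    then show ?thesis unfolding srw1_kernel.simps * Suc by simp
  qed
qed

text \<open>The factor 2 k + 1 makes the bound inductive: passing from k to k + 1 only needs (2 k +
  1)(2 k + 3) \<le> 4 (k + 1)^2. It replaces Stirling's formula.\<close>

lemma central_binomial_le: "(real ((2 * k) choose k))\<^sup>2 * (2 * k + 1) \<le> (4 ^ k)\<^sup>2"
proof (induction k)
  case (Suc k)
  define b where "b = real ((2 * k) choose k)"
  have "Suc k * ((2 * Suc k) choose Suc k) = (2 * Suc k) * (Suc (2 * k) choose k)"
    using Suc_times_binomial[of k "Suc (2 * k)"] by simp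
  also have "Suc k * (Suc (2 * k) choose k) = Suc (2 * k) * ((2 * k) choose k)"
  proof -
    have "Suc (2 * k) - k = Suc k" by simp
    then have "(Suc (2 * k) choose k) = (Suc (2 * k) choose Suc k)"
      using binomial_symmetric[of k "Suc (2 * k)"] by simp
    then show ?thesis by (simp only: Suc_times_binomial)
  qed
  then have "(2 * Suc k) * (Suc (2 * k) choose k) = 2 * (Suc (2 * k) * ((2 * k) choose k))" by simp
  finally have "real (Suc k * ((2 * Suc k) choose Suc k)) = real (2 * (Suc (2 * k) * ((2 * k) choose k)))"
    by (rule arg_cong)
  then have e: "real ((2 * Suc k) choose Suc k) = 2 * (2 * real k + 1) * b / (real k + 1)"
    by (simp add: b_def field_simps)
  have "4 * (2 * real k + 1) * (2 * real k + 3) \<le> 16 * (real k + 1)\<^sup>2"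
    by (simp add: power2_eq_square field_simps)
  then have k: "4 * (2 * real k + 1) * (2 * real k + 3) / (real k + 1)\<^sup>2 \<le> 16"
    by (simp add: divide_le_eq)
  have "(real ((2 * Suc k) choose Suc k))\<^sup>2 * real (2 * Suc k + 1)
     = (b\<^sup>2 * (2 * real k + 1)) * (4 * (2 * real k + 1) * (2 * real k + 3) / (real k + 1)\<^sup>2)"
    unfolding e by (simp add: power_mult_distrib power_divide) (simp add: power2_eq_square field_simps)
  also have "\<dots> \<le> (4 ^ k)\<^sup>2 * 16"
    using Suc k by (intro mult_mono) (auto simp: b_def add.commute)
  also have "\<dots> = (4 ^ Suc k)\<^sup>2" by (simp add: power_mult_distrib)
  finally show ?case by simp
qed simp

lemma srw1_kernel_0_le: "srw1_kernel n 0 \<le> 1 / sqrt (real (Suc n))"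
proof (cases "even n")
  case True
  then obtain k where k: "n = 2 * k" by blast
  define b where "b = real ((2 * k) choose k) / 4 ^ k"
  have "srw1_kernel n 0 = b"
    using srw1_kernel_binomial[of n "int k"] by (simp add: k b_def power_mult)
  moreover have "b\<^sup>2 * (2 * real k + 1) \<le> 1"
    using central_binomial_le[of k] by (simp add: b_def power_divide divide_le_eq add.commute)
  then have "b\<^sup>2 \<le> 1 / (2 * real k + 1)" by (subst pos_le_divide_eq) auto
  then have "b \<le> sqrt (1 / (2 * real k + 1))" by (rule real_le_rsqrt)
  then have "b \<le> 1 / sqrt (real (Suc n))" by (simp add: k real_sqrt_divide add.commute)
  ultimately show ?thesis by simp
qed (simp add: srw1_kernel_odd)

text \<open>The law of the numbers of steps taken along each axis. Given these counts, the
  coordinates are independent one-dimensional walks; this is the content of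
  \<open>rw_prob_eq\<close>.\<close>

primrec count_pmf :: "nat \<Rightarrow> ('d::finite \<Rightarrow> nat) pmf" where
  "count_pmf 0 = return_pmf (\<lambda>_. 0)"
| "count_pmf (Suc n) = bind_pmf (count_pmf n)
     (\<lambda>N. map_pmf (\<lambda>c. N(c := Suc (N c))) (pmf_of_set UNIV))"

lemma finite_count_pmf [simp]: "finite (set_pmf (count_pmf n))"
  by (induction n) auto

lemma count_pmf_le: "N \<in> set_pmf (count_pmf n) \<Longrightarrow> N c \<le> n"
  by (induction n arbitrary: N) (auto simp: le_SucI)

lemma pexp_count_Suc:
  fixes f :: "('d::finite \<Rightarrow> nat) \<Rightarrow> real"
  shows "pexp (count_pmf (Suc n)) f
    = pexp (count_pmf n) (\<lambda>N. (\<Sum>c\<in>UNIV. f (N(c := Suc (N c)))) / real CARD('d))"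
  by (simp add: pexp_bind integral_pmf_of_set)

lemma rw_prob_eq:
  fixes z :: "('d::finite) site"
  shows "pprob (rw_pmf n) {xs. sum_list xs = z}
    = pexp (count_pmf n) (\<lambda>N. \<Prod>c\<in>UNIV. srw1_kernel (N c) (z $ c))"
proof (induction n arbitrary: z)
  case 0
  have "(\<Prod>c\<in>UNIV. of_bool (z $ c = 0) :: real) = of_bool (z = 0)"
    by (cases "z = 0") (auto simp: vec_eq_iff)
  then show ?case by (auto simp: indicator_def)
next
  case (Suc n)
  let ?d = "real CARD('d)"
  have "pprob (rw_pmf (Suc n)) {xs. sum_list xs = z}
    = pexp (rw_pmf n) (\<lambda>xs. pexp step_pmf (\<lambda>v. of_bool (sum_list xs + v = z)))"
    by (simp only: pexp_of_bool[symmetric] pexp_rw_snoc sum_list_append) simp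
  also have "\<dots> = pexp (rw_pmf n) (\<lambda>xs. (\<Sum>c\<in>UNIV. of_bool (sum_list xs = z - axis c 1)
      + of_bool (sum_list xs = z + axis c 1)) / (2 * ?d))"
  proof -
    have "sum_list xs + axis c (- 1) = z \<longleftrightarrow> sum_list xs = z + axis c 1"
      "sum_list xs + axis c 1 = z \<longleftrightarrow> sum_list xs = z - axis c 1" for xs :: "'d site list" and c
      by (auto simp: axis_minus)
    then show ?thesis by (simp add: pexp_step)
  qed
  also have "\<dots> = (\<Sum>c\<in>UNIV. pprob (rw_pmf n) {xs. sum_list xs = z - axis c 1}
      + pprob (rw_pmf n) {xs. sum_list xs = z + axis c 1}) / (2 * ?d)"
    by (simp add: pexp_sum pexp_add pexp_of_bool[symmetric])
  also have "\<dots> = pexp (count_pmf n) (\<lambda>N. (\<Sum>c\<in>UNIV. (\<Prod>c'\<in>UNIV. srw1_kernel (N c') ((z - axis c 1) $ c'))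
      + (\<Prod>c'\<in>UNIV. srw1_kernel (N c') ((z + axis c 1) $ c'))) / (2 * ?d))"
    unfolding Suc by (simp add: pexp_sum pexp_add)
  also have "\<dots> = pexp (count_pmf n) (\<lambda>N. (\<Sum>c\<in>UNIV. \<Prod>c'\<in>UNIV. srw1_kernel ((N(c := Suc (N c))) c') (z $ c')) / ?d)"
  proof (rule pexp_cong)
    fix N :: "'d \<Rightarrow> nat"
    have "(\<Prod>c'\<in>UNIV. srw1_kernel (N c') ((z - axis c 1) $ c')) + (\<Prod>c'\<in>UNIV. srw1_kernel (N c') ((z + axis c 1) $ c'))
      = 2 * (\<Prod>c'\<in>UNIV. srw1_kernel ((N(c := Suc (N c))) c') (z $ c'))" for c
    proof -
      let ?P = "\<Prod>c'\<in>UNIV - {c}. srw1_kernel (N c') (z $ c')"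
      have "(\<Prod>c'\<in>UNIV - {c}. srw1_kernel (N c') ((z - axis c 1) $ c')) = ?P"
        "(\<Prod>c'\<in>UNIV - {c}. srw1_kernel (N c') ((z + axis c 1) $ c')) = ?P"
        "(\<Prod>c'\<in>UNIV - {c}. srw1_kernel ((N(c := Suc (N c))) c') (z $ c')) = ?P"
        by (rule prod.cong; simp add: axis_def)+
      moreover have "prod f UNIV = f c * prod f (UNIV - {c})" for f :: "'d \<Rightarrow> real"
        by (rule prod.remove) auto
      ultimately show ?thesis by (simp add: algebra_simps)
    qed
    then show "(\<Sum>c\<in>UNIV. (\<Prod>c'\<in>UNIV. srw1_kernel (N c') ((z - axis c 1) $ c'))
      + (\<Prod>c'\<in>UNIV. srw1_kernel (N c') ((z + axis c 1) $ c'))) / (2 * ?d)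
      = (\<Sum>c\<in>UNIV. \<Prod>c'\<in>UNIV. srw1_kernel ((N(c := Suc (N c))) c') (z $ c')) / ?d"
      by (simp add: sum_distrib_left[symmetric])
  qed
  also have "\<dots> = pexp (count_pmf (Suc n)) (\<lambda>N. \<Prod>c\<in>UNIV. srw1_kernel (N c) (z $ c))"
    by (simp only: pexp_count_Suc)
  finally show ?case .
qed

text \<open>Each value of the count of a fixed coordinate is kept for a geometric time of mean \<open>d\<close>.\<close>

lemma sum_count_le:
  fixes f :: "nat \<Rightarrow> real" and c :: "'d::finite"
  assumes "\<And>k. 0 \<le> f k"
  shows "(\<Sum>l<n. pexp (count_pmf l) (\<lambda>N. f (N c))) \<le> real CARD('d) * (\<Sum>k<n. f k)"
proof -
  \<comment> \<open>\<open>F\<close> is a potential: each step moves the chosen count with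
    probability 1 / d, so the mean of \<open>F (N c)\<close> grows by the mean of
    \<open>f (N c)\<close> divided by d, and the sum telescopes.\<close>
  define F where "F k = (\<Sum>j<k. f j)" for k
  let ?d = "real CARD('d)"
  have step: "pexp (count_pmf (Suc l)) (\<lambda>N. F (N c))
      = pexp (count_pmf l) (\<lambda>N. F (N c)) + pexp (count_pmf l) (\<lambda>N. f (N c)) / ?d" for l
  proof -
    have "(\<Sum>c'\<in>UNIV. F ((N(c' := Suc (N c'))) c)) = ?d * F (N c) + f (N c)" for N
    proof -
      have "(\<Sum>c'\<in>UNIV. F ((N(c' := Suc (N c'))) c)) = (\<Sum>c'\<in>UNIV. F (N c) + (if c' = c then f (N c) else 0))"
        by (rule sum.cong) (auto simp: F_def)
      then show ?thesis by (simp add: sum.distrib)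
    qed
    then have "pexp (count_pmf (Suc l)) (\<lambda>N. F (N c)) = pexp (count_pmf l) (\<lambda>N. F (N c) + f (N c) / ?d)"
      by (simp only: pexp_count_Suc) (simp add: add_divide_distrib)
    then show ?thesis by (simp add: pexp_add)
  qed
  have "(\<Sum>l<n. pexp (count_pmf l) (\<lambda>N. f (N c))) = ?d * pexp (count_pmf n) (\<lambda>N. F (N c))"
    by (induction n) (simp_all add: F_def step[unfolded F_def] field_simps del: count_pmf.simps(2))
  also have "\<dots> \<le> ?d * pexp (count_pmf n) (\<lambda>_ :: 'd \<Rightarrow> nat. F n)"
    by (intro mult_left_mono pexp_mono)
      (auto simp: F_def assms intro!: sum_mono2 dest!: count_pmf_le[where c = c])
  finally show ?thesis by (simp add: F_def)
qed

definition return_prob :: "'d::finite itself \<Rightarrow> nat \<Rightarrow> real" where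
  "return_prob _ l = pprob (rw_pmf l) {xs. sum_list xs = (0 :: 'd site)}"

text \<open>Each of the d one-dimensional factors is at most the bound for the smallest count, so
  their product is at most \<open>f\<close> of that count, hence at most the sum of \<open>f\<close>
  over all coordinates. One factor d comes from that sum and one from \<open>sum_count_le\<close>.
  No local limit theorem enters.\<close>

lemma sum_return_prob_le:
  "(\<Sum>l<n. return_prob TYPE('d::finite) l)
    \<le> (real CARD('d))\<^sup>2 * (\<Sum>k<n. (1 / sqrt (real (Suc k))) ^ CARD('d))"
proof -
  define f :: "nat \<Rightarrow> real" where "f k = (1 / sqrt (real (Suc k))) ^ CARD('d)" for k
  have f0: "0 \<le> f k" for k by (simp add: f_def)
  have "return_prob TYPE('d) l \<le> (\<Sum>c\<in>(UNIV::'d set). pexp (count_pmf l) (\<lambda>N. f (N c)))" for l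
  proof -
    have "return_prob TYPE('d) l = pexp (count_pmf l) (\<lambda>N :: 'd \<Rightarrow> nat. \<Prod>c\<in>UNIV. srw1_kernel (N c) 0)"
      by (simp add: return_prob_def rw_prob_eq)
    also have "\<dots> \<le> pexp (count_pmf l) (\<lambda>N :: 'd \<Rightarrow> nat. \<Sum>c\<in>UNIV. f (N c))"
    proof (rule pexp_mono)
      fix N :: "'d \<Rightarrow> nat"
      obtain c0 where c0: "\<And>c. N c0 \<le> N c"
        using Min_in[of "range N"] by (metis Min_le finite finite_imageI imageE empty_not_UNIV image_is_empty rangeI)
      have "(\<Prod>c\<in>UNIV. srw1_kernel (N c) 0) \<le> (\<Prod>c\<in>(UNIV::'d set). 1 / sqrt (real (Suc (N c0))))"
      proof (rule prod_mono, rule conjI)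
        fix c
        have "srw1_kernel (N c) 0 \<le> 1 / sqrt (real (Suc (N c)))" by (rule srw1_kernel_0_le)
        also have "\<dots> \<le> 1 / sqrt (real (Suc (N c0)))"
          using c0[of c] by (intro divide_left_mono) auto
        finally show "srw1_kernel (N c) 0 \<le> 1 / sqrt (real (Suc (N c0)))" .
      qed (rule srw1_kernel_nonneg)
      also have "\<dots> = f (N c0)" by (simp add: f_def)
      also have "\<dots> \<le> (\<Sum>c\<in>UNIV. f (N c))"
        by (rule member_le_sum) (auto simp: f0)
      finally show "(\<Prod>c\<in>UNIV. srw1_kernel (N c) 0) \<le> (\<Sum>c\<in>UNIV. f (N c))" .
    qed simp
    finally show ?thesis by (simp add: pexp_sum)
  qed
  then have "(\<Sum>l<n. return_prob TYPE('d) l)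
      \<le> (\<Sum>l<n. \<Sum>c\<in>(UNIV::'d set). pexp (count_pmf l) (\<lambda>N. f (N c)))"
    by (intro sum_mono) auto
  also have "\<dots> = (\<Sum>c\<in>(UNIV::'d set). \<Sum>l<n. pexp (count_pmf l) (\<lambda>N. f (N c)))"
    by (rule sum.swap)
  also have "\<dots> \<le> (\<Sum>c\<in>(UNIV::'d set). real CARD('d) * (\<Sum>k<n. f k))"
    by (intro sum_mono sum_count_le f0)
  finally show ?thesis by (simp add: f_def power2_eq_square)
qed

section \<open>The number of distinct sites visited within a ball\<close>

lemma pexp_rw_take:
  assumes "k \<le> n"
  shows "pexp (rw_pmf n) (\<lambda>xs. f (take k xs)) = pexp (rw_pmf k) f"
proof -
  have "pexp (rw_pmf (k + (n - k))) (\<lambda>xs. f (take k xs)) = pexp (rw_pmf k) f"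
    unfolding pexp_rw_add by (intro pexp_cong) (simp add: length_rw)
  then show ?thesis using assms by simp
qed

lemma pexp_rw_drop:
  "pexp (rw_pmf (j + n)) (\<lambda>xs :: ('d::finite) site list. f (drop j xs)) = pexp (rw_pmf n) f"
proof -
  have "pexp (rw_pmf (j + n)) (\<lambda>xs. f (drop j xs)) = pexp (rw_pmf j) (\<lambda>xs :: 'd site list. pexp (rw_pmf n) f)"
    unfolding pexp_rw_add by (intro pexp_cong) (simp add: length_rw)
  then show ?thesis by simp
qed

lemma rw_prob_meet:
  assumes "j \<le> k" "k \<le> n"
  shows "pexp (rw_pmf n) (\<lambda>xs. of_bool (sum_list (take j xs) = sum_list (take k xs :: ('d::finite) site list)))
    = return_prob TYPE('d) (k - j)"
proof -
  have "pexp (rw_pmf n) (\<lambda>xs. of_bool (sum_list (take j xs) = sum_list (take k xs :: 'd site list)))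
    = pexp (rw_pmf n) (\<lambda>xs. of_bool (sum_list (take (k - j) (drop j xs)) = (0 :: 'd site)))"
  proof (rule pexp_cong)
    fix xs :: "'d site list"
    have "take k xs = take j xs @ take (k - j) (drop j xs)"
      using assms by (metis le_add_diff_inverse take_add)
    then show "of_bool (sum_list (take j xs) = sum_list (take k xs))
      = (of_bool (sum_list (take (k - j) (drop j xs)) = 0) :: real)" by simp
  qed
  also have "\<dots> = pexp (rw_pmf (j + (n - j))) (\<lambda>xs. of_bool (sum_list (take (k - j) (drop j xs)) = (0 :: 'd site)))"
    using assms by simp
  also have "\<dots> = pexp (rw_pmf (n - j)) (\<lambda>xs. of_bool (sum_list (take (k - j) xs) = (0 :: 'd site)))"
    by (rule pexp_rw_drop)
  also have "\<dots> = return_prob TYPE('d) (k - j)"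
    using assms by (subst pexp_rw_take) (auto simp: return_prob_def pexp_of_bool)
  finally show ?thesis .
qed

lemma rw_prob_far:
  assumes "a > 0"
  shows "pprob (rw_pmf n) {xs :: ('d::finite) site list. a < norm (rpos xs)} \<le> real n / a\<^sup>2"
proof -
  have "pprob (rw_pmf n) {xs :: 'd site list. a < norm (rpos xs)}
    \<le> pprob (rw_pmf n) {xs :: 'd site list. a\<^sup>2 < (norm (rpos xs))\<^sup>2}"
    using assms by (intro prob_mono power_strict_mono) auto
  also have "\<dots> \<le> pexp (rw_pmf n) (\<lambda>xs :: 'd site list. (norm (rpos xs))\<^sup>2) / a\<^sup>2"
    using assms by (intro pexp_markov) auto
  also have "\<dots> = real n / a\<^sup>2" using rw_norm_moment2[of n "0 :: real ^ 'd"] by simp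
  finally show ?thesis .
qed

definition local_range :: "nat \<Rightarrow> real \<Rightarrow> ('d::finite) site list \<Rightarrow> 'd site set" where
  "local_range n a xs = {p \<in> (\<lambda>k. sum_list (take k xs)) ` {..<n}. norm (int_to_real_vec p) \<le> a}"

text \<open>Let \<open>out\<close> be the time spent outside the ball and \<open>I\<close> the
  number of pairs of times at the same site. Cauchy-Schwarz over local times gives (n - out)^2 \<le>
  I * card V. The means are at most n / 8 and 2 n G, so by Markov each of out > n / 2 and I > 8 n G
  has probability at most 1/4; outside both, card V is at least (n / 2)^2 / (8 n G).\<close>

lemma local_range_large:
  fixes n :: nat and a G :: real
  assumes n: "n > 0" and a: "a > 0" "8 * real n \<le> a\<^sup>2"
    and G: "(\<Sum>l<n. return_prob TYPE('d::finite) l) \<le> G" "G > 0"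
  shows "pprob (rw_pmf n) {xs :: 'd site list. real n / (32 * G) \<le> card (local_range n a xs)} \<ge> 1 / 2"
proof -
  let ?S = "\<lambda>k (xs :: 'd site list). sum_list (take k xs)"
  define out where "out xs = (\<Sum>k<n. of_bool (a < norm (int_to_real_vec (?S k xs))) :: real)" for xs
  define I where "I xs = (\<Sum>j<n. \<Sum>k<n. of_bool (?S j xs = ?S k xs) :: real)" for xs
  have nonneg: "0 \<le> out xs" "0 \<le> I xs" for xs by (auto simp: out_def I_def intro!: sum_nonneg)
  have "pexp (rw_pmf n) out = (\<Sum>k<n. pexp (rw_pmf n) (\<lambda>xs :: 'd site list. of_bool (a < norm (rpos (take k xs)))))"
    unfolding out_def by (rule pexp_sum) simp
  also have "\<dots> = (\<Sum>k<n. pprob (rw_pmf k) {xs :: 'd site list. a < norm (rpos xs)})"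
    by (intro sum.cong refl) (subst pexp_rw_take[where f = "\<lambda>xs. of_bool (a < norm (rpos xs))"]; simp add: pexp_of_bool)
  also have "\<dots> \<le> (\<Sum>k<n. real n / a\<^sup>2)"
    by (intro sum_mono order.trans[OF rw_prob_far] divide_right_mono) (use a in auto)
  also have "\<dots> \<le> real n / 8" using a n by (simp add: field_simps)
  finally have "pprob (rw_pmf n) {xs. real n / 2 < out xs} \<le> (real n / 8) / (real n / 2)"
    using n by (intro order.trans[OF pexp_markov] divide_right_mono) (auto simp: nonneg)
  then have 1: "pprob (rw_pmf n) {xs. real n / 2 < out xs} \<le> 1 / 4" using n by simp
  have "pexp (rw_pmf n) I \<le> (\<Sum>j<n. \<Sum>k<n. return_prob TYPE('d) (max j k - min j k))"
  proof -
    have "pexp (rw_pmf n) (\<lambda>xs. of_bool (?S j xs = ?S k xs)) = return_prob TYPE('d) (max j k - min j k)"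
      if "j < n" "k < n" for j k
    proof (cases "j \<le> k")
      case True
      then show ?thesis using rw_prob_meet[of j k n, where 'd = 'd] that by (simp add: max_def min_def)
    next
      case False
      have "(?S j xs = ?S k xs) = (?S k xs = ?S j xs)" for xs by (rule eq_commute)
      then show ?thesis
        using rw_prob_meet[of k j n, where 'd = 'd] that False by (simp add: max_def min_def)
    qed
    then have "pexp (rw_pmf n) I = (\<Sum>j<n. \<Sum>k<n. return_prob TYPE('d) (max j k - min j k))"
      unfolding I_def by (simp only: pexp_sum finite_rw) (intro sum.cong; simp)
    then show ?thesis by simp
  qed
  also have "\<dots> \<le> (\<Sum>j<n. 2 * G)"
  proof (rule sum_mono)
    fix j assume "j \<in> {..<n}"
    have r0: "0 \<le> return_prob TYPE('d) l" for l by (simp add: return_prob_def)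
    have "(\<Sum>k<n. return_prob TYPE('d) (max j k - min j k))
      \<le> (\<Sum>k<n. (if k \<le> j then return_prob TYPE('d) (j - k) else 0) + (if j \<le> k then return_prob TYPE('d) (k - j) else 0))"
      by (intro sum_mono) (auto simp: max_def min_def r0)
    also have "\<dots> = (\<Sum>k\<in>{..j} \<inter> {..<n}. return_prob TYPE('d) (j - k)) + (\<Sum>k\<in>{j..<n}. return_prob TYPE('d) (k - j))"
      unfolding sum.distrib by (intro arg_cong2[where f = "(+)"] sum.mono_neutral_cong_right) auto
    also have "(\<Sum>k\<in>{..j} \<inter> {..<n}. return_prob TYPE('d) (j - k)) = sum (return_prob TYPE('d)) ((\<lambda>k. j - k) ` ({..j} \<inter> {..<n}))"
      by (subst sum.reindex) (auto simp: inj_on_def)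
    also have "\<dots> \<le> (\<Sum>l<n. return_prob TYPE('d) l)"
      using \<open>j \<in> {..<n}\<close> by (intro sum_mono2) (auto simp: r0)
    also have "(\<Sum>k\<in>{j..<n}. return_prob TYPE('d) (k - j)) = sum (return_prob TYPE('d)) ((\<lambda>k. k - j) ` {j..<n})"
      by (subst sum.reindex) (auto simp: inj_on_def)
    also have "\<dots> \<le> (\<Sum>l<n. return_prob TYPE('d) l)"
      by (intro sum_mono2) (auto simp: r0)
    finally show "(\<Sum>k<n. return_prob TYPE('d) (max j k - min j k)) \<le> 2 * G" using G by linarith
  qed
  finally have "pexp (rw_pmf n) I \<le> 2 * n * G" by simp
  then have "pprob (rw_pmf n) {xs. 8 * n * G < I xs} \<le> (2 * n * G) / (8 * n * G)"
    using n G by (intro order.trans[OF pexp_markov] divide_right_mono) (auto simp: nonneg)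
  then have 2: "pprob (rw_pmf n) {xs. 8 * n * G < I xs} \<le> 1 / 4" using n G by simp
  have 3: "real n / (32 * G) \<le> card (local_range n a xs)"
    if "out xs \<le> real n / 2" "I xs \<le> 8 * n * G" for xs
  proof -
    define V where "V = local_range n a xs"
    have V: "finite V" "V = {p \<in> (\<lambda>k. ?S k xs) ` {..<n}. norm (int_to_real_vec p) \<le> a}"
      by (auto simp: V_def local_range_def)
    define L where "L p = (\<Sum>k<n. of_bool (?S k xs = p) :: real)" for p
    have "real n - out xs = (\<Sum>k<n. \<Sum>p\<in>V. of_bool (?S k xs = p))"
    proof -
      have "1 - of_bool (a < norm (int_to_real_vec (?S k xs))) = (\<Sum>p\<in>V. of_bool (?S k xs = p) :: real)" if "k < n" for k
      proof -
        have "(\<Sum>p\<in>V. of_bool (?S k xs = p) :: real) = (\<Sum>p\<in>V. if p = ?S k xs then 1 else 0)"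
          by (rule sum.cong) auto
        also have "\<dots> = of_bool (?S k xs \<in> V)" using V(1) by (simp add: sum.delta')
        finally show ?thesis using that by (auto simp: V(2) not_less)
      qed
      then have "(\<Sum>k<n. 1 - of_bool (a < norm (int_to_real_vec (?S k xs)))) = (\<Sum>k<n. \<Sum>p\<in>V. of_bool (?S k xs = p) :: real)"
        by (intro sum.cong) auto
      then show ?thesis by (simp add: out_def sum_subtractf)
    qed
    also have "\<dots> = (\<Sum>p\<in>V. L p)" unfolding L_def by (rule sum.swap)
    finally have "(real n / 2)\<^sup>2 \<le> (\<Sum>p\<in>V. L p)\<^sup>2"
      using that(1) by (intro power_mono) auto
    also have "\<dots> \<le> (\<Sum>p\<in>V. (L p)\<^sup>2) * card V"
      using Cauchy_Schwarz_ineq_sum[of L "\<lambda>_. 1" V] by simp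
    also have "(\<Sum>p\<in>V. (L p)\<^sup>2) = (\<Sum>j<n. \<Sum>k<n. \<Sum>p\<in>V. of_bool (?S j xs = p) * of_bool (?S k xs = p))"
      unfolding L_def power2_eq_square sum_product
      by (subst sum.swap) (intro sum.cong refl, subst sum.swap, rule refl)
    also have "\<dots> \<le> I xs"
    proof -
      have "(\<Sum>p\<in>V. of_bool (?S j xs = p) * of_bool (?S k xs = p)) \<le> (of_bool (?S j xs = ?S k xs) :: real)" for j k
      proof -
        have "(\<Sum>p\<in>V. of_bool (?S j xs = p) * of_bool (?S k xs = p)) = (\<Sum>p\<in>V. if p = ?S j xs then of_bool (?S j xs = ?S k xs) else 0 :: real)"
          by (rule sum.cong) auto
        also have "\<dots> \<le> of_bool (?S j xs = ?S k xs)" using V(1) by (auto simp: sum.delta')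
        finally show ?thesis .
      qed
      then show ?thesis unfolding I_def by (intro sum_mono)
    qed
    finally have "(real n / 2)\<^sup>2 \<le> I xs * card V" by (simp add: mult_right_mono)
    also have "\<dots> \<le> 8 * n * G * card V" using that(2) by (intro mult_right_mono) auto
    finally have "real n * real n \<le> real n * (32 * G * card V)" by (simp add: power2_eq_square field_simps)
    then have "real n \<le> 32 * G * card V" using n by simp
    then show ?thesis using G unfolding V_def by (simp add: field_simps)
  qed
  let ?A = "{xs :: 'd site list. real n / (32 * G) \<le> card (local_range n a xs)}"
  have "1 = pprob (rw_pmf n) (UNIV :: 'd site list set)" by simp
  also have "\<dots> \<le> pprob (rw_pmf n) (?A \<union> ({xs. real n / 2 < out xs} \<union> {xs. 8 * n * G < I xs}))"
    by (rule measure_pmf.finite_measure_mono) (use 3 in \<open>auto simp: not_less not_le\<close>, meson not_less)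
  also have "\<dots> \<le> pprob (rw_pmf n) ?A + (pprob (rw_pmf n) {xs. real n / 2 < out xs}
      + pprob (rw_pmf n) {xs. 8 * n * G < I xs})"
    by (intro order.trans[OF measure_Un_le] add_mono order_refl) auto
  finally show ?thesis using 1 2 by linarith
qed

section \<open>Hitting a sphere\<close>

definition pos :: "('d::finite) site \<Rightarrow> 'd site list \<Rightarrow> nat \<Rightarrow> 'd site" where
  "pos x xs k = x + sum_list (take k xs)"

abbreviation site_dist :: "('d::finite) site \<Rightarrow> 'd site \<Rightarrow> real" where
  "site_dist x y \<equiv> norm (int_to_real_vec (x - y))"

lemma pos_0 [simp]: "pos x xs 0 = x"
  by (simp add: pos_def)

lemma pos_Cons_Suc [simp]: "pos x (v # xs) (Suc k) = pos (x + v) xs k"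
  by (simp add: pos_def add.assoc)

lemma site_dist_diff_le: "\<bar>site_dist x b - site_dist y b\<bar> \<le> site_dist x y"
  using norm_triangle_ineq3[of "int_to_real_vec (x - b)" "int_to_real_vec (y - b)"]
  by (simp add: int_to_real_vec_diff)

lemma discrete_crossing:
  fixes f :: "nat \<Rightarrow> real"
  assumes "\<And>k. k < t \<Longrightarrow> \<bar>f (Suc k) - f k\<bar> \<le> 1" "f 0 \<le> c" "c \<le> f t"
  shows "\<exists>k\<le>t. \<bar>f k - c\<bar> \<le> 1"
proof (rule ccontr)
  assume far: "\<not> ?thesis"
  have "k \<le> t \<Longrightarrow> f k < c - 1" for k
  proof (induction k)
    case 0
    then show ?case using far assms(2) by (force simp: abs_le_iff)
  next
    case (Suc k)
    then have "f k < c - 1" "\<bar>f (Suc k) - f k\<bar> \<le> 1" "\<not> \<bar>f (Suc k) - c\<bar> \<le> 1" using assms(1) far by auto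
    then show ?case by (auto simp: abs_le_iff)
  qed
  from this[of t] assms(3) show False by simp
qed

lemma walk_crossing:
  assumes xs: "set xs \<subseteq> srw_steps" "length xs = t"
    and cross: "(site_dist y b \<le> c \<and> c \<le> site_dist (pos y xs t) b) \<or> (c \<le> site_dist y b \<and> site_dist (pos y xs t) b \<le> c)"
  shows "\<exists>k\<le>t. \<bar>site_dist (pos y xs k) b - c\<bar> \<le> 1"
proof -
  define f where "f k = site_dist (pos y xs k) b" for k
  have f: "\<bar>f (Suc k) - f k\<bar> \<le> 1" if "k < t" for k
  proof -
    have "site_dist (pos y xs (Suc k)) (pos y xs k) = norm (int_to_real_vec (xs ! k))"
      using that xs(2) by (simp add: pos_def take_Suc_conv_app_nth)
    also have "\<dots> = 1" using that xs by (intro norm_srw_step) auto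
    finally show ?thesis using site_dist_diff_le[of "pos y xs (Suc k)" b "pos y xs k"] by (simp add: f_def)
  qed
  have "\<exists>k\<le>t. \<bar>f k - c\<bar> \<le> 1"
  proof (cases "f 0 \<le> c \<and> c \<le> f t")
    case True
    then show ?thesis using f by (intro discrete_crossing) auto
  next
    case False
    have "\<exists>k\<le>t. \<bar>- f k - (- c)\<bar> \<le> 1"
      using f False cross by (intro discrete_crossing) (auto simp: f_def abs_minus_commute)
    then show ?thesis by (auto simp: abs_minus_commute)
  qed
  then show ?thesis by (simp add: f_def)
qed

abbreviation hits_sphere :: "('d::finite) site \<Rightarrow> real \<Rightarrow> 'd site \<Rightarrow> nat \<Rightarrow> 'd site list \<Rightarrow> bool" where
  "hits_sphere b \<rho> y t xs \<equiv> \<exists>k\<le>t. \<bar>site_dist (pos y xs k) b - \<rho>\<bar> \<le> 1"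

text \<open>From inside, moving 3 l outwards along the radius already crosses the sphere. From
  outside, a move of 3 l inwards can be undone by sideways displacement, since the squared distance
  also gains the squared displacement. The latter must stay below 2 \<rho> l, which costs at most t
  / (2 \<rho> l) \<le> 9/256, half of the available 9/128. This curvature effect is why \<rho> has
  to be a large multiple of l.\<close>

lemma hit_sphere_prob:
  fixes y b :: "('d::finite) site" and l \<rho> :: real
  assumes l: "l > 0" and \<rho>: "\<rho> > 0" and t: "36 * CARD('d) * l\<^sup>2 \<le> real t" "CARD('d) \<le> t"
    and t\<rho>: "256 * real t \<le> 18 * \<rho> * l"
    and near: "\<bar>site_dist y b - \<rho>\<bar> \<le> 2 * l"
  shows "pprob (rw_pmf t) {xs. hits_sphere b \<rho> y t xs} \<ge> 9 / 256"
proof -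
  define v where "v = int_to_real_vec (y - b)"
  define u where "u = (if v = 0 then axis undefined 1 else v /\<^sub>R norm v)"
  have u: "norm u = 1" "u \<bullet> v = norm v" "v = norm v *\<^sub>R u"
    by (auto simp: u_def power2_norm_eq_inner[symmetric] power2_eq_square norm_axis_1)
  have pos: "int_to_real_vec (pos y xs t - b) = v + rpos xs" if "xs \<in> set_pmf (rw_pmf t)" for xs
    using length_rw[OF that] by (simp add: pos_def v_def int_to_real_vec_add[symmetric] algebra_simps)
  show ?thesis
  proof (cases "norm v \<le> \<rho>")
    case True
    have "9 / 128 \<le> pprob (rw_pmf t) {xs. u \<bullet> rpos xs \<ge> 3 * l}"
      by (rule rw_proj_large) (use u t l in auto)
    also have "\<dots> \<le> pprob (rw_pmf t) {xs. hits_sphere b \<rho> y t xs}"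
    proof (rule prob_mono)
      fix xs assume xs: "xs \<in> set_pmf (rw_pmf t)" and 3: "u \<bullet> rpos xs \<ge> 3 * l"
      have "\<rho> \<le> norm v + 3 * l" using near l by (simp add: v_def abs_le_iff)
      also have "\<dots> \<le> u \<bullet> (v + rpos xs)" using 3 u by (simp add: inner_add_right)
      also have "\<dots> \<le> norm (v + rpos xs)" using norm_cauchy_schwarz[of u "v + rpos xs"] u by simp
      finally show "hits_sphere b \<rho> y t xs"
        using True xs by (intro walk_crossing) (auto simp: set_rw length_rw pos v_def dest: set_rw)
    qed
    finally show ?thesis by simp
  next
    case False
    then have D: "\<rho> < norm v" by simp
    let ?A = "{xs. (- u) \<bullet> rpos xs \<ge> 3 * l}" and ?B = "{xs :: 'd site list. 2 * \<rho> * l < (norm (rpos xs))\<^sup>2}"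
    have "pprob (rw_pmf t) ?A \<ge> 9 / 128"
      by (rule rw_proj_large) (use u t l in auto)
    moreover have "pprob (rw_pmf t) ?B \<le> real t / (2 * \<rho> * l)"
      using pexp_markov[of "rw_pmf t" "\<lambda>xs :: 'd site list. (norm (rpos xs))\<^sup>2" "2 * \<rho> * l"] l \<rho>
        rw_norm_moment2[of t "0 :: real ^ 'd"] by simp
    moreover have "real t / (2 * \<rho> * l) \<le> 9 / 256"
      using t\<rho> l \<rho> by (simp add: divide_le_eq)
    moreover have "pprob (rw_pmf t) ?A \<le> pprob (rw_pmf t)
      ({xs. hits_sphere b \<rho> y t xs} \<union> ?B)"
    proof (rule measure_pmf.finite_measure_mono_AE)
      show "AE xs in rw_pmf t. xs \<in> ?A \<longrightarrow> xs \<in> {xs. hits_sphere b \<rho> y t xs} \<union> ?B"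
        unfolding AE_measure_pmf_iff
      proof safe
        fix xs :: "'d site list"
        assume xs: "xs \<in> set_pmf (rw_pmf t)" and A: "(- u) \<bullet> rpos xs \<ge> 3 * l"
          and B: "\<not> 2 * \<rho> * l < (norm (rpos xs))\<^sup>2"
        have "v \<bullet> rpos xs = norm v * (u \<bullet> rpos xs)" using u(3) by (metis inner_scaleR_left)
        also have "\<dots> \<le> norm v * (- 3 * l)" using A by (intro mult_left_mono) auto
        finally have "(norm (v + rpos xs))\<^sup>2 \<le> (norm v)\<^sup>2 + 2 * (norm v * (- 3 * l)) + 2 * \<rho> * l"
          using B dot_norm[of v "rpos xs"] by (simp add: field_simps)
        also have "2 * \<rho> * l \<le> 2 * norm v * l" using D l by simp
        also have "(norm v)\<^sup>2 + 2 * (norm v * (- 3 * l)) + 2 * norm v * l = (norm v)\<^sup>2 - 2 * l * (norm v + norm v)"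
          by simp
        also have "\<dots> \<le> (norm v)\<^sup>2 - (norm v - \<rho>) * (norm v + \<rho>)"
          using near D l \<rho> by (intro diff_left_mono mult_mono) (auto simp: v_def abs_le_iff)
        also have "\<dots> = \<rho>\<^sup>2" by (simp add: power2_eq_square algebra_simps)
        finally have "(norm (v + rpos xs))\<^sup>2 \<le> \<rho>\<^sup>2" by simp
        then have "norm (v + rpos xs) \<le> \<rho>" by (rule power2_le_imp_le) (use \<rho> in simp)
        then show "hits_sphere b \<rho> y t xs"
          using D xs by (intro walk_crossing) (auto simp: length_rw pos v_def dest: set_rw)
      qed
    qed simp
    moreover have "\<dots> \<le> pprob (rw_pmf t) {xs. hits_sphere b \<rho> y t xs}
       + pprob (rw_pmf t) ?B"
      by (rule measure_Un_le) auto
    ultimately show ?thesis by linarith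
  qed
qed

definition annulus_visits :: "('d::finite) site \<Rightarrow> real \<Rightarrow> real \<Rightarrow> 'd site \<Rightarrow> 'd site list \<Rightarrow> 'd site set" where
  "annulus_visits b \<rho> h y xs = {p \<in> pos y xs ` {..length xs}. \<bar>site_dist p b - \<rho>\<bar> \<le> h}"

lemma finite_annulus_visits [simp]: "finite (annulus_visits b \<rho> h y xs)"
  by (simp add: annulus_visits_def)

text \<open>The strong Markov property at the first visit near the sphere, carried out by peeling
  off single steps. From that time at least n steps remain; the range they discover stays within a
  of a point at distance at most 1 from the sphere, and a + 1 \<le> h.\<close>

lemma annulus_visits_prob:
  fixes y b :: "('d::finite) site"
  assumes range: "pprob (rw_pmf n) {xs :: 'd site list. K \<le> real (card (local_range n a xs))} \<ge> 1 / 2"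
    and h: "a + 1 \<le> h"
  shows "pprob (rw_pmf t) {xs. hits_sphere b \<rho> y t xs} / 2
    \<le> pprob (rw_pmf (t + n)) {xs. K \<le> card (annulus_visits b \<rho> h y xs)}"
proof (induction t arbitrary: y)
  have near: "1 / 2 \<le> pprob (rw_pmf (t + n)) {xs. K \<le> card (annulus_visits b \<rho> h y xs)}"
    if "\<bar>site_dist y b - \<rho>\<bar> \<le> 1" for y t
  proof -
    have "1 / 2 \<le> pexp (rw_pmf n) (\<lambda>xs :: 'd site list. of_bool (K \<le> real (card (local_range n a xs))))"
      using range by (simp add: pexp_of_bool)
    also have "\<dots> = pexp (rw_pmf (t + n)) (\<lambda>xs :: 'd site list. of_bool (K \<le> real (card (local_range n a (take n xs)))))"
      by (subst pexp_rw_take) auto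
    also have "\<dots> \<le> pexp (rw_pmf (t + n)) (\<lambda>xs. of_bool (K \<le> card (annulus_visits b \<rho> h y xs)))"
    proof (rule pexp_mono)
      fix xs :: "'d site list" assume xs: "xs \<in> set_pmf (rw_pmf (t + n))"
      have "(\<lambda>p. y + p) ` local_range n a (take n xs) \<subseteq> annulus_visits b \<rho> h y xs"
      proof safe
        fix p assume p: "p \<in> local_range n a (take n xs)"
        then obtain k where k: "k < n" "p = sum_list (take k xs)" "norm (int_to_real_vec p) \<le> a"
          by (auto simp: local_range_def min_def)
        have "y + p = pos y xs k" "k \<le> length xs" using k length_rw[OF xs] by (auto simp: pos_def)
        moreover have "\<bar>site_dist (y + p) b - site_dist y b\<bar> \<le> a"
          using site_dist_diff_le[of "y + p" b y] k by simp
        ultimately show "y + p \<in> annulus_visits b \<rho> h y xs"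
          using that h by (auto simp: annulus_visits_def)
      qed
      then have "card ((\<lambda>p. y + p) ` local_range n a (take n xs)) \<le> card (annulus_visits b \<rho> h y xs)"
        by (intro card_mono) auto
      then show "of_bool (K \<le> real (card (local_range n a (take n xs))))
        \<le> (of_bool (K \<le> card (annulus_visits b \<rho> h y xs)) :: real)"
        by (auto simp: card_image inj_on_def)
    qed simp
    finally show ?thesis by (simp add: pexp_of_bool)
  qed
  {
    case 0
    show ?case
    proof (cases "\<bar>site_dist y b - \<rho>\<bar> \<le> 1")
      case True
      have "pprob (rw_pmf 0) {xs. hits_sphere b \<rho> y 0 xs} / 2 \<le> 1 / 2"
        by (intro divide_right_mono) auto
      with near[OF True, of 0] show ?thesis by linarith
    qed simp
  next
    case (Suc t)
    show ?case
    proof (cases "\<bar>site_dist y b - \<rho>\<bar> \<le> 1")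
      case True
      have "pprob (rw_pmf (Suc t)) {xs. hits_sphere b \<rho> y (Suc t) xs} / 2 \<le> 1 / 2"
        by (intro divide_right_mono) auto
      with near[OF True, of "Suc t"] show ?thesis by linarith
    next
      case False
      have "pexp (rw_pmf (Suc t)) (\<lambda>xs. of_bool (hits_sphere b \<rho> y (Suc t) xs)) / 2
         = pexp step_pmf (\<lambda>v. pexp (rw_pmf t) (\<lambda>xs. of_bool (hits_sphere b \<rho> (y + v) t xs)) / 2)"
      proof -
        have "(hits_sphere b \<rho> y (Suc t) (v # xs))
           \<longleftrightarrow> (hits_sphere b \<rho> (y + v) t xs)" for v xs
        proof
          assume "hits_sphere b \<rho> y (Suc t) (v # xs)"
          then obtain k where k: "k \<le> Suc t" "\<bar>site_dist (pos y (v # xs) k) b - \<rho>\<bar> \<le> 1" by blast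
          with False obtain k' where "k = Suc k'" by (cases k) auto
          with k show "hits_sphere b \<rho> (y + v) t xs" by auto
        next
          assume "hits_sphere b \<rho> (y + v) t xs"
          then show "hits_sphere b \<rho> y (Suc t) (v # xs)"
            by (metis Suc_le_mono pos_Cons_Suc)
        qed
        then show ?thesis unfolding pexp_rw_Suc by simp
      qed
      also have "\<dots> \<le> pexp step_pmf (\<lambda>v. pexp (rw_pmf (t + n)) (\<lambda>xs. of_bool (K \<le> card (annulus_visits b \<rho> h (y + v) xs))))"
        using Suc by (intro pexp_mono) (auto simp: pexp_of_bool)
      also have "\<dots> \<le> pexp step_pmf (\<lambda>v. pexp (rw_pmf (t + n)) (\<lambda>xs. of_bool (K \<le> card (annulus_visits b \<rho> h y (v # xs)))))"
      proof (intro pexp_mono)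
        fix v xs
        have "annulus_visits b \<rho> h (y + v) xs \<subseteq> annulus_visits b \<rho> h y (v # xs)"
          by (force simp: annulus_visits_def simp flip: pos_Cons_Suc)
        then have "card (annulus_visits b \<rho> h (y + v) xs) \<le> card (annulus_visits b \<rho> h y (v # xs))"
          by (intro card_mono) auto
        then show "of_bool (K \<le> card (annulus_visits b \<rho> h (y + v) xs))
          \<le> (of_bool (K \<le> card (annulus_visits b \<rho> h y (v # xs))) :: real)" by auto
      qed auto
      also have "\<dots> = pexp (rw_pmf (Suc t + n)) (\<lambda>xs. of_bool (K \<le> card (annulus_visits b \<rho> h y xs)))"
        unfolding add_Suc pexp_rw_Suc ..
      finally show ?thesis by (simp add: pexp_of_bool)
    qed
  }
qed

section \<open>One walker, all scales\<close>

text \<open>The bound, given the walks, for finding fewer than m frogs in V: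
  \<open>few_frogs_prob\<close> supplies the factor 1/2 once V has at least K sites.\<close>

definition visit_weight :: "real \<Rightarrow> 'a set \<Rightarrow> real" where
  "visit_weight K V = (if K \<le> real (card V) then 1 / 2 else 1)"

lemma visit_weight_bounds: "0 \<le> visit_weight K V" "visit_weight K V \<le> 1"
  by (auto simp: visit_weight_def)

text \<open>The factor \<open>1 + (distance from the start / scale)\<^sup>2\<close> is a Lyapunov function: it makes up for
  the walkers that have drifted too far away for the window to succeed with probability \<open>p\<close>.\<close>

lemma window_contraction:
  fixes x y b :: "('d::finite) site" and l p c \<kappa> K :: real
  assumes P: "\<And>y. \<bar>site_dist y b - \<rho>\<bar> \<le> 2 * l \<Longrightarrow>
      p \<le> pprob (rw_pmf W) {ys. K \<le> card (annulus_visits b \<rho> h y ys)}"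
    and x: "\<bar>site_dist x b - \<rho>\<bar> \<le> l" and l: "l > 0" and W: "real W \<le> c * l\<^sup>2"
    and \<kappa>: "\<kappa> > 0" "(1 + c) / \<kappa>\<^sup>2 \<le> p / 4" and p: "0 < p" "p \<le> 1" and c: "c \<ge> 0"
  shows "pexp (rw_pmf W) (\<lambda>ys. visit_weight K (annulus_visits b \<rho> h y ys)
      * (1 + (site_dist (y + sum_list ys) x / (\<kappa> * l))\<^sup>2))
    \<le> (1 - p / 4) * (1 + (site_dist y x / l)\<^sup>2)"
proof -
  let ?g = "\<lambda>ys. visit_weight K (annulus_visits b \<rho> h y ys)"
  let ?P = "pprob (rw_pmf W) {ys. K \<le> card (annulus_visits b \<rho> h y ys)}"
  define z where "z = (site_dist y x / l)\<^sup>2"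
  have z0: "z \<ge> 0" by (simp add: z_def)
  have "pexp (rw_pmf W) (\<lambda>ys. ?g ys * (1 + (site_dist (y + sum_list ys) x / (\<kappa> * l))\<^sup>2))
    \<le> pexp (rw_pmf W) (\<lambda>ys. (1 - of_bool (K \<le> card (annulus_visits b \<rho> h y ys)) / 2)
         + (norm (int_to_real_vec (y - x) + rpos ys))\<^sup>2 / (\<kappa> * l)\<^sup>2)"
  proof (rule pexp_mono)
    fix ys :: "'d site list"
    have 1: "int_to_real_vec (y + sum_list ys - x) = int_to_real_vec (y - x) + rpos ys"
      by (simp add: int_to_real_vec_add int_to_real_vec_diff)
    have 2: "?g ys = 1 - of_bool (K \<le> card (annulus_visits b \<rho> h y ys)) / 2"
      by (simp add: visit_weight_def)
    have "?g ys * (1 + (site_dist (y + sum_list ys) x / (\<kappa> * l))\<^sup>2)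
      \<le> ?g ys + 1 * (site_dist (y + sum_list ys) x / (\<kappa> * l))\<^sup>2"
      unfolding distrib_left mult_1_right by (intro add_mono order_refl mult_right_mono visit_weight_bounds) auto
    then show "?g ys * (1 + (site_dist (y + sum_list ys) x / (\<kappa> * l))\<^sup>2)
      \<le> (1 - of_bool (K \<le> card (annulus_visits b \<rho> h y ys)) / 2)
         + (norm (int_to_real_vec (y - x) + rpos ys))\<^sup>2 / (\<kappa> * l)\<^sup>2"
      unfolding 1 2 by (simp add: power_divide)
  qed simp
  also have "\<dots> = 1 - ?P / 2 + ((site_dist y x)\<^sup>2 + real W) / (\<kappa> * l)\<^sup>2"
  proof -
    have "pexp (rw_pmf W) (\<lambda>ys. 1 - of_bool (K \<le> card (annulus_visits b \<rho> h y ys)) / 2) = 1 - ?P / 2"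
      by (subst Bochner_Integration.integral_diff)
        (auto intro!: integrable_measure_pmf_finite simp: pexp_of_bool)
    then show ?thesis by (simp add: pexp_add rw_norm_moment2)
  qed
  also have "((site_dist y x)\<^sup>2 + real W) / (\<kappa> * l)\<^sup>2 \<le> ((site_dist y x)\<^sup>2 + c * l\<^sup>2) / (\<kappa> * l)\<^sup>2"
    using W by (intro divide_right_mono) auto
  also have "\<dots> = (z + c) / \<kappa>\<^sup>2"
    using l \<kappa> by (simp add: z_def power_divide power_mult_distrib field_simps)
  also have "1 - ?P / 2 + (z + c) / \<kappa>\<^sup>2 \<le> (1 - p / 4) * (1 + z)"
  \<comment> \<open>Near the starting point the window succeeds with probability p, and this gain of
    p / 2 pays for the quadratic term, which is at most p / 4 after rescaling.\<close>
  proof (cases "z \<le> 1")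
    case True
    then have "site_dist y x / l \<le> 1" unfolding z_def by (metis abs_square_le_1 abs_le_iff)
    then have "site_dist y x \<le> l" using l by simp
    then have "\<bar>site_dist y b - \<rho>\<bar> \<le> 2 * l" using x site_dist_diff_le[of y b x] by linarith
    then have "p \<le> ?P" by (rule P)
    moreover have "(z + c) / \<kappa>\<^sup>2 \<le> (1 + c) / \<kappa>\<^sup>2" using True by (intro divide_right_mono) auto
    with \<kappa> have "(z + c) / \<kappa>\<^sup>2 \<le> p / 4" by (metis order.trans)
    ultimately have "1 - ?P / 2 + (z + c) / \<kappa>\<^sup>2 \<le> (1 - p / 2) + p / 4"
      by (intro add_mono) auto
    also have "\<dots> = (1 - p / 4) * 1" by simp
    also have "\<dots> \<le> (1 - p / 4) * (1 + z)" using z0 p by (intro mult_left_mono) auto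
    finally show ?thesis .
  next
    \<comment> \<open>Far away nothing is gained from the window, but replacing the scale l by
      \<kappa> l shrinks the quadratic term enough.\<close>
    case False
    have "z + c \<le> z * (1 + c)" using False c mult_right_mono[of 1 z c] by (simp add: algebra_simps)
    then have "(z + c) / \<kappa>\<^sup>2 \<le> z * ((1 + c) / \<kappa>\<^sup>2)" by (simp add: divide_right_mono)
    also have "\<dots> \<le> z * (p / 4)" using \<kappa> z0 by (intro mult_left_mono) auto
    finally have 1: "1 - ?P / 2 + (z + c) / \<kappa>\<^sup>2 \<le> 1 + z * (p / 4)"
      using measure_nonneg[of "measure_pmf (rw_pmf W)" "{ys. K \<le> card (annulus_visits b \<rho> h y ys)}"] by linarith
    have "p / 4 \<le> 1 * (1 - p / 2)" using p by (simp add: field_simps)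
    also have "\<dots> \<le> z * (1 - p / 2)" using False p by (intro mult_right_mono) auto
    finally have "p / 4 \<le> z - z * p / 2" by (simp add: algebra_simps)
    moreover have e: "(1 - p / 4) * (1 + z) = 1 + z - p / 4 - z * (p / 4)" by (simp add: field_simps)
    moreover have "z * (p / 4) = z * p / 4" "z * p / 2 = 2 * (z * (p / 4))" by auto
    ultimately show ?thesis unfolding e using 1 by linarith
  qed
  finally show ?thesis by (simp add: z_def)
qed

definition window_visits ::
  "('d::finite) site \<Rightarrow> real \<Rightarrow> real \<Rightarrow> 'd site \<Rightarrow> nat \<Rightarrow> nat \<Rightarrow> 'd site list \<Rightarrow> 'd site set" where
  "window_visits b \<rho> h x s W xs = annulus_visits b \<rho> h (pos x xs s) (take W (drop s xs))"

lemma finite_window_visits [simp]: "finite (window_visits b \<rho> h x s W xs)"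
  by (simp add: window_visits_def)

lemma window_visits_take:
  "s + W \<le> n \<Longrightarrow> window_visits b \<rho> h x s W (take n xs) = window_visits b \<rho> h x s W xs"
  by (simp add: window_visits_def pos_def drop_take min_def)

lemma window_visits_append:
  "s + W \<le> length xs \<Longrightarrow> window_visits b \<rho> h x s W (xs @ ys) = window_visits b \<rho> h x s W xs"
  using window_visits_take[of s W "length xs" b \<rho> h x "xs @ ys"] by simp

lemma window_visits_pos:
  assumes "p \<in> window_visits b \<rho> h x s W xs"
  obtains k where "k \<le> s + W" "k \<le> length xs" "p = pos x xs k" "\<bar>site_dist p b - \<rho>\<bar> \<le> h"
proof (cases "s \<le> length xs")
  case True
  from assms obtain k where k: "k \<le> length (take W (drop s xs))" "p = pos (pos x xs s) (take W (drop s xs)) k"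
    "\<bar>site_dist p b - \<rho>\<bar> \<le> h"
    by (auto simp: window_visits_def annulus_visits_def)
  have "p = pos x xs (s + k)"
    using k(1) unfolding k(2) by (simp add: pos_def take_add add.assoc)
  then show thesis using that[of "s + k"] k True by auto
next
  case False
  then have "p = pos x xs (length xs)" "\<bar>site_dist p b - \<rho>\<bar> \<le> h"
    using assms by (auto simp: window_visits_def annulus_visits_def pos_def)
  then show thesis using that[of "length xs"] False by auto
qed

lemma all_windows_bound:
  fixes x b :: "('d::finite) site" and p c \<kappa> K :: real and W :: "nat \<Rightarrow> nat"
  assumes P: "\<And>i y. i < I \<Longrightarrow> \<bar>site_dist y b - \<rho> i\<bar> \<le> 2 * l i \<Longrightarrow>
      p \<le> pprob (rw_pmf (W i)) {ys. K \<le> card (annulus_visits b (\<rho> i) h y ys)}"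
    and x: "\<And>i. i < I \<Longrightarrow> \<bar>site_dist x b - \<rho> i\<bar> \<le> l i"
    and l: "\<And>i. l i > 0" "\<And>i. l (Suc i) = \<kappa> * l i" and W: "\<And>i. real (W i) \<le> c * (l i)\<^sup>2"
    and \<kappa>: "\<kappa> > 0" "(1 + c) / \<kappa>\<^sup>2 \<le> p / 4" and p: "0 < p" "p \<le> 1" and c: "c \<ge> 0"
    and T: "(\<Sum>j<I. W j) \<le> T"
  shows "pexp (rw_pmf T) (\<lambda>xs. \<Prod>i<I. visit_weight K (window_visits b (\<rho> i) h x (\<Sum>j<i. W j) (W i) xs))
    \<le> (1 - p / 4) ^ I"
proof -
  let ?s = "\<lambda>i. \<Sum>j<i. W j"
  let ?g = "\<lambda>i xs. visit_weight K (window_visits b (\<rho> i) h x (?s i) (W i) xs)"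
  have claim: "J \<le> I \<Longrightarrow> pexp (rw_pmf (?s J)) (\<lambda>xs. (\<Prod>i<J. ?g i xs) * (1 + (site_dist (x + sum_list xs) x / l J)\<^sup>2))
      \<le> (1 - p / 4) ^ J" for J
  proof (induction J)
    case (Suc J)
    let ?F = "\<lambda>xs. (\<Prod>i<J. ?g i xs)"
    let ?lhs = "\<lambda>xs. pexp (rw_pmf (W J)) (\<lambda>ys. (\<Prod>i<Suc J. ?g i (xs @ ys)) * (1 + (site_dist (x + sum_list (xs @ ys)) x / l (Suc J))\<^sup>2))"
    let ?v = "\<lambda>xs ys. visit_weight K (annulus_visits b (\<rho> J) h (x + sum_list xs) ys)
          * (1 + (site_dist (x + sum_list xs + sum_list ys) x / (\<kappa> * l J))\<^sup>2)"
    have "pexp (rw_pmf (?s (Suc J))) (\<lambda>xs. (\<Prod>i<Suc J. ?g i xs) * (1 + (site_dist (x + sum_list xs) x / l (Suc J))\<^sup>2))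
      = pexp (rw_pmf (?s J)) (\<lambda>xs. pexp (rw_pmf (W J)) (\<lambda>ys. (\<Prod>i<Suc J. ?g i (xs @ ys))
          * (1 + (site_dist (x + sum_list (xs @ ys)) x / l (Suc J))\<^sup>2)))"
      by (simp only: sum.lessThan_Suc pexp_rw_add)
    also have "\<dots> = pexp (rw_pmf (?s J)) (\<lambda>xs. ?F xs * pexp (rw_pmf (W J)) (\<lambda>ys.
        ?v xs ys))"
    proof (rule pexp_cong)
      fix xs :: "'d site list" assume "xs \<in> set_pmf (rw_pmf (?s J))"
      then have len: "length xs = ?s J" by (rule length_rw)
      have "?lhs xs
        = pexp (rw_pmf (W J)) (\<lambda>ys. ?F xs * (?v xs ys))"
      proof (rule pexp_cong)
        fix ys :: "'d site list" assume "ys \<in> set_pmf (rw_pmf (W J))"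
        then have len': "length ys = W J" by (rule length_rw)
        have "?g i (xs @ ys) = ?g i xs" if "i < J" for i
        proof -
          have "?s i + W i = ?s (Suc i)" by simp
          also have "\<dots> \<le> ?s J" using that by (intro sum_mono2) auto
          finally show ?thesis using len by (simp add: window_visits_append)
        qed
        moreover have "?g J (xs @ ys) = visit_weight K (annulus_visits b (\<rho> J) h (x + sum_list xs) ys)"
          using len len' by (simp add: window_visits_def pos_def)
        ultimately show "(\<Prod>i<Suc J. ?g i (xs @ ys)) * (1 + (site_dist (x + sum_list (xs @ ys)) x / l (Suc J))\<^sup>2)
          = ?F xs * (?v xs ys)"
          by (simp add: l(2) add.assoc)
      qed
      then show "?lhs xs
        = ?F xs * pexp (rw_pmf (W J)) (\<lambda>ys. ?v xs ys)" by simp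
    qed
    also have "\<dots> \<le> pexp (rw_pmf (?s J)) (\<lambda>xs. ?F xs * ((1 - p / 4) * (1 + (site_dist (x + sum_list xs) x / l J)\<^sup>2)))"
    proof (rule pexp_mono, simp, rule mult_left_mono)
      fix xs :: "'d site list"
      show "pexp (rw_pmf (W J)) (\<lambda>ys. ?v xs ys)
        \<le> (1 - p / 4) * (1 + (site_dist (x + sum_list xs) x / l J)\<^sup>2)"
        by (rule window_contraction[where c = c]) (use P x l W \<kappa> p c Suc.prems in auto)
    qed (auto intro!: prod_nonneg visit_weight_bounds)
    also have "\<dots> = (1 - p / 4) * pexp (rw_pmf (?s J)) (\<lambda>xs. ?F xs * (1 + (site_dist (x + sum_list xs) x / l J)\<^sup>2))"
      by (subst integral_mult_right_zero[symmetric]) (simp only: ac_simps)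
    also have "\<dots> \<le> (1 - p / 4) * (1 - p / 4) ^ J"
      using Suc p by (intro mult_left_mono) auto
    finally show ?case by simp
  qed simp
  have "pexp (rw_pmf T) (\<lambda>xs. \<Prod>i<I. ?g i xs) = pexp (rw_pmf T) (\<lambda>xs. \<Prod>i<I. ?g i (take (?s I) xs))"
  proof (intro pexp_cong prod.cong refl)
    fix xs :: "'d site list" and i assume "i \<in> {..<I}"
    have "?s i + W i = ?s (Suc i)" by simp
    also have "\<dots> \<le> ?s I" using \<open>i \<in> {..<I}\<close> by (intro sum_mono2) auto
    finally show "?g i xs = ?g i (take (?s I) xs)" by (simp add: window_visits_take)
  qed
  also have "\<dots> = pexp (rw_pmf (?s I)) (\<lambda>xs. \<Prod>i<I. ?g i xs)"
    using T by (rule pexp_rw_take)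
  also have "\<dots> \<le> pexp (rw_pmf (?s I)) (\<lambda>xs. (\<Prod>i<I. ?g i xs) * (1 + (site_dist (x + sum_list xs) x / l I)\<^sup>2))"
    by (intro pexp_mono) (auto intro!: mult_nonneg_nonneg prod_nonneg visit_weight_bounds simp: distrib_left)
  also have "\<dots> \<le> (1 - p / 4) ^ I" by (rule claim) simp
  finally show ?thesis .
qed

section \<open>The finite environment\<close>

type_synonym 'd env = "('d site \<Rightarrow> bool) \<times> ('d site \<Rightarrow> 'd site list)"

abbreviation frogs_pmf :: "real \<Rightarrow> ('d::finite) site set \<Rightarrow> ('d site \<Rightarrow> bool) pmf" where
  "frogs_pmf r J \<equiv> Pi_pmf J False (\<lambda>_. bernoulli_pmf r)"

abbreviation walks_pmf :: "nat \<Rightarrow> ('d::finite) site set \<Rightarrow> ('d site \<Rightarrow> 'd site list) pmf" where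
  "walks_pmf T J \<equiv> Pi_pmf J [] (\<lambda>_. rw_pmf T)"

text \<open>Truncation to the sites of J and to T steps gives the law finite support, so that sums
  may be exchanged and conditioning is a finite sum. The infinite product space returns only through
  \<open>project_env\<close>.\<close>

definition env_pmf :: "real \<Rightarrow> ('d::finite) site set \<Rightarrow> nat \<Rightarrow> 'd env pmf" where
  "env_pmf r J T = pair_pmf (frogs_pmf r J) (walks_pmf T J)"

lemma finite_Pi_pmf:
  assumes "finite J" "\<And>x. x \<in> J \<Longrightarrow> finite (set_pmf (q x))"
  shows "finite (set_pmf (Pi_pmf J d q))"
  using assms by (simp add: set_Pi_pmf finite_PiE_dflt)

lemma finite_env_pmf:
  assumes "finite J"
  shows "finite (set_pmf (env_pmf r J T))"
  using assms by (simp add: env_pmf_def finite_Pi_pmf)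

lemma pexp_env:
  assumes "finite J"
  shows "pexp (env_pmf r J T) f
    = pexp (walks_pmf T J) (\<lambda>s. pexp (frogs_pmf r J) (\<lambda>\<omega>. f (\<omega>, s)))"
  using assms unfolding env_pmf_def
  by (subst pexp_pair) (auto simp: finite_Pi_pmf intro!: pexp_commute)

lemma pexp_Pi_union:
  assumes "finite A" "finite B" "A \<inter> B = {}" "\<And>x. finite (set_pmf (q x))"
  shows "pexp (Pi_pmf (A \<union> B) d q) f
    = pexp (Pi_pmf A d q) (\<lambda>\<alpha>. pexp (Pi_pmf B d q) (\<lambda>\<beta>. f (\<lambda>x. if x \<in> A then \<alpha> x else \<beta> x)))"
  using assms
  by (subst Pi_pmf_union) (auto simp: pexp_pair finite_Pi_pmf case_prod_unfold cong: if_cong)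

lemma pexp_Pi_prod:
  assumes "finite J" "U \<subseteq> J" "\<And>x. finite (set_pmf (q x))" "\<And>x y. 0 \<le> f x y"
  shows "pexp (Pi_pmf J d q) (\<lambda>\<alpha>. \<Prod>x\<in>U. f x (\<alpha> x)) = (\<Prod>x\<in>U. pexp (q x) (f x))"
proof -
  let ?f = "\<lambda>x y. if x \<in> U then f x y else 1"
  have U: "(\<Prod>x\<in>J. if x \<in> U then g x else 1) = (\<Prod>x\<in>U. g x)" for g :: "_ \<Rightarrow> real"
    using assms(1,2) by (simp add: prod.inter_restrict[symmetric] Int_absorb1)
  have "pexp (Pi_pmf J d q) (\<lambda>\<alpha>. \<Prod>x\<in>U. f x (\<alpha> x)) = pexp (Pi_pmf J d q) (\<lambda>\<alpha>. \<Prod>x\<in>J. ?f x (\<alpha> x))"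
    by (simp add: U)
  also have "\<dots> = (\<Prod>x\<in>J. pexp (q x) (?f x))"
    using assms by (intro expectation_prod_Pi_pmf integrable_measure_pmf_finite) auto
  also have "\<dots> = (\<Prod>x\<in>J. if x \<in> U then pexp (q x) (f x) else 1)"
    by (intro prod.cong) auto
  finally show ?thesis by (simp add: U)
qed

text \<open>A and B carry occupations, C and D carry walks. The two pairs differ on purpose: the
  frogs woken in a stage have occupations in A, already inspected, and walks in D, still
  fresh.\<close>

lemma env_indep:
  fixes P R :: "('d::finite) env \<Rightarrow> bool"
  assumes J: "finite J" "A \<subseteq> J" "C \<subseteq> J" and disj: "A \<inter> B = {}" "C \<inter> D = {}"
    and P: "\<And>\<omega> \<omega>' s s'. (\<And>x. x \<in> A \<Longrightarrow> \<omega> x = \<omega>' x) \<Longrightarrow> (\<And>x. x \<in> C \<Longrightarrow> s x = s' x) \<Longrightarrow> P (\<omega>, s) = P (\<omega>', s')"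
    and R: "\<And>\<omega> \<omega>' s s'. (\<And>x. x \<in> B \<Longrightarrow> \<omega> x = \<omega>' x) \<Longrightarrow> (\<And>x. x \<in> D \<Longrightarrow> s x = s' x) \<Longrightarrow> R (\<omega>, s) = R (\<omega>', s')"
  shows "pprob (env_pmf r J T) {e. P e \<and> R e}
    = pprob (env_pmf r J T) {e. P e} * pprob (env_pmf r J T) {e. R e}"
proof -
  define a where "a P = pexp (frogs_pmf r A) (\<lambda>\<omega>. pexp (walks_pmf T C) (\<lambda>s. of_bool (P (\<omega>, s))))"
    for P :: "'d env \<Rightarrow> bool"
  define c where "c R = pexp (frogs_pmf r (J - A)) (\<lambda>\<omega>. pexp (walks_pmf T (J - C)) (\<lambda>s. of_bool (R (\<omega>, s))))"
    for R :: "'d env \<Rightarrow> bool"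
  have fin: "finite A" "finite C" using J finite_subset by auto
  \<comment> \<open>Stated for arbitrary events, since it is also applied with one of them trivial,
    which identifies the two factors as the marginals.\<close>
  have main: "pprob (env_pmf r J T) {e. P e \<and> R e} = a P * c R"
    if P: "\<And>\<omega> \<omega>' s s'. (\<And>x. x \<in> A \<Longrightarrow> \<omega> x = \<omega>' x) \<Longrightarrow> (\<And>x. x \<in> C \<Longrightarrow> s x = s' x) \<Longrightarrow> P (\<omega>, s) = P (\<omega>', s')"
    and R: "\<And>\<omega> \<omega>' s s'. (\<And>x. x \<in> B \<Longrightarrow> \<omega> x = \<omega>' x) \<Longrightarrow> (\<And>x. x \<in> D \<Longrightarrow> s x = s' x) \<Longrightarrow> R (\<omega>, s) = R (\<omega>', s')"
    for P R :: "'d env \<Rightarrow> bool"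
  proof -
    define w :: "('d site \<Rightarrow> bool) \<Rightarrow> ('d site \<Rightarrow> bool) \<Rightarrow> 'd site \<Rightarrow> bool" where "w \<alpha> \<beta> = (\<lambda>x. if x \<in> A then \<alpha> x else \<beta> x)" for \<alpha> \<beta>
    define v :: "('d site \<Rightarrow> 'd site list) \<Rightarrow> ('d site \<Rightarrow> 'd site list) \<Rightarrow> 'd site \<Rightarrow> 'd site list" where "v \<gamma> \<delta> = (\<lambda>x. if x \<in> C then \<gamma> x else \<delta> x)" for \<gamma> \<delta>
    let ?pA = "frogs_pmf r A" and ?pB = "frogs_pmf r (J - A)"
    let ?pC = "walks_pmf T C" and ?pD = "walks_pmf T (J - C)"
    have f: "finite (set_pmf ?pA)" "finite (set_pmf ?pB)" "finite (set_pmf ?pC)" "finite (set_pmf ?pD)"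
      using fin J by (auto intro!: finite_Pi_pmf)
    have "A \<union> (J - A) = J" "C \<union> (J - C) = J" using J by auto
    then have "pprob (env_pmf r J T) {e. P e \<and> R e} =
      pexp (Pi_pmf (A \<union> (J - A)) False (\<lambda>_. bernoulli_pmf r)) (\<lambda>\<omega>. pexp (Pi_pmf (C \<union> (J - C)) [] (\<lambda>_. rw_pmf T))
        (\<lambda>s. of_bool (P (\<omega>, s) \<and> R (\<omega>, s))))"
      using J(1) unfolding env_pmf_def
      by (simp add: pexp_of_bool[symmetric] pexp_pair finite_Pi_pmf del: of_bool_conj)
    also have "\<dots> = pexp ?pA (\<lambda>\<alpha>. pexp ?pB (\<lambda>\<beta>. pexp ?pC (\<lambda>\<gamma>. pexp ?pD (\<lambda>\<delta>.
        of_bool (P (w \<alpha> \<beta>, v \<gamma> \<delta>) \<and> R (w \<alpha> \<beta>, v \<gamma> \<delta>))))))"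
    proof -
      have "A \<inter> (J - A) = {}" "C \<inter> (J - C) = {}" by auto
      then show ?thesis
        unfolding w_def v_def using fin J(1)
        by (simp add: pexp_Pi_union del: Un_Diff_cancel of_bool_conj)
    qed
    also have "\<dots> = pexp ?pA (\<lambda>\<alpha>. pexp ?pB (\<lambda>\<beta>. pexp ?pC (\<lambda>\<gamma>. pexp ?pD (\<lambda>\<delta>.
        of_bool (P (\<alpha>, \<gamma>)) * of_bool (R (\<beta>, \<delta>))))))"
    proof -
      have "P (w \<alpha> \<beta>, v \<gamma> \<delta>) = P (\<alpha>, \<gamma>)" for \<alpha> \<beta> \<gamma> \<delta> by (rule P) (auto simp: w_def v_def)
      moreover have "R (w \<alpha> \<beta>, v \<gamma> \<delta>) = R (\<beta>, \<delta>)" for \<alpha> \<beta> \<gamma> \<delta> by (rule R) (use disj in \<open>auto simp: w_def v_def\<close>)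
      ultimately show ?thesis by (simp add: of_bool_conj)
    qed
    also have "\<dots> = a P * c R"
      unfolding a_def c_def by simp
    finally show ?thesis .
  qed
  have 1: "a (\<lambda>_. True) = 1" "c (\<lambda>_. True) = 1" by (simp_all add: a_def c_def)
  have "pprob (env_pmf r J T) {e. P e \<and> R e} = a P * c R"
    by (rule main) (use P R in blast)+
  moreover have "pprob (env_pmf r J T) {e. P e \<and> True} = a P * c (\<lambda>_. True)"
    by (rule main) (use P in blast)+
  moreover have "pprob (env_pmf r J T) {e. True \<and> R e} = a (\<lambda>_. True) * c R"
    by (rule main) (use R in blast)+
  ultimately show ?thesis using 1 by simp
qed

text \<open>A relay that may wake frogs only in Q; the starting site is taken to be awake. Bounding
  k by the length keeps it inside the revealed part of the walk, where \<open>pos\<close> agrees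
  with \<open>walk\<close>.\<close>

inductive reach :: "('d::finite) site \<Rightarrow> 'd env \<Rightarrow> 'd site set \<Rightarrow> 'd site \<Rightarrow> nat \<Rightarrow> bool"
  for b e Q where
  hit: "\<lbrakk>k \<le> length (snd e x); pos x (snd e x) k = b\<rbrakk> \<Longrightarrow> reach b e Q x k"
| jump: "\<lbrakk>k \<le> length (snd e x); pos x (snd e x) k = y; y \<in> Q; fst e y; reach b e Q y t\<rbrakk> \<Longrightarrow> reach b e Q x (k + t)"

definition reach_within :: "('d::finite) site \<Rightarrow> 'd env \<Rightarrow> 'd site set \<Rightarrow> 'd site set \<Rightarrow> nat \<Rightarrow> bool" where
  "reach_within b e Q F u \<longleftrightarrow> (\<exists>x\<in>F. \<exists>t\<le>u. reach b e Q x t)"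

lemma reach_mono:
  assumes "reach b e Q x t" "Q \<subseteq> Q'"
  shows "reach b e Q' x t"
  using assms by (induction rule: reach.induct) (auto intro: reach.intros)

lemma reach_cong:
  assumes "reach b (\<omega>, s) Q x t" "\<And>y. y \<in> Q \<Longrightarrow> \<omega> y = \<omega>' y" "\<And>y. y \<in> insert x Q \<Longrightarrow> s y = s' y"
  shows "reach b (\<omega>', s') Q x t"
  using assms
proof (induction rule: reach.induct)
  case (hit k x)
  then show ?case by (intro reach.hit) auto
next
  case (jump k x y t)
  then show ?case by (intro reach.jump) auto
qed

lemma reach_within_cong:
  assumes "\<And>y. y \<in> Q \<Longrightarrow> \<omega> y = \<omega>' y" "\<And>y. y \<in> F \<union> Q \<Longrightarrow> s y = s' y"
  shows "reach_within b (\<omega>, s) Q F u = reach_within b (\<omega>', s') Q F u"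
proof -
  have "reach b (\<omega>, s) Q x t = reach b (\<omega>', s') Q x t" if "x \<in> F" for x t
    using assms that by (auto elim!: reach_cong)
  then show ?thesis by (auto simp: reach_within_def)
qed

lemma sum_first_success:
  fixes M :: nat
  shows "(\<Sum>n<M. of_bool (S n \<and> (\<forall>n'<n. \<not> S n')) :: real) = of_bool (\<exists>n<M. S n)"
  by (induction M) (auto simp: less_Suc_eq)

lemma sum_first_success_block:
  fixes M :: nat
  shows "(\<Sum>n\<in>{k..<k + M}. of_bool (S n \<and> (\<forall>n'<n. \<not> S n')) :: real) \<le> of_bool (\<forall>n<k. \<not> S n)"
proof (cases "\<forall>n<k. \<not> S n")
  case True
  have "(\<Sum>n\<in>{k..<k + M}. of_bool (S n \<and> (\<forall>n'<n. \<not> S n')) :: real)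
    \<le> (\<Sum>n<k + M. of_bool (S n \<and> (\<forall>n'<n. \<not> S n')))"
    by (rule sum_mono2) auto
  then show ?thesis unfolding sum_first_success using True by (auto simp: of_bool_def split: if_splits)
next
  case False
  then have "(\<Sum>n\<in>{k..<k + M}. of_bool (S n \<and> (\<forall>n'<n. \<not> S n')) :: real) = 0"
    by (intro sum.neutral ballI) (use False in \<open>auto intro: less_le_trans\<close>)
  then show ?thesis by simp
qed

lemma frogs_weight_expectation:
  assumes "finite J" "U \<subseteq> J" "0 \<le> r" "r \<le> 1"
  shows "pexp (frogs_pmf r J) (\<lambda>\<omega>. \<Prod>v\<in>U. if \<omega> v then 1 / 2 else 1)
    = (1 - r / 2) ^ card U"
proof -
  have "pexp (bernoulli_pmf r) (\<lambda>y. if y then 1 / 2 else 1) = 1 - r / 2"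
    using assms by (simp add: field_simps)
  then show ?thesis
    using pexp_Pi_prod[OF assms(1,2), where q = "\<lambda>_. bernoulli_pmf r" and d = False
        and f = "\<lambda>_ y. if y then 1 / 2 else 1"] by simp
qed

text \<open>Seeing fewer than \<open>m\<close> frogs in each of several disjoint sets: by Markov's inequality for
  \<open>2 ^ (m - number of frogs)\<close>, every set with at least \<open>K\<close> sites costs a factor \<open>1 / 2\<close>.\<close>

lemma few_frogs_prob:
  fixes V :: "nat \<Rightarrow> ('d::finite) site set"
  assumes J: "finite J" "\<And>n. n < M \<Longrightarrow> V n \<subseteq> J" and r: "0 \<le> r" "r \<le> 1"
    and disj: "\<And>n n'. n < n' \<Longrightarrow> n' < M \<Longrightarrow> V n \<inter> V n' = {}"
    and K: "2 * (real m + 1) \<le> r * K"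
  shows "pprob (frogs_pmf r J) {\<omega>. \<forall>n<M. card {v \<in> V n. \<omega> v} < m}
    \<le> (\<Prod>n<M. visit_weight K (V n))"
proof -
  let ?p = "frogs_pmf r J"
  define B where "B = {n. n < M \<and> K \<le> card (V n)}"
  have B: "finite B" "\<And>n. n \<in> B \<Longrightarrow> n < M" by (auto simp: B_def)
  have finV: "finite (V n)" if "n < M" for n using J(2)[OF that] J(1) finite_subset by blast
  have wt: "(\<Prod>v\<in>V n. if \<omega> v then 1 / 2 else 1 :: real) = (1 / 2) ^ card {v \<in> V n. \<omega> v}" if "n < M" for n \<omega>
    using finV[OF that] by (simp add: prod.If_cases Int_def)
  have disjB: "V n \<inter> V n' = {}" if "n \<in> B" "n' \<in> B" "n \<noteq> n'" for n n'
    using that disj[of n n'] disj[of n' n] B by (cases "n < n'") auto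
  have "pprob ?p {\<omega>. \<forall>n<M. card {v \<in> V n. \<omega> v} < m}
    = pexp ?p (\<lambda>\<omega>. of_bool (\<forall>n<M. card {v \<in> V n. \<omega> v} < m))"
    by (simp add: pexp_of_bool)
  also have "\<dots> \<le> pexp ?p (\<lambda>\<omega>. \<Prod>n\<in>B. 2 ^ m * (\<Prod>v\<in>V n. if \<omega> v then 1 / 2 else 1))"
  proof (rule pexp_mono)
    fix \<omega>
    show "of_bool (\<forall>n<M. card {v \<in> V n. \<omega> v} < m) \<le> (\<Prod>n\<in>B. 2 ^ m * (\<Prod>v\<in>V n. if \<omega> v then 1 / 2 else 1 :: real))"
    proof (cases "\<forall>n<M. card {v \<in> V n. \<omega> v} < m")
      case True
      have "1 \<le> (\<Prod>n\<in>B. 2 ^ m * (\<Prod>v\<in>V n. if \<omega> v then 1 / 2 else 1 :: real))"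
      proof (rule prod_ge_1)
        fix n assume n: "n \<in> B"
        have "(1 / 2 :: real) ^ m \<le> (1 / 2) ^ card {v \<in> V n. \<omega> v}"
          using True B(2)[OF n] by (intro power_decreasing) (auto simp: less_imp_le)
        then show "1 \<le> 2 ^ m * (\<Prod>v\<in>V n. if \<omega> v then 1 / 2 else 1 :: real)"
          unfolding wt[OF B(2)[OF n]] by (simp add: power_divide divide_le_eq le_divide_eq)
      qed
      then show ?thesis using True by simp
    next
      case False
      then show ?thesis by (auto intro!: prod_nonneg mult_nonneg_nonneg)
    qed
  qed (use J in \<open>auto intro!: finite_Pi_pmf\<close>)
  also have "\<dots> = pexp ?p (\<lambda>\<omega>. 2 ^ (m * card B) * (\<Prod>v\<in>(\<Union>n\<in>B. V n). if \<omega> v then 1 / 2 else 1))"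
    using B finV disjB
    by (subst prod.UNION_disjoint) (auto simp: prod.distrib power_mult)
  also have "\<dots> = 2 ^ (m * card B) * (1 - r / 2) ^ card (\<Union>n\<in>B. V n)"
    using J B r by (simp, subst frogs_weight_expectation) auto
  also have "card (\<Union>n\<in>B. V n) = (\<Sum>n\<in>B. card (V n))"
    using B finV disjB by (intro card_UN_disjoint) auto
  also have "2 ^ (m * card B) * (1 - r / 2) ^ (\<Sum>n\<in>B. card (V n)) = (\<Prod>n\<in>B. 2 ^ m * (1 - r / 2) ^ card (V n))"
    by (simp add: prod.distrib power_sum power_mult)
  also have "\<dots> \<le> (\<Prod>n\<in>B. 1 / 2)"
  proof (rule prod_mono, rule conjI)
    fix n assume "n \<in> B"
    then have "K \<le> card (V n)" by (simp add: B_def)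
    \<comment> \<open>Origin of the condition on K: the empty-site factor becomes at most exp (- (m
      + 1)), which beats 2^m and leaves 1/2.\<close>
    then have le: "2 * (real m + 1) \<le> r * card (V n)" using K r by (meson mult_left_mono order.trans)
    have "(1 - r / 2) ^ card (V n) \<le> exp (- r / 2) ^ card (V n)"
      using r exp_ge_add_one_self[of "- r / 2"] by (intro power_mono) auto
    also have "\<dots> = exp (- (r * card (V n)) / 2)" by (simp add: exp_of_nat_mult[symmetric] mult.commute)
    also have "\<dots> \<le> exp (- (real m + 1))" using le by simp
    also have "\<dots> = 1 / exp 1 ^ (m + 1)"
      using exp_of_nat_mult[of "m + 1" "1 :: real"] by (simp only: exp_minus) (simp add: divide_inverse add.commute)
    also have "\<dots> \<le> 1 / 2 ^ (m + 1)"
      using exp_ge_add_one_self[of 1] by (intro divide_left_mono power_mono) auto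
    finally have "2 ^ m * (1 - r / 2) ^ card (V n) \<le> 2 ^ m * (1 / 2 ^ (m + 1))" by (intro mult_left_mono) auto
    then show "2 ^ m * (1 - r / 2) ^ card (V n) \<le> 1 / 2" by simp
  qed (use r in auto)
  also have "\<dots> = (\<Prod>n\<in>{..<M}. if K \<le> card (V n) then 1 / 2 else 1)"
    by (subst prod.If_cases) (auto simp: B_def Int_def)
  finally show ?thesis by (simp add: visit_weight_def)
qed

section \<open>One stage of the exploration\<close>

lemma finite_site_ball: "finite {y :: ('d::finite) site. site_dist y b \<le> N}"
proof -
  let ?J = "{y :: 'd site. site_dist y b \<le> N}"
  define M where "M = \<lceil>N\<rceil>"
  have "?J \<subseteq> (\<lambda>f. \<chi> i. f i) ` (PiE UNIV (\<lambda>i. {b $ i - M..b $ i + M}))"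
  proof
    fix y assume "y \<in> ?J"
    then have "site_dist y b \<le> N" by simp
    have "b $ i - M \<le> y $ i \<and> y $ i \<le> b $ i + M" for i
    proof -
      have "real_of_int \<bar>y $ i - b $ i\<bar> \<le> site_dist y b"
        using component_le_norm_cart[of "int_to_real_vec (y - b)" i] by (simp add: int_to_real_vec_def)
      also have "\<dots> \<le> N" using \<open>site_dist y b \<le> N\<close> .
      also have "\<dots> \<le> real_of_int M" by (simp add: M_def)
      finally have "\<bar>y $ i - b $ i\<bar> \<le> M" by (simp only: of_int_le_iff)
      then show ?thesis by (simp add: abs_le_iff)
    qed
    then have "vec_nth y \<in> PiE UNIV (\<lambda>i. {b $ i - M..b $ i + M})" by auto
    moreover have "y = (\<chi> i. vec_nth y i)" by simp
    ultimately show "y \<in> (\<lambda>f. \<chi> i. f i) ` (PiE UNIV (\<lambda>i. {b $ i - M..b $ i + M}))" by blast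
  qed
  moreover have "finite (PiE (UNIV :: 'd set) (\<lambda>i. {b $ i - M..b $ i + M}))" by (rule finite_PiE) auto
  ultimately show ?thesis using finite_surj by blast
qed

text \<open>K sites are enough to expect m frogs; p is the probability that a window of length
  \<open>W i\<close>, started within 2 l_i of a sphere of radius at least A l_i, discovers K sites;
  \<open>c\<close> bounds window lengths in units of l_i^2. The two inequalities for \<kappa> and m
  are those of \<open>window_contraction\<close> and of the summability of failure probability times
  cost.\<close>

locale frog_stage =
  fixes b :: "('d::finite) site" and r h p c \<kappa> K A N :: real and m T :: nat and W :: "nat \<Rightarrow> nat"
    and l :: "nat \<Rightarrow> real"
  assumes r: "0 \<le> r" "r \<le> 1" and h: "h \<ge> 1" and p: "0 < p" "p \<le> 1" and c: "c \<ge> 0"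
    and \<kappa>: "\<kappa> \<ge> 2" "(1 + c) / \<kappa>\<^sup>2 \<le> p / 4" and m: "m \<ge> 1" "(1 - p / 4) ^ m * \<kappa>\<^sup>2 \<le> 1 / 2"
    and K: "2 * (real m + 1) \<le> r * K" and A: "A \<ge> 1"
    and W: "\<And>i. real (W i) \<le> c * (l i)\<^sup>2" and l_def: "\<And>i. l i = 8 * h * m * \<kappa> ^ i"
    and window: "\<And>i \<rho> y. A * l i \<le> \<rho> \<Longrightarrow> \<bar>site_dist y b - \<rho>\<bar> \<le> 2 * l i \<Longrightarrow>
      p \<le> pprob (rw_pmf (W i)) {ys. K \<le> card (annulus_visits b \<rho> h y ys)}"
begin

definition J :: "'d site set" where "J = {y. site_dist y b \<le> N}"

abbreviation env :: "'d env pmf" where "env \<equiv> env_pmf r J T"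

definition ball_sites :: "real \<Rightarrow> 'd site set" where "ball_sites \<rho> = {y. site_dist y b < \<rho>}"

abbreviation reach_prob :: "real \<Rightarrow> 'd site set \<Rightarrow> nat \<Rightarrow> real" where
  "reach_prob \<rho> F u \<equiv> pprob env {e. reach_within b e (ball_sites \<rho>) F u}"

text \<open>Here \<open>F\<close> stands for awake frogs with unrevealed walks, and the ball of radius \<open>\<rho>\<close> for the
  unexplored region.\<close>

definition front :: "real \<Rightarrow> 'd site set \<Rightarrow> bool" where
  "front \<rho> F \<longleftrightarrow> F \<subseteq> J \<and> m \<le> card F \<and> (\<forall>x\<in>F. \<rho> \<le> site_dist x b \<and> site_dist x b \<le> \<rho> + 2 * h)"

lemma finite_J [simp]: "finite J"
  unfolding J_def by (rule finite_site_ball)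

lemma finite_env [simp]: "finite (set_pmf env)"
  by (rule finite_env_pmf) simp

text \<open>The number n encodes scale n div m and walker n mod m. The annulus reserved for this
  pair is centred at radius \<rho> - depth n and has half-width h.\<close>

definition depth :: "nat \<Rightarrow> real" where
  "depth n = 3 * h * (1 + m * \<kappa> ^ (n div m) + real (n mod m))"

definition start_time :: "nat \<Rightarrow> nat" where "start_time i = (\<Sum>j<i. W j)"

lemma start_time_Suc: "start_time (Suc i) = start_time i + W i"
  by (simp add: start_time_def)

lemma l_pos: "l i > 0"
  using h m \<kappa> by (simp add: l_def)

lemma l_Suc: "l (Suc i) = \<kappa> * l i"
  by (simp add: l_def)

text \<open>Within a scale the offsets differ by at least 1. Between scales, \<kappa> \<ge> 2 at
  least doubles the term with \<kappa>, leaving room for m offsets. The gap 3 h exceeds the width 2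
  h, so the annuli are disjoint.\<close>

lemma depth_less:
  assumes "n < n'"
  shows "depth n + 3 * h \<le> depth n'"
proof -
  have "m * \<kappa> ^ (n div m) + real (n mod m) + 1 \<le> m * \<kappa> ^ (n' div m) + real (n' mod m)"
  proof (cases "n div m = n' div m")
    case True
    then have "n mod m < n' mod m" using assms
      by (metis add_less_cancel_left mult_div_mod_eq)
    then show ?thesis using True by simp
  next
    case False
    then have *: "Suc (n div m) \<le> n' div m" using assms by (simp add: div_le_mono le_neq_implies_less less_imp_le Suc_leI)
    have "n mod m < m" using m by simp
    then have "real (n mod m) + 1 \<le> real m * 1" by simp
    also have "\<dots> \<le> m * \<kappa> ^ (n div m)" using \<kappa> by (intro mult_left_mono one_le_power) auto
    finally have "m * \<kappa> ^ (n div m) + real (n mod m) + 1 \<le> m * (2 * \<kappa> ^ (n div m))" by simp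
    also have "\<dots> \<le> m * \<kappa> ^ Suc (n div m)" using \<kappa> by (intro mult_left_mono) (auto intro!: mult_right_mono)
    also have "\<dots> \<le> m * \<kappa> ^ (n' div m)" using * \<kappa> by (intro mult_left_mono power_increasing) auto
    finally show ?thesis by simp
  qed
  then have "3 * h * (m * \<kappa> ^ (n div m) + real (n mod m) + 1) \<le> 3 * h * (m * \<kappa> ^ (n' div m) + real (n' mod m))"
    using h by (intro mult_left_mono) auto
  then show ?thesis by (simp add: depth_def algebra_simps)
qed

lemma depth_ge: "6 * h \<le> depth n"
proof -
  have "1 * 1 \<le> real m * \<kappa> ^ (n div m)" using m \<kappa> by (intro mult_mono one_le_power) auto
  then have "3 * h * 2 \<le> 3 * h * (1 + m * \<kappa> ^ (n div m) + real (n mod m))" using h by (intro mult_left_mono) auto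
  then show ?thesis by (simp add: depth_def)
qed

text \<open>A walker starts up to 2 h outside the sphere of radius \<rho>; it must be within l_i of
  the sphere it aims at. This is the origin of the 8 in l_i: 2 + 3 + 3, as both m and 1 are at most
  m \<kappa>^i.\<close>

lemma depth_le: "2 * h + depth n \<le> l (n div m)"
proof -
  have "n mod m < m" using m by simp
  then have 1: "real (n mod m) + 1 \<le> m" by simp
  have 2: "real m * 1 \<le> m * \<kappa> ^ (n div m)" using \<kappa> by (intro mult_left_mono one_le_power) auto
  have "2 + 3 * (1 + m * \<kappa> ^ (n div m) + real (n mod m)) \<le> 8 * (m * \<kappa> ^ (n div m))"
  proof -
    define z where "z = real m * \<kappa> ^ (n div m)"
    have "1 \<le> real m" using m by simp
    then show ?thesis using 1 2 unfolding z_def[symmetric] by simp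
  qed
  then have "h * (2 + 3 * (1 + m * \<kappa> ^ (n div m) + real (n mod m))) \<le> h * (8 * (m * \<kappa> ^ (n div m)))"
    using h by (intro mult_left_mono) auto
  then show ?thesis by (simp add: depth_def l_def algebra_simps)
qed

context
  fixes \<rho> :: real and F :: "'d site set" and I :: nat and f :: "nat \<Rightarrow> 'd site"
  assumes front: "front \<rho> F" and \<rho>N: "\<rho> \<le> N" and I: "\<And>i. i < I \<Longrightarrow> (A + 1) * l i \<le> \<rho>"
    and T: "start_time I \<le> T" and f: "inj_on f {..<m}" "f ` {..<m} \<subseteq> F"
begin

definition found :: "nat \<Rightarrow> ('d site \<Rightarrow> 'd site list) \<Rightarrow> 'd site set" where
  "found n s = window_visits b (\<rho> - depth n) h (f (n mod m)) (start_time (n div m)) (W (n div m)) (s (f (n mod m)))"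

definition woken :: "nat \<Rightarrow> 'd env \<Rightarrow> 'd site set" where
  "woken n e = {v \<in> found n (snd e). fst e v}"

definition success :: "nat \<Rightarrow> 'd env \<Rightarrow> bool" where
  "success n e \<longleftrightarrow> m \<le> card (woken n e)"

lemma found_dist: "v \<in> found n s \<Longrightarrow> \<bar>site_dist v b - (\<rho> - depth n)\<bar> \<le> h"
  unfolding found_def by (erule window_visits_pos)

lemma found_sub_J: "found n s \<subseteq> J"
  using found_dist[of _ n s] depth_ge[of n] h \<rho>N by (force simp: J_def abs_le_iff)

lemma finite_found [simp]: "finite (found n s)"
  by (simp add: found_def)

lemma found_disjoint:
  assumes "n < n'"
  shows "found n s \<inter> found n' s' = {}"
proof -
  have False if "v \<in> found n s" "v \<in> found n' s'" for v
    using found_dist[OF that(1)] found_dist[OF that(2)] depth_less[OF assms] h by (simp add: abs_le_iff)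
  then show ?thesis by blast
qed

lemma f_mem: "f (n mod m) \<in> F" "f (n mod m) \<in> J"
proof -
  have "n mod m \<in> {..<m}" using m by simp
  then show "f (n mod m) \<in> F" using f by blast
  then show "f (n mod m) \<in> J" using front by (auto simp: front_def)
qed

text \<open>Given the walks, the reserved annuli make the found sets disjoint, so
  \<open>few_frogs_prob\<close> bounds the failure of all attempts by a product of weights. Grouped
  by walker, this product factorises because the m walks start at distinct sites, and each factor is
  bounded by \<open>all_windows_bound\<close>.\<close>

lemma all_fail_prob:
  assumes "i \<le> I"
  shows "pprob env {e. \<forall>n<i * m. \<not> success n e} \<le> ((1 - p / 4) ^ i) ^ m"
proof -
  let ?p\<omega> = "frogs_pmf r J" and ?ps = "walks_pmf T J :: ('d site \<Rightarrow> 'd site list) pmf"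
  have fin: "finite (set_pmf ?ps)" by (rule finite_Pi_pmf) auto
  have T': "(\<Sum>j<i. W j) \<le> T"
  proof -
    have "(\<Sum>j<i. W j) \<le> (\<Sum>j<I. W j)" using assms by (intro sum_mono2) auto
    then show ?thesis using T by (simp add: start_time_def)
  qed
  define V where "V a j xs = window_visits b (\<rho> - depth (j * m + a)) h (f a) (start_time j) (W j) xs" for a j xs
  have "pprob env {e. \<forall>n<i * m. \<not> success n e}
    = pexp ?ps (\<lambda>s. pprob ?p\<omega> {\<omega>. \<forall>n<i * m. card {v \<in> found n s. \<omega> v} < m})"
    by (simp add: pexp_of_bool[symmetric] pexp_env success_def woken_def not_le)
  also have "\<dots> \<le> pexp ?ps (\<lambda>s. \<Prod>n<i * m. visit_weight K (found n s))"
    using r K found_sub_J found_disjoint fin by (intro pexp_mono few_frogs_prob) auto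
  also have "\<dots> = pexp ?ps (\<lambda>s. \<Prod>a<m. \<Prod>j<i. visit_weight K (V a j (s (f a))))"
  proof (rule pexp_cong)
    fix s
    have "(\<Prod>n<i * m. visit_weight K (found n s)) = (\<Prod>j<i. \<Prod>n\<in>{j * m..<j * m + m}. visit_weight K (found n s))"
      by (rule prod.nat_group[symmetric])
    also have "\<dots> = (\<Prod>j<i. \<Prod>a<m. visit_weight K (found (j * m + a) s))"
    proof (rule prod.cong)
      fix j
      show "(\<Prod>n\<in>{j * m..<j * m + m}. visit_weight K (found n s)) = (\<Prod>a<m. visit_weight K (found (j * m + a) s))"
        using prod.shift_bounds_nat_ivl[of "\<lambda>n. visit_weight K (found n s)" 0 "j * m" m]
        by (simp add: lessThan_atLeast0 add.commute)
    qed simp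
    also have "\<dots> = (\<Prod>a<m. \<Prod>j<i. visit_weight K (found (j * m + a) s))" by (rule prod.swap)
    also have "\<dots> = (\<Prod>a<m. \<Prod>j<i. visit_weight K (V a j (s (f a))))"
      by (intro prod.cong refl) (simp add: found_def V_def)
    finally show "(\<Prod>n<i * m. visit_weight K (found n s)) = (\<Prod>a<m. \<Prod>j<i. visit_weight K (V a j (s (f a))))" .
  qed
  \<comment> \<open>\<open>pexp_Pi_prod\<close> is indexed by sites, so the walker's number has to
    be recovered from its starting site.\<close>
  also have "\<dots> = pexp ?ps (\<lambda>s. \<Prod>x\<in>f ` {..<m}. \<Prod>j<i. visit_weight K (V (inv_into {..<m} f x) j (s x)))"
    using f(1) by (simp add: prod.reindex)
  also have "\<dots> = (\<Prod>x\<in>f ` {..<m}. pexp (rw_pmf T) (\<lambda>xs. \<Prod>j<i. visit_weight K (V (inv_into {..<m} f x) j xs)))"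
    using f front by (intro pexp_Pi_prod[where f = "\<lambda>x xs. \<Prod>j<i. visit_weight K (V (inv_into {..<m} f x) j xs)"])
      (auto simp: front_def intro!: prod_nonneg visit_weight_bounds)
  also have "\<dots> = (\<Prod>a<m. pexp (rw_pmf T) (\<lambda>xs. \<Prod>j<i. visit_weight K (V a j xs)))"
    using f(1) by (simp add: prod.reindex)
  also have "\<dots> \<le> (\<Prod>a<m. (1 - p / 4) ^ i)"
  proof (rule prod_mono, rule conjI)
    fix a assume a: "a \<in> {..<m}"
    have d: "(j * m + a) div m = j" "(j * m + a) mod m = a" for j using a by auto
    show "pexp (rw_pmf T) (\<lambda>xs. \<Prod>j<i. visit_weight K (V a j xs)) \<le> (1 - p / 4) ^ i"
      unfolding V_def start_time_def
    proof (rule all_windows_bound[where l = l and c = c and \<kappa> = \<kappa>])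
      fix j y assume j: "j < i" and y: "\<bar>site_dist y b - (\<rho> - depth (j * m + a))\<bar> \<le> 2 * l j"
      have "A * l j \<le> \<rho> - depth (j * m + a)"
        using I[of j] j assms depth_le[of "j * m + a"] h unfolding d by (simp add: algebra_simps)
      then show "p \<le> pprob (rw_pmf (W j)) {ys. K \<le> card (annulus_visits b (\<rho> - depth (j * m + a)) h y ys)}"
        using y by (rule window)
    next
      fix j assume "j < i"
      have "f a \<in> F" using a f by auto
      then have "\<rho> \<le> site_dist (f a) b" "site_dist (f a) b \<le> \<rho> + 2 * h" using front by (auto simp: front_def)
      then show "\<bar>site_dist (f a) b - (\<rho> - depth (j * m + a))\<bar> \<le> l j"
        using depth_le[of "j * m + a"] depth_ge[of "j * m + a"] h unfolding d by (simp add: abs_le_iff)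
    qed (use l_pos l_Suc W \<kappa> p c T' in auto)
  qed (auto intro!: pexp_nonneg prod_nonneg visit_weight_bounds)
  finally show ?thesis by simp
qed

text \<open>Decompose by the first successful attempt n and the set G of frogs it wakes, then use
  the hypothesis for G with the remaining time. The form \<beta> exp (\<theta> u) - 1 suits this:
  losing time S multiplies the exponential by exp (- \<theta> S) \<ge> 1 - \<theta> S, so only the
  mean of S matters, and since \<beta> \<le> 1 the bound is at most 0, hence trivial, when the time
  is used up.\<close>

lemma stage_recursion:
  fixes \<beta> \<theta> c0 :: real
  assumes IH: "\<And>n G u'. n < I * m \<Longrightarrow> front (\<rho> - depth n - h) G \<Longrightarrow> u' \<le> u \<Longrightarrow>
      c0 * (\<beta> * exp (\<theta> * real u') - 1) \<le> reach_prob (\<rho> - depth n - h) G u'"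
    and pos: "0 \<le> \<beta>" "\<beta> \<le> 1" "0 \<le> \<theta>" "0 \<le> c0"
  shows "c0 * (\<beta> * exp (\<theta> * real u) * (1 - ((1 - p / 4) ^ I) ^ m - (\<Sum>i<I. \<theta> * real (start_time (Suc i)) * ((1 - p / 4) ^ i) ^ m)) - 1)
    \<le> reach_prob \<rho> F u"
proof -
  let ?cost = "\<Sum>i<I. \<theta> * real (start_time (Suc i)) * ((1 - p / 4) ^ i) ^ m"
  define first where "first n e \<longleftrightarrow> success n e \<and> (\<forall>n'<n. \<not> success n' e)" for n e
  define S where "S n = start_time (Suc (n div m))" for n
  define P where "P n = pprob env {e. first n e}" for n
  define X where "X n = c0 * (\<beta> * exp (\<theta> * (real u - real (S n))) - 1)" for n
  define R where "R n G e \<longleftrightarrow> S n \<le> u \<and> reach_within b e (ball_sites (\<rho> - depth n - h)) G (u - S n)" for n G e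
  let ?outcome = "\<lambda>n G e. first n e \<and> woken n e = G"
  have woken_sub: "woken n e \<in> Pow J" for n e
    using found_sub_J by (auto simp: woken_def)
  \<comment> \<open>the walks from \<open>F\<close> and the frogs outside the smaller ball determine the outcome of the stage;
    the walks from \<open>G\<close> and everything inside the smaller ball are independent of it\<close>
  have indep: "pprob env {e. ?outcome n G e} * X n
     \<le> pprob env {e. ?outcome n G e \<and> R n G e}" if n: "n < I * m" for n G
  proof (cases "front (\<rho> - depth n - h) G \<and> S n \<le> u")
    case True
    let ?\<rho> = "\<rho> - depth n - h"
    have "pprob env {e. ?outcome n G e \<and> R n G e}
      = pprob env {e. ?outcome n G e} * pprob env {e. R n G e}"
    proof (rule env_indep[where A = "J - ball_sites ?\<rho>" and B = "ball_sites ?\<rho>" and C = "f ` {..<m}" and D = "G \<union> ball_sites ?\<rho>"])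
      show "f ` {..<m} \<subseteq> J" using f front by (auto simp: front_def)
      show "f ` {..<m} \<inter> (G \<union> ball_sites ?\<rho>) = {}"
      proof -
        have "site_dist y b < \<rho>" if "y \<in> G \<union> ball_sites ?\<rho>" for y
          using that True depth_ge[of n] h by (auto simp: front_def ball_sites_def)
        moreover have "\<rho> \<le> site_dist y b" if "y \<in> f ` {..<m}" for y
          using that f front by (auto simp: front_def)
        ultimately show ?thesis by fastforce
      qed
      fix \<omega> \<omega>' :: "'d site \<Rightarrow> bool" and s s' :: "'d site \<Rightarrow> 'd site list"
      {
        assume \<omega>: "\<And>x. x \<in> J - ball_sites ?\<rho> \<Longrightarrow> \<omega> x = \<omega>' x" and s: "\<And>x. x \<in> f ` {..<m} \<Longrightarrow> s x = s' x"
        \<comment> \<open>Only attempts up to n are inspected. The same walks may have entered the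
          smaller ball, but occupations there are never read.\<close>
        have w: "woken n' (\<omega>, s) = woken n' (\<omega>', s')" if "n' \<le> n" for n'
        proof -
          have "f (n' mod m) \<in> f ` {..<m}" using m by simp
          then have "found n' s = found n' s'" using s unfolding found_def by metis
          moreover have "\<omega> v = \<omega>' v" if "v \<in> found n' s" for v
          proof (rule \<omega>)
            have "depth n' \<le> depth n" using depth_less[of n' n] \<open>n' \<le> n\<close> h by (cases "n' = n") auto
            then show "v \<in> J - ball_sites ?\<rho>"
              using found_dist[OF that] found_sub_J that by (auto simp: ball_sites_def abs_le_iff)
          qed
          ultimately show ?thesis by (auto simp: woken_def)
        qed
        then have "success n' (\<omega>, s) = success n' (\<omega>', s')" if "n' \<le> n" for n'
          using that by (simp add: success_def)
        then show "(first n (\<omega>, s) \<and> woken n (\<omega>, s) = G) = (first n (\<omega>', s') \<and> woken n (\<omega>', s') = G)"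
          using w by (auto simp: first_def)
      next
        assume "\<And>x. x \<in> ball_sites ?\<rho> \<Longrightarrow> \<omega> x = \<omega>' x" "\<And>x. x \<in> G \<union> ball_sites ?\<rho> \<Longrightarrow> s x = s' x"
        then show "R n G (\<omega>, s) = R n G (\<omega>', s')"
          unfolding R_def using reach_within_cong[of "ball_sites ?\<rho>" \<omega> \<omega>' G s s' b "u - S n"] by auto
      }
    qed auto
    moreover have "X n \<le> pprob env {e. R n G e}"
      using IH[OF n, of G "u - S n"] True by (simp add: X_def R_def)
    ultimately show ?thesis by (simp add: mult_left_mono)
  next
    case False
    \<comment> \<open>Either the time has run out and X n is at most 0, or G is not a front, and
      then it cannot be the outcome of a successful attempt.\<close>
    have "pprob env {e. ?outcome n G e} * X n \<le> 0"
    proof (cases "front (\<rho> - depth n - h) G")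
      case True
      with False have "real u - real (S n) \<le> 0" by simp
      then have "exp (\<theta> * (real u - real (S n))) \<le> 1" using pos by (simp add: mult_nonneg_nonpos)
      then have "\<beta> * exp (\<theta> * (real u - real (S n))) \<le> 1" using pos mult_mono[of \<beta> 1 "exp (\<theta> * (real u - real (S n)))" 1] by simp
      then have "X n \<le> 0" using pos by (simp add: X_def mult_nonneg_nonpos)
      then show ?thesis by (simp add: mult_nonneg_nonpos)
    next
      case False
      have "\<not> (first n e \<and> woken n e = G)" for e
      proof
        assume *: "first n e \<and> woken n e = G"
        then have "m \<le> card G" by (auto simp: first_def success_def)
        moreover have "G \<subseteq> found n (snd e)" using * by (auto simp: woken_def)
        ultimately show False
          using False found_dist[of _ n "snd e"] found_sub_J[of n "snd e"] by (force simp: front_def abs_le_iff)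
      qed
      then have "{e. ?outcome n G e} = {}" by blast
      then show ?thesis by (simp only: measure_empty mult_zero_left order_refl)
    qed
    then show ?thesis by (rule order.trans) simp
  qed
  have woken_reach: "reach_within b e (ball_sites \<rho>) F u" if "e \<in> set_pmf env" "R n (woken n e) e" "n < I * m" for n e
  proof -
    from that(2) obtain y t where y: "y \<in> woken n e" "t \<le> u - S n" "S n \<le> u"
      "reach b e (ball_sites (\<rho> - depth n - h)) y t"
      by (auto simp: R_def reach_within_def)
    then have fy: "fst e y" and yf: "y \<in> found n (snd e)" by (auto simp: woken_def)
    from yf obtain k where k: "k \<le> start_time (n div m) + W (n div m)" "k \<le> length (snd e (f (n mod m)))"
       "y = pos (f (n mod m)) (snd e (f (n mod m))) k"
      unfolding found_def by (elim window_visits_pos)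
    have "ball_sites (\<rho> - depth n - h) \<subseteq> ball_sites \<rho>" using depth_ge[of n] h by (auto simp: ball_sites_def)
    then have "reach b e (ball_sites \<rho>) y t" using y reach_mono by blast
    moreover have "y \<in> ball_sites \<rho>" using found_dist[OF yf] depth_ge[of n] h by (simp add: ball_sites_def abs_le_iff)
    ultimately have "reach b e (ball_sites \<rho>) (f (n mod m)) (k + t)"
      using k fy by (intro reach.jump[of k _ _ y]) auto
    moreover have "k + t \<le> u" using k(1) y by (simp add: S_def start_time_Suc)
    ultimately show ?thesis using f_mem by (auto simp: reach_within_def)
  qed
  have pt: "(\<Sum>n<I * m. \<Sum>G\<in>Pow J. of_bool (?outcome n G e \<and> R n G e) :: real)
      \<le> of_bool (reach_within b e (ball_sites \<rho>) F u)" if e: "e \<in> set_pmf env" for e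
  proof -
    have "(\<Sum>G\<in>Pow J. of_bool (?outcome n G e \<and> R n G e) :: real) \<le> of_bool (reach_within b e (ball_sites \<rho>) F u) * of_bool (first n e)"
      if n: "n < I * m" for n
    proof -
      have "(\<Sum>G\<in>Pow J. of_bool (?outcome n G e \<and> R n G e) :: real)
         = (\<Sum>G\<in>Pow J. if G = woken n e then of_bool (first n e \<and> R n (woken n e) e) else 0)"
        by (rule sum.cong) auto
      also have "\<dots> = of_bool (first n e \<and> R n (woken n e) e)"
        using woken_sub by (subst sum.delta) auto
      also have "\<dots> \<le> of_bool (reach_within b e (ball_sites \<rho>) F u) * of_bool (first n e)"
        using woken_reach[OF e _ n] by auto
      finally show ?thesis .
    qed
    then have "(\<Sum>n<I * m. \<Sum>G\<in>Pow J. of_bool (?outcome n G e \<and> R n G e) :: real)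
      \<le> (\<Sum>n<I * m. of_bool (reach_within b e (ball_sites \<rho>) F u) * of_bool (first n e))"
      by (intro sum_mono) auto
    also have "\<dots> = of_bool (reach_within b e (ball_sites \<rho>) F u) * of_bool (\<exists>n<I * m. success n e)"
      unfolding sum_distrib_left[symmetric] first_def by (subst sum_first_success) rule
    also have "\<dots> \<le> of_bool (reach_within b e (ball_sites \<rho>) F u)" by simp
    finally show ?thesis .
  qed
  have P_split: "P n = (\<Sum>G\<in>Pow J. pprob env {e. ?outcome n G e})" for n
  proof -
    have "P n = pexp env (\<lambda>e. \<Sum>G\<in>Pow J. of_bool (first n e \<and> woken n e = G))"
      unfolding P_def pexp_of_bool[symmetric]
    proof (rule pexp_cong)
      fix e
      have "(\<Sum>G\<in>Pow J. of_bool (first n e \<and> woken n e = G) :: real) = (\<Sum>G\<in>Pow J. if G = woken n e then of_bool (first n e) else 0)"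
        by (rule sum.cong) auto
      then show "of_bool (first n e) = (\<Sum>G\<in>Pow J. of_bool (first n e \<and> woken n e = G) :: real)"
        using woken_sub by (subst (asm) sum.delta) auto
    qed
    then show ?thesis by (simp only: pexp_sum finite_env pexp_of_bool)
  qed
  have "(\<Sum>n<I * m. P n * X n) \<le> (\<Sum>n<I * m. \<Sum>G\<in>Pow J. pprob env {e. ?outcome n G e \<and> R n G e})"
    unfolding P_split sum_distrib_right by (intro sum_mono indep) auto
  also have "\<dots> = pexp env (\<lambda>e. \<Sum>n<I * m. \<Sum>G\<in>Pow J. of_bool (?outcome n G e \<and> R n G e))"
    by (simp only: pexp_sum finite_env pexp_of_bool)
  also have "\<dots> \<le> pexp env (\<lambda>e. of_bool (reach_within b e (ball_sites \<rho>) F u))"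
    by (intro pexp_mono pt) auto
  finally have main: "(\<Sum>n<I * m. P n * X n) \<le> reach_prob \<rho> F u"
    by (simp only: pexp_of_bool)
  have P0: "0 \<le> P n" for n by (simp add: P_def)
  have sumP: "(\<Sum>n<I * m. P n) = pprob env {e. \<exists>n<I * m. success n e}"
  proof -
    have "(\<Sum>n<I * m. P n) = pexp env (\<lambda>e. \<Sum>n<I * m. of_bool (first n e))"
      by (simp only: P_def pexp_sum finite_env pexp_of_bool)
    then show ?thesis unfolding first_def sum_first_success pexp_of_bool .
  qed
  have "pprob env {e. \<exists>n<I * m. success n e} = 1 - pprob env {e. \<forall>n<I * m. \<not> success n e}"
  proof -
    have "{e. \<exists>n<I * m. success n e} = space env - {e. \<forall>n<I * m. \<not> success n e}" by auto
    then show ?thesis by (simp only: measure_pmf.prob_compl sets_measure_pmf UNIV_I)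
  qed
  then have sumP_ge: "1 - ((1 - p / 4) ^ I) ^ m \<le> (\<Sum>n<I * m. P n)"
    using all_fail_prob[of I] sumP by simp
  have sumP_le: "(\<Sum>n<I * m. P n) \<le> 1" unfolding sumP by simp
  \<comment> \<open>A first success at scale i forces all attempts at smaller scales to fail, so
    scale i is charged with the probability of that failure.\<close>
  have sumPS: "(\<Sum>n<I * m. P n * (\<theta> * S n)) \<le> ?cost"
  proof -
    have "(\<Sum>n<I * m. P n * (\<theta> * S n)) = (\<Sum>i<I. \<Sum>n\<in>{i * m..<i * m + m}. P n * (\<theta> * S n))"
      by (rule sum.nat_group[symmetric])
    also have "\<dots> \<le> ?cost"
    proof (rule sum_mono)
      fix i assume i: "i \<in> {..<I}"
      have "(\<Sum>n\<in>{i * m..<i * m + m}. P n * (\<theta> * S n)) = (\<Sum>n\<in>{i * m..<i * m + m}. P n) * (\<theta> * start_time (Suc i))"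
        unfolding sum_distrib_right
      proof (rule sum.cong)
        fix n assume "n \<in> {i * m..<i * m + m}"
        then have "n div m = i" by (intro div_nat_eqI) (auto simp: mult.commute)
        then show "P n * (\<theta> * S n) = P n * (\<theta> * start_time (Suc i))" by (simp add: S_def)
      qed simp
      also have "(\<Sum>n\<in>{i * m..<i * m + m}. P n) = pexp env (\<lambda>e. \<Sum>n\<in>{i * m..<i * m + m}. of_bool (first n e))"
        by (simp only: P_def pexp_sum finite_env pexp_of_bool)
      also have "\<dots> \<le> pexp env (\<lambda>e. of_bool (\<forall>n<i * m. \<not> success n e))"
        unfolding first_def by (intro pexp_mono sum_first_success_block) simp
      also have "\<dots> \<le> ((1 - p / 4) ^ i) ^ m"
        unfolding pexp_of_bool using i by (intro all_fail_prob) auto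
      finally show "(\<Sum>n\<in>{i * m..<i * m + m}. P n * (\<theta> * S n)) \<le> \<theta> * real (start_time (Suc i)) * ((1 - p / 4) ^ i) ^ m"
        using pos by (simp add: mult_right_mono mult.commute)
    qed
    finally show ?thesis .
  qed
  have "c0 * (\<beta> * exp (\<theta> * real u) * (1 - ((1 - p / 4) ^ I) ^ m - ?cost) - 1)
    \<le> c0 * (\<beta> * exp (\<theta> * real u) * (\<Sum>n<I * m. P n * (1 - \<theta> * S n)) - (\<Sum>n<I * m. P n))"
  proof (intro mult_left_mono diff_mono)
    have "(\<Sum>n<I * m. P n * (1 - \<theta> * S n)) = (\<Sum>n<I * m. P n) - (\<Sum>n<I * m. P n * (\<theta> * S n))"
      by (simp add: right_diff_distrib sum_subtractf)
    then show "1 - ((1 - p / 4) ^ I) ^ m - ?cost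
       \<le> (\<Sum>n<I * m. P n * (1 - \<theta> * S n))" using sumP_ge sumPS by linarith
  qed (use pos sumP_le in auto)
  also have "\<dots> = (\<Sum>n<I * m. P n * (c0 * (\<beta> * (exp (\<theta> * real u) * (1 - \<theta> * S n)) - 1)))"
    by (simp add: sum_distrib_left sum_subtractf sum.distrib algebra_simps)
  also have "\<dots> \<le> (\<Sum>n<I * m. P n * X n)"
  proof (rule sum_mono, rule mult_left_mono)
    fix n
    have "exp (\<theta> * real u) * (1 - \<theta> * S n) \<le> exp (\<theta> * real u) * exp (- (\<theta> * S n))"
      using exp_ge_add_one_self[of "- (\<theta> * S n)"] by (intro mult_left_mono) auto
    also have "\<dots> = exp (\<theta> * (real u - real (S n)))" by (simp add: exp_add[symmetric] right_diff_distrib)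
    finally show "c0 * (\<beta> * (exp (\<theta> * real u) * (1 - \<theta> * S n)) - 1) \<le> X n"
      unfolding X_def using pos by (intro mult_left_mono diff_mono) auto
  qed (rule P0)
  also note main
  finally show ?thesis .
qed

end

end

section \<open>Prescribed paths near the target, and iteration of the stages\<close>

lemma pexp_Pi_component:
  assumes "finite J" "x \<in> J" "\<And>x. finite (set_pmf (q x))" "\<And>y. 0 \<le> f y"
  shows "pexp (Pi_pmf J d q) (\<lambda>\<alpha>. f (\<alpha> x)) = pexp (q x) f"
  using pexp_Pi_prod[of J "{x}" q "\<lambda>_. f" d] assms by simp

lemma ex_steps: "\<exists>xs. set xs \<subseteq> srw_steps \<and> sum_list xs = (v :: ('d::finite) site)"
proof -
  let ?P = "\<lambda>v :: 'd site. \<exists>xs. set xs \<subseteq> srw_steps \<and> sum_list xs = v"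
  have add: "?P (v + w)" if vw: "?P v" "?P w" for v w
  proof -
    from vw obtain xs ys where "set xs \<subseteq> srw_steps" "sum_list xs = v" "set ys \<subseteq> srw_steps" "sum_list ys = w" by blast
    then show ?thesis by (intro exI[of _ "xs @ ys"]) auto
  qed
  have nat: "?P (axis c (int n))" "?P (axis c (- int n))" for c n
  proof (induction n)
    case 0
    { case 1 show ?case by (rule exI[of _ "[]"]) (simp add: axis_def vec_eq_iff) }
    { case 2 show ?case by (rule exI[of _ "[]"]) (simp add: axis_def vec_eq_iff) }
  next
    case (Suc n)
    have s: "?P (axis c 1)" "?P (axis c (- 1))"
      by (rule exI[of _ "[axis c 1]"], simp add: srw_steps_eq, rule exI[of _ "[axis c (- 1)]"], simp add: srw_steps_eq)
    have e: "axis c (int (Suc n)) = axis c (int n) + axis c 1" "axis c (- int (Suc n)) = axis c (- int n) + axis c (- 1)"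
      by (auto simp: axis_def vec_eq_iff)
    { case 1 show ?case unfolding e by (intro add Suc s) }
    { case 2 show ?case unfolding e by (intro add Suc s) }
  qed
  have int: "?P (axis c z)" for c z
    using nat[of c "nat z"] nat[of c "nat (- z)"] by (cases "z \<ge> 0") auto
  have "?P (\<Sum>c\<in>S. axis c (v $ c))" if "finite S" for S
    using that
  proof (induction S rule: finite_induct)
    case empty
    show ?case by (rule exI[of _ "[]"]) simp
  next
    case (insert c S)
    then show ?case unfolding sum.insert[OF insert(1,2)] by (intro add int) auto
  qed
  moreover have "(\<Sum>c\<in>UNIV. axis c (v $ c)) = v"
    by (simp add: vec_eq_iff axis_def sum_component)
  ultimately show ?thesis by (metis finite)
qed

text \<open>Finiteness of the ball gives a crude uniform bound, which is enough: it is used for a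
  radius that does not depend on the distance of the target from the origin.\<close>

lemma ex_short_steps:
  "\<exists>k0. \<forall>v :: ('d::finite) site. norm (int_to_real_vec v) \<le> R \<longrightarrow>
     (\<exists>xs. length xs \<le> k0 \<and> set xs \<subseteq> srw_steps \<and> sum_list xs = v)"
proof -
  have "\<forall>v :: 'd site. \<exists>xs. set xs \<subseteq> srw_steps \<and> sum_list xs = v" using ex_steps by blast
  then obtain g :: "'d site \<Rightarrow> 'd site list" where g: "\<And>v. set (g v) \<subseteq> srw_steps \<and> sum_list (g v) = v" by metis
  let ?S = "{v :: 'd site. norm (int_to_real_vec v) \<le> R}"
  have "finite ?S" using finite_site_ball[of 0 R] by simp
  then have "length (g v) \<le> Max ((\<lambda>v. length (g v)) ` ?S)" if "norm (int_to_real_vec v) \<le> R" for v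
    using that by (intro Max_ge) auto
  then show ?thesis using g by blast
qed

lemma rw_prob_list:
  assumes "set xs \<subseteq> (srw_steps :: ('d::finite) site set)"
  shows "pexp (rw_pmf (length xs)) (\<lambda>ys. of_bool (ys = xs)) = (1 / (2 * real CARD('d))) ^ length xs"
  using assms
proof (induction xs)
  case (Cons x xs)
  have "pexp (rw_pmf (length (x # xs))) (\<lambda>ys. of_bool (ys = x # xs))
    = pexp step_pmf (\<lambda>v. of_bool (v = x) * pexp (rw_pmf (length xs)) (\<lambda>ys. of_bool (ys = xs)))"
    unfolding list.size(4) add_0_right add_Suc_right pexp_rw_Suc by (simp add: of_bool_conj)
  also have "\<dots> = pmf step_pmf x * (1 / (2 * real CARD('d))) ^ length xs"
    using Cons by (simp add: pexp_of_bool measure_pmf_single)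
  also have "pmf step_pmf x = 1 / (2 * real CARD('d))"
    using Cons.prems by (simp add: step_pmf_def card_srw_steps)
  finally show ?case by simp
qed simp

lemma env_prob_steps:
  assumes J: "finite J" "x \<in> J" and xs: "set xs \<subseteq> (srw_steps :: ('d::finite) site set)" "length xs \<le> T"
  shows "pprob (env_pmf r J T) {e. take (length xs) (snd e x) = xs} = (1 / (2 * real CARD('d))) ^ length xs"
proof -
  have "pprob (env_pmf r J T) {e. take (length xs) (snd e x) = xs}
    = pexp (walks_pmf T J) (\<lambda>s. of_bool (take (length xs) (s x) = xs))"
    using J by (simp add: pexp_of_bool[symmetric] pexp_env)
  also have "\<dots> = pexp (rw_pmf T) (\<lambda>ys. of_bool (take (length xs) ys = xs))"
    using J by (intro pexp_Pi_component) auto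
  also have "\<dots> = pexp (rw_pmf (length xs)) (\<lambda>ys. of_bool (ys = xs))"
    using xs by (intro pexp_rw_take)
  finally show ?thesis using xs by (simp add: rw_prob_list)
qed

lemma exp_minus_le:
  fixes y :: real
  assumes "0 \<le> y" "y \<le> 1"
  shows "exp (- y) \<le> 1 - y / 2"
proof -
  have "y * y \<le> y" using assms by (simp add: mult_left_le)
  then have "1 \<le> (1 + y) * (1 - y / 2)" by (simp add: algebra_simps)
  also have "\<dots> \<le> exp y * (1 - y / 2)"
    using assms by (intro mult_right_mono exp_ge_add_one_self) auto
  finally show ?thesis using assms by (simp add: exp_minus field_simps)
qed

context frog_stage
begin

lemma start_time_bound: "real (start_time (Suc i)) \<le> 2 * c * (l i)\<^sup>2"
proof (induction i)
  case 0
  have "c * (l 0)\<^sup>2 \<ge> 0" using c by simp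
  then show ?case using W[of 0] by (simp add: start_time_def)
next
  case (Suc i)
  have "2\<^sup>2 \<le> \<kappa>\<^sup>2" using \<kappa> by (intro power_mono) auto
  then have "4 * (2 * c * (l i)\<^sup>2) \<le> \<kappa>\<^sup>2 * (2 * c * (l i)\<^sup>2)" using c by (intro mult_right_mono) auto
  then have "4 * (2 * c * (l i)\<^sup>2) \<le> 2 * c * (l (Suc i))\<^sup>2" by (simp add: l_Suc power_mult_distrib)
  moreover have "c * (l (Suc i))\<^sup>2 \<ge> 0" using c by simp
  ultimately show ?case using Suc W[of "Suc i"] unfolding start_time_Suc[of "Suc i"] of_nat_add by linarith
qed

lemma q_bounds: "0 \<le> (1 - p / 4) ^ m" "(1 - p / 4) ^ m * \<kappa>\<^sup>2 \<le> 1 / 2"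
  using p m by auto

lemma sum_cost_le:
  assumes "0 \<le> \<theta>"
  shows "(\<Sum>i<I. \<theta> * real (start_time (Suc i)) * ((1 - p / 4) ^ i) ^ m) \<le> 4 * c * \<theta> * (l 0)\<^sup>2"
proof -
  have "(\<Sum>i<I. \<theta> * real (start_time (Suc i)) * ((1 - p / 4) ^ i) ^ m) \<le> (\<Sum>i<I. 2 * c * \<theta> * (l 0)\<^sup>2 * (1 / 2) ^ i)"
  proof (rule sum_mono)
    fix i
    have "\<theta> * real (start_time (Suc i)) * ((1 - p / 4) ^ i) ^ m \<le> \<theta> * (2 * c * (l i)\<^sup>2) * ((1 - p / 4) ^ i) ^ m"
      using start_time_bound[of i] assms p by (intro mult_right_mono mult_left_mono) auto
    also have "\<dots> = 2 * c * \<theta> * (l 0)\<^sup>2 * ((1 - p / 4) ^ m * \<kappa>\<^sup>2) ^ i"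
      by (simp add: l_def power_mult_distrib power_mult[symmetric] mult.commute)
    also have "\<dots> \<le> 2 * c * \<theta> * (l 0)\<^sup>2 * (1 / 2) ^ i"
      using q_bounds c assms by (intro mult_left_mono power_mono) auto
    finally show "\<theta> * real (start_time (Suc i)) * ((1 - p / 4) ^ i) ^ m \<le> 2 * c * \<theta> * (l 0)\<^sup>2 * (1 / 2) ^ i" .
  qed
  also have "\<dots> = 2 * c * \<theta> * (l 0)\<^sup>2 * (\<Sum>i<I. (1 / 2) ^ i)" by (simp add: sum_distrib_left)
  also have "\<dots> \<le> 2 * c * \<theta> * (l 0)\<^sup>2 * 2"
    using c assms by (intro mult_left_mono) (auto simp: sum_gp_strict)
  finally show ?thesis by simp
qed

text \<open>All scales with (A + 1) l_i \<le> \<rho> are used; the extra l_i covers the depth of the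
  annuli, which thus keep radius at least A l_i. If I is their number, total failure has probability
  at most \<kappa>^(-2 I) = (l_0 / l_I)^2, and l_I exceeds \<rho> / (A + 1) by the choice of
  I.\<close>

lemma stage_step:
  assumes front: "front \<rho> F" and \<rho>: "0 < \<rho>" "\<rho> \<le> N"
    and T: "\<And>i. (A + 1) * l i \<le> N \<Longrightarrow> start_time (Suc i) \<le> T"
    and IH: "\<And>\<rho>' G u'. \<rho>' \<le> \<rho> - 2 * h \<Longrightarrow> front \<rho>' G \<Longrightarrow> u' \<le> u \<Longrightarrow>
      c0 * (\<beta> * exp (\<theta> * real u') - 1) \<le> reach_prob \<rho>' G u'"
    and pos: "0 \<le> \<beta>" "\<beta> \<le> 1" "0 \<le> \<theta>" "0 \<le> c0"
  shows "c0 * (\<beta> * exp (\<theta> * real u) * (1 - ((A + 1) * l 0 / \<rho>)\<^sup>2 - 4 * c * \<theta> * (l 0)\<^sup>2) - 1)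
    \<le> reach_prob \<rho> F u"
proof -
  have "finite F" "m \<le> card F" using front finite_subset[OF _ finite_J] by (auto simp: front_def)
  then obtain f where f: "inj_on f {..<m}" "f ` {..<m} \<subseteq> F"
    by (metis card_le_inj card_lessThan finite_lessThan)
  have "\<exists>i. \<rho> < (A + 1) * l i"
  proof -
    obtain i where "\<rho> < \<kappa> ^ i" using real_arch_pow[of \<kappa> \<rho>] \<kappa> by auto
    also have "1 * \<kappa> ^ i \<le> ((A + 1) * (8 * h * m)) * \<kappa> ^ i"
    proof (rule mult_right_mono)
      have "1 * 1 \<le> (8 * h) * real m" using h m by (intro mult_mono) auto
      then have "1 * 1 \<le> (A + 1) * (8 * h * m)" using A by (intro mult_mono) auto
      then show "1 \<le> (A + 1) * (8 * h * m)" by simp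
    qed (use \<kappa> in auto)
    finally show ?thesis by (auto simp: l_def mult.assoc)
  qed
  define I where "I = (LEAST i. \<rho> < (A + 1) * l i)"
  have I: "\<rho> < (A + 1) * l I" unfolding I_def by (rule LeastI_ex) fact
  have less_I: "(A + 1) * l i \<le> \<rho>" if "i < I" for i
    using not_less_Least[of i "\<lambda>i. \<rho> < (A + 1) * l i"] that by (auto simp: I_def not_less)
  have T_I: "start_time I \<le> T"
  proof (cases I)
    case 0
    then show ?thesis by (simp add: start_time_def)
  next
    case (Suc i)
    then show ?thesis using less_I[of i] T[of i] \<rho> by auto
  qed
  have fail: "((1 - p / 4) ^ I) ^ m \<le> ((A + 1) * l 0 / \<rho>)\<^sup>2"
  proof -
    have k: "\<kappa>\<^sup>2 > 0" using \<kappa> by auto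
    have "((1 - p / 4) ^ I) ^ m = ((1 - p / 4) ^ m) ^ I" by (simp add: power_mult[symmetric] mult.commute)
    also have "\<dots> \<le> (1 / \<kappa>\<^sup>2) ^ I"
    proof (rule power_mono)
      have "(1 - p / 4) ^ m * \<kappa>\<^sup>2 \<le> 1" using q_bounds by simp
      then show "(1 - p / 4) ^ m \<le> 1 / \<kappa>\<^sup>2" using k by (simp add: pos_le_divide_eq)
    qed (rule q_bounds)
    also have "\<dots> = (l 0 / l I)\<^sup>2"
      using h m \<kappa> by (simp add: l_def power_divide power_mult_distrib power_mult[symmetric] mult.commute)
    also have "\<dots> \<le> ((A + 1) * l 0 / \<rho>)\<^sup>2"
    proof (rule power_mono)
      have "\<rho> * l 0 \<le> (A + 1) * l I * l 0" using I l_pos[of 0] by (intro mult_right_mono) auto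
      then show "l 0 / l I \<le> (A + 1) * l 0 / \<rho>" using l_pos[of I] \<rho> by (simp add: field_simps)
    qed (use l_pos[of 0] l_pos[of I] in simp)
    finally show ?thesis .
  qed
  have "c0 * (\<beta> * exp (\<theta> * real u) * (1 - ((1 - p / 4) ^ I) ^ m - (\<Sum>i<I. \<theta> * real (start_time (Suc i)) * ((1 - p / 4) ^ i) ^ m)) - 1)
    \<le> reach_prob \<rho> F u"
  proof (rule stage_recursion[OF front \<rho>(2) less_I T_I f])
    fix n G u' assume "n < I * m" "front (\<rho> - depth n - h) G" "u' \<le> u"
    then show "c0 * (\<beta> * exp (\<theta> * real u') - 1)
      \<le> reach_prob (\<rho> - depth n - h) G u'"
      using depth_ge[of n] h by (intro IH) auto
  qed (use pos in auto)
  moreover have "c0 * (\<beta> * exp (\<theta> * real u) * (1 - ((A + 1) * l 0 / \<rho>)\<^sup>2 - 4 * c * \<theta> * (l 0)\<^sup>2) - 1)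
    \<le> c0 * (\<beta> * exp (\<theta> * real u) * (1 - ((1 - p / 4) ^ I) ^ m - (\<Sum>i<I. \<theta> * real (start_time (Suc i)) * ((1 - p / 4) ^ i) ^ m)) - 1)"
    using pos fail sum_cost_le[OF pos(3), of I] by (intro mult_left_mono diff_mono) auto
  ultimately show ?thesis by linarith
qed

text \<open>Close to the target a single walker of the front is made to follow a prescribed
  path.\<close>

lemma base_case:
  assumes k0: "\<And>v :: 'd site. norm (int_to_real_vec v) \<le> R \<Longrightarrow> \<exists>xs. length xs \<le> k0 \<and> set xs \<subseteq> srw_steps \<and> sum_list xs = v"
    and \<rho>: "\<rho> + 2 * h \<le> R" and front: "front \<rho> F" and u: "k0 \<le> u" "k0 \<le> T"
  shows "(1 / (2 * real CARD('d))) ^ k0 \<le> reach_prob \<rho> F u"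
proof -
  have "F \<noteq> {}" using front m by (auto simp: front_def)
  then obtain x where x: "x \<in> F" by blast
  then have x': "x \<in> J" "site_dist x b \<le> R" using front \<rho> by (auto simp: front_def)
  then have "norm (int_to_real_vec (b - x)) \<le> R" by (simp add: int_to_real_vec_diff norm_minus_commute)
  then obtain xs where xs: "length xs \<le> k0" "set xs \<subseteq> srw_steps" "sum_list xs = b - x" using k0 by blast
  have "0 < CARD('d)" by simp
  then have "1 \<le> 2 * real CARD('d)" by linarith
  then have "1 / (2 * real CARD('d)) \<le> 1" by (simp add: divide_le_eq_1)
  then have "(1 / (2 * real CARD('d))) ^ k0 \<le> (1 / (2 * real CARD('d))) ^ length xs"
    using xs by (intro power_decreasing) auto
  also have "\<dots> = pprob env {e. take (length xs) (snd e x) = xs}"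
    using x' xs u by (intro env_prob_steps[symmetric]) auto
  also have "\<dots> \<le> reach_prob \<rho> F u"
  proof (rule prob_mono)
    fix e :: "'d env" assume e: "take (length xs) (snd e x) = xs"
    have "reach b e (ball_sites \<rho>) x (length xs)"
    proof (rule reach.hit)
      show "length xs \<le> length (snd e x)" using arg_cong[OF e, of length] by simp
      show "pos x (snd e x) (length xs) = b" using e xs by (simp add: pos_def)
    qed
    then show "reach_within b e (ball_sites \<rho>) F u"
      using x xs(1) u(1) unfolding reach_within_def by (meson order.trans)
  qed
  finally show ?thesis .
qed

text \<open>The radius is measured in units of 2 h, the least gain of a stage. The candidate \<beta>
  has ratio exp (- (a + \<gamma> / (n (n + 1)))) between n and n + 1: the term \<gamma> / j
  telescopes, so the failure probabilities cost only the bounded factor exp (- \<gamma>). Of the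
  constants in a and \<gamma>, one factor 2 pays for exp (- y) \<le> 1 - y / 2, and \<gamma> has
  another for 1 / n^2 \<le> 2 / (n (n + 1)). In the base case exp (- \<theta> k0) makes the bound
  trivial for u < k0, and exp (- \<theta> U) keeps it below the probability of the prescribed path
  for u \<le> U.\<close>

lemma front_induction:
  fixes \<theta> \<gamma> a R :: real and j0 k0 U :: nat
  assumes k0: "\<And>v :: 'd site. norm (int_to_real_vec v) \<le> R \<Longrightarrow> \<exists>xs. length xs \<le> k0 \<and> set xs \<subseteq> srw_steps \<and> sum_list xs = v"
    and R: "R = 2 * h * (real j0 + 1)" and kT: "k0 \<le> T"
    and T: "\<And>i. (A + 1) * l i \<le> N \<Longrightarrow> start_time (Suc i) \<le> T"
    and \<theta>: "0 \<le> \<theta>" and a: "a = 8 * c * \<theta> * (l 0)\<^sup>2" "a \<le> 1 / 2"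
    and \<gamma>: "\<gamma> = 4 * ((A + 1) * l 0 / (2 * h))\<^sup>2" and j0: "2 * \<gamma> \<le> real j0" "1 \<le> j0"
    and j: "j0 \<le> j" and \<rho>: "\<rho> \<le> 2 * h * real j" "\<rho> \<le> N" and front: "front \<rho> F" and u: "u \<le> U"
  shows "(1 / (2 * real CARD('d))) ^ k0 * exp (- \<theta> * real U)
      * (exp (- \<theta> * real k0 - a * real j - \<gamma> + \<gamma> / real j) * exp (\<theta> * real u) - 1)
    \<le> reach_prob \<rho> F u"
proof -
  define cb where "cb = (1 / (2 * real CARD('d))) ^ k0"
  define c0 where "c0 = cb * exp (- \<theta> * real U)"
  define \<beta> where "\<beta> j = exp (- \<theta> * real k0 - a * real j - \<gamma> + \<gamma> / real j)" for j :: nat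
  have cb: "0 \<le> cb" by (simp add: cb_def)
  have c0: "0 \<le> c0" using cb by (simp add: c0_def)
  have \<gamma>0: "0 \<le> \<gamma>" by (simp add: \<gamma>)
  have a0: "0 \<le> a" using c \<theta> by (simp add: a)
  have \<beta>_le: "\<beta> j \<le> exp (- \<theta> * real k0)" if "1 \<le> j" for j
  proof -
    have "\<gamma> / real j \<le> \<gamma> / 1" using that \<gamma>0 by (intro divide_left_mono) auto
    moreover have "0 \<le> a * real j" using a0 by simp
    ultimately show ?thesis by (simp add: \<beta>_def)
  qed
  have \<beta>1: "\<beta> j \<le> 1" if "1 \<le> j" for j
    using \<beta>_le[OF that] \<theta> order.trans by fastforce
  have "c0 * (\<beta> j * exp (\<theta> * real u) - 1) \<le> reach_prob \<rho> F u"
    using j \<rho> front u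
  proof (induction j arbitrary: \<rho> F u rule: dec_induct)
    case base
    show ?case
    proof (cases "k0 \<le> u")
      case True
      have "c0 * (\<beta> j0 * exp (\<theta> * real u) - 1) \<le> c0 * exp (\<theta> * real U)"
      proof (rule mult_left_mono[OF _ c0])
        have "\<beta> j0 * exp (\<theta> * real u) \<le> 1 * exp (\<theta> * real U)"
          using \<beta>1[of j0] j0 base \<theta> by (intro mult_mono) (auto simp: mult_left_mono)
        then show "\<beta> j0 * exp (\<theta> * real u) - 1 \<le> exp (\<theta> * real U)" by simp
      qed
      also have "\<dots> = cb" by (simp add: c0_def exp_minus)
      also have "\<dots> \<le> reach_prob \<rho> F u"
        unfolding cb_def using base True kT k0 by (intro base_case[of R]) (auto simp: R algebra_simps)
      finally show ?thesis .
    next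
      case False
      have "\<beta> j0 * exp (\<theta> * real u) \<le> exp (- \<theta> * real k0) * exp (\<theta> * real k0)"
        using \<beta>_le[of j0] j0 False \<theta> by (intro mult_mono) (auto simp: mult_left_mono)
      also have "\<dots> = 1" by (simp add: exp_minus)
      finally have "c0 * (\<beta> j0 * exp (\<theta> * real u) - 1) \<le> 0" using c0 by (simp add: mult_nonneg_nonpos)
      then show ?thesis by (rule order.trans) simp
    qed
  next
    case (step n)
    have n1: "1 \<le> n" using step j0 by simp
    then have nr: "real n \<ge> 1" by simp
    have eq: "\<gamma> / real n - \<gamma> / real (Suc n) = \<gamma> / (real n * real (Suc n))"
      using nr by (simp add: field_simps)
    have ratio: "\<beta> (Suc n) = \<beta> n * exp (- (a + \<gamma> / (real n * real (Suc n))))"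
      unfolding \<beta>_def exp_add[symmetric] eq[symmetric] by (simp add: algebra_simps)
    have dec: "\<beta> (Suc n) \<le> \<beta> n"
    proof -
      have "0 \<le> a + \<gamma> / (real n * real (Suc n))" using a0 \<gamma>0 by (intro add_nonneg_nonneg) auto
      then have "exp (- (a + \<gamma> / (real n * real (Suc n)))) \<le> 1" by (simp only: exp_le_one_iff neg_le_0_iff_le)
      then show ?thesis unfolding ratio by (intro mult_right_le_one_le) (auto simp: \<beta>_def)
    qed
    show ?case
    proof (cases "\<rho> \<le> 2 * h * real n")
      case True
      have "c0 * (\<beta> (Suc n) * exp (\<theta> * real u) - 1) \<le> c0 * (\<beta> n * exp (\<theta> * real u) - 1)"
        using dec c0 by (intro mult_left_mono diff_mono mult_right_mono) auto
      also have "\<dots> \<le> reach_prob \<rho> F u"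
        using step True by (intro step.IH) auto
      finally show ?thesis .
    next
      case False
      then have \<rho>n: "2 * h * real n < \<rho>" by simp
      moreover have "2 * h * real n > 0" using h nr by simp
      ultimately have \<rho>0: "0 < \<rho>" by linarith
      let ?fac = "1 - ((A + 1) * l 0 / \<rho>)\<^sup>2 - 4 * c * \<theta> * (l 0)\<^sup>2"
      have main: "c0 * (\<beta> n * exp (\<theta> * real u) * ?fac - 1) \<le> reach_prob \<rho> F u"
      proof (rule stage_step[OF _ \<rho>0 _ T])
        fix \<rho>' G u' assume "\<rho>' \<le> \<rho> - 2 * h" "front \<rho>' G" "u' \<le> u"
        then show "c0 * (\<beta> n * exp (\<theta> * real u') - 1) \<le> reach_prob \<rho>' G u'"
          using step h by (intro step.IH) (auto simp: algebra_simps)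
      qed (use step \<beta>1[OF n1] \<theta> c0 in \<open>auto simp: \<beta>_def\<close>)
      let ?y = "a + \<gamma> / (real n * real (Suc n))"
      have "exp (- ?y) \<le> 1 - ?y / 2"
      proof (rule exp_minus_le)
        have "\<gamma> / (real n * real (Suc n)) \<le> 1 / 2"
        proof -
          have "2 * \<gamma> \<le> real n * 1" using j0 step by simp
          also have "\<dots> \<le> real n * real (Suc n)" by (intro mult_left_mono) auto
          finally show ?thesis using nr by (simp add: divide_le_eq)
        qed
        then show "?y \<le> 1" using a(2) by linarith
      qed (use a0 \<gamma>0 in auto)
      also have "1 - ?y / 2 \<le> ?fac"
      proof -
        have "((A + 1) * l 0 / \<rho>)\<^sup>2 \<le> ((A + 1) * l 0 / (2 * h * real n))\<^sup>2"
        proof (rule power_mono)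
          show "(A + 1) * l 0 / \<rho> \<le> (A + 1) * l 0 / (2 * h * real n)"
            using \<rho>n h nr A l_pos[of 0] \<rho>0 by (intro divide_left_mono) auto
        qed (use A l_pos[of 0] \<rho>0 in auto)
        also have "\<dots> = \<gamma> / 4 / (real n * real n)"
          by (simp add: \<gamma> power_divide power_mult_distrib power2_eq_square)
        also have "\<dots> \<le> \<gamma> / 4 / (real n * real (Suc n) / 2)"
          using nr \<gamma>0 by (intro divide_left_mono) auto
        also have "\<dots> = \<gamma> / (real n * real (Suc n)) / 2" by simp
        finally show ?thesis unfolding a(1) by (simp only: add_divide_distrib)
      qed
      finally have "\<beta> (Suc n) \<le> \<beta> n * ?fac"
        unfolding ratio by (intro mult_left_mono) (auto simp: \<beta>_def)
      then have "\<beta> (Suc n) * exp (\<theta> * real u) \<le> \<beta> n * ?fac * exp (\<theta> * real u)"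
        by (intro mult_right_mono) auto
      then have "c0 * (\<beta> (Suc n) * exp (\<theta> * real u) - 1) \<le> c0 * (\<beta> n * exp (\<theta> * real u) * ?fac - 1)"
        using c0 by (intro mult_left_mono) (auto simp: algebra_simps)
      with main show ?thesis by linarith
    qed
  qed
  then show ?thesis by (simp add: c0_def cb_def \<beta>_def)
qed

end

section \<open>Creating the initial front at the origin\<close>

lemma norm_axis_real: "norm (axis c (a :: real)) = \<bar>a\<bar>"
  by (simp add: norm_eq_sqrt_inner inner_axis_axis)

lemma site_dist_axis:
  "j \<le> n \<Longrightarrow> site_dist (axis i (int j)) (axis i (int n)) = real n - real j"
proof -
  have "axis i (int j) - axis i (int n) = axis i (int j - int n)" by (simp add: axis_def vec_eq_iff)
  then show "j \<le> n \<Longrightarrow> ?thesis" by (simp add: int_to_real_vec_axis norm_axis_real)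
qed

context frog_stage
begin

text \<open>The sites 0 to m on the axis are forced to be occupied, and the frog at 0 is forced to
  walk along them. This wakes m frogs with fresh walks at a probability cost that does not depend on
  n.\<close>

lemma start_prob:
  fixes i :: 'd and n u :: nat
  assumes b: "b = axis i (int n)" and N: "N = real n" and m: "m < n" "m \<le> T"
  shows "r ^ (m + 1) * (1 / (2 * real CARD('d))) ^ m
      * reach_prob (real n - real m) ((\<lambda>j. axis i (int j)) ` {1..m}) u
    \<le> pprob env {e. fst e 0 \<and> (\<exists>t\<le>m + u. reach b e UNIV 0 t)}"
proof -
  let ?x = "\<lambda>j. axis i (int j) :: 'd site"
  let ?B = "ball_sites (real n - real m)"
  let ?F = "?x ` {1..m}" and ?X = "?x ` {0..m}"
  let ?l = "replicate m (axis i 1 :: 'd site)"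
  define P where "P e \<longleftrightarrow> (\<forall>x\<in>?X. fst e x) \<and> take m (snd e 0) = ?l" for e :: "'d env"
  have dist: "site_dist (?x j) b = real n - real j" if "j \<le> n" for j
    using that by (simp add: b site_dist_axis)
  have inj: "inj ?x" by (auto simp: inj_def axis_eq_axis)
  have XJ: "?X \<subseteq> J" unfolding J_def using m dist N by auto
  have x0: "?x 0 = 0" by (simp add: axis_def vec_eq_iff)
  have J0: "0 \<in> J" using XJ x0 by (metis atLeastAtMost_iff image_eqI le0 subsetD)
  have "pprob env {e. P e} = r ^ (m + 1) * (1 / (2 * real CARD('d))) ^ m"
  proof -
    have "pprob env {e. P e} = pexp (walks_pmf T J) (\<lambda>s. of_bool (take m (s 0) = ?l)
        * pexp (frogs_pmf r J) (\<lambda>\<omega>. \<Prod>x\<in>?X. of_bool (\<omega> x)))"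
    proof -
      have "of_bool (P (\<omega>, s)) = of_bool (take m (s 0) = ?l) * ((\<Prod>x\<in>?X. of_bool (\<omega> x)) :: real)" for \<omega> s
      proof (cases "\<forall>x\<in>?X. \<omega> x")
        case True
        then have "(\<Prod>x\<in>?X. of_bool (\<omega> x)) = (1 :: real)" by (intro prod.neutral) auto
        then show ?thesis using True by (simp only: P_def fst_conv snd_conv) simp
      next
        case False
        then have "(\<Prod>x\<in>?X. of_bool (\<omega> x)) = (0 :: real)" by (intro prod_zero) auto
        then show ?thesis using False by (auto simp: P_def)
      qed
      then show ?thesis by (simp add: pexp_of_bool[symmetric] pexp_env)
    qed
    also have "pexp (frogs_pmf r J) (\<lambda>\<omega>. \<Prod>x\<in>?X. of_bool (\<omega> x)) = (\<Prod>x\<in>?X. pexp (bernoulli_pmf r) of_bool)"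
      using XJ by (intro pexp_Pi_prod[where f = "\<lambda>_. of_bool"]) auto
    also have "\<dots> = r ^ (m + 1)" using r card_image[OF inj_on_subset[OF inj], of "{0..m}"] by simp
    also have "pexp (walks_pmf T J) (\<lambda>s. of_bool (take m (s 0) = ?l) * r ^ (m + 1))
      = pprob env {e. take (length ?l) (snd e 0) = ?l} * r ^ (m + 1)"
      by (simp add: pexp_of_bool[symmetric] pexp_env)
    also have "\<dots> = (1 / (2 * real CARD('d))) ^ m * r ^ (m + 1)"
      using J0 m by (subst env_prob_steps) (auto simp: srw_steps_eq)
    finally show ?thesis by simp
  qed
  then have "r ^ (m + 1) * (1 / (2 * real CARD('d))) ^ m * pprob env {e. reach_within b e ?B ?F u}
    = pprob env {e. P e \<and> reach_within b e ?B ?F u}"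
  proof (subst env_indep[where A = ?X and B = ?B and C = "{0}" and D = "?F \<union> ?B"])
    show "?X \<inter> ?B = {}" using dist m by (auto simp: ball_sites_def)
    have "0 \<notin> ?B" using dist[of 0] unfolding x0 by (simp add: ball_sites_def)
    moreover have "0 \<notin> ?F" using inj x0 by (auto simp: inj_def)
    ultimately show "{0} \<inter> (?F \<union> ?B) = {}" by auto
    fix \<omega> \<omega>' :: "'d site \<Rightarrow> bool" and s s' :: "'d site \<Rightarrow> 'd site list"
    {
      assume \<omega>: "\<And>x. x \<in> ?X \<Longrightarrow> \<omega> x = \<omega>' x" and s: "\<And>x. x \<in> {0} \<Longrightarrow> s x = s' x"
      have "(\<forall>x\<in>?X. \<omega> x) = (\<forall>x\<in>?X. \<omega>' x)" using \<omega> by (intro ball_cong) auto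
      moreover have "s 0 = s' 0" using s by simp
      ultimately show "P (\<omega>, s) = P (\<omega>', s')" by (simp only: P_def fst_conv snd_conv)
    next
      assume "\<And>x. x \<in> ?B \<Longrightarrow> \<omega> x = \<omega>' x" "\<And>x. x \<in> ?F \<union> ?B \<Longrightarrow> s x = s' x"
      then show "reach_within b (\<omega>, s) ?B ?F u = reach_within b (\<omega>', s') ?B ?F u"
        by (intro reach_within_cong) auto
    }
  qed (use XJ J0 in auto)
  also have "\<dots> \<le> pprob env {e. fst e 0 \<and> (\<exists>t\<le>m + u. reach b e UNIV 0 t)}"
  proof (rule prob_mono)
    fix e :: "'d env" assume e: "P e \<and> reach_within b e ?B ?F u"
    then obtain j t where j: "1 \<le> j" "j \<le> m" "t \<le> u" "reach b e ?B (?x j) t"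
      by (auto simp: reach_within_def)
    have "take m (snd e 0) = ?l" using e by (simp add: P_def)
    from arg_cong[OF this, of length] have len: "m \<le> length (snd e 0)" by simp
    have "take j (snd e 0) = take j (take m (snd e 0))" using j by (simp add: min_def)
    also have "\<dots> = replicate j (axis i 1)" using e j by (simp add: P_def min_def)
    finally have "pos 0 (snd e 0) j = ?x j"
      by (simp add: pos_def sum_list_replicate) (simp add: axis_def vec_eq_iff of_nat_index)
    then have "reach b e UNIV 0 (j + t)"
      using e j len by (intro reach.jump[of j _ _ "?x j"] reach_mono[OF j(4)]) (auto simp: P_def)
    moreover have "fst e 0"
    proof -
      have "0 \<in> ?X" by (rule image_eqI[of _ _ 0]) (simp_all only: x0 atLeastAtMost_iff le0)
      then show ?thesis using e unfolding P_def by blast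
    qed
    moreover have "j + t \<le> m + u" using j by simp
    ultimately show "fst e 0 \<and> (\<exists>t\<le>m + u. reach b e UNIV 0 t)" by blast
  qed
  finally show ?thesis .
qed

end

section \<open>Back to the infinite product space\<close>

definition project_env :: "('d::finite) site set \<Rightarrow> nat \<Rightarrow> ('d site \<Rightarrow> bool \<times> (nat \<Rightarrow> 'd site)) \<Rightarrow> 'd env" where
  "project_env J T w = ((\<lambda>x. x \<in> J \<and> fst (w x)), (\<lambda>x. if x \<in> J then map (snd (w x)) [0..<T] else []))"

lemma passage_time_refl: "passage_time w x x = 0"
proof -
  have "passage_time w x x \<le> sum_list (map (\<lambda>(a, b). tau w a b) (zip [x] (tl [x])))"
    unfolding passage_time_def by (rule INF_lower) auto
  then show ?thesis by simp
qed

lemma passage_time_jump: "passage_time w x z \<le> tau w x y + passage_time w y z"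
proof -
  \<comment> \<open>Moving the finite summand to the left lets the infimum on the right be handled
    path by path.\<close>
  have "passage_time w x z - tau w x y \<le> passage_time w y z" if "tau w x y \<noteq> \<infinity>"
    unfolding passage_time_def[of w y z]
  proof (rule INF_greatest)
    fix ps assume ps: "ps \<in> {ps. ps \<noteq> [] \<and> hd ps = y \<and> last ps = z}"
    have "passage_time w x z \<le> sum_list (map (\<lambda>(a, b). tau w a b) (zip (x # ps) (tl (x # ps))))"
      unfolding passage_time_def using ps by (intro INF_lower) auto
    also have "\<dots> = tau w x y + sum_list (map (\<lambda>(a, b). tau w a b) (zip ps (tl ps)))"
      using ps by (cases ps) auto
    finally show "passage_time w x z - tau w x y \<le> sum_list (map (\<lambda>(a, b). tau w a b) (zip ps (tl ps)))"
      using that by (cases "passage_time w x z"; cases "tau w x y"; cases "sum_list (map (\<lambda>(a, b). tau w a b) (zip ps (tl ps)))"; auto)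
  qed
  then show ?thesis
    by (cases "passage_time w x z"; cases "tau w x y"; cases "passage_time w y z") auto
qed

lemma tau_le:
  assumes "occ w x" "walk w x k = y"
  shows "tau w x y \<le> enat k"
  using assms by (auto simp: tau_def intro: Least_le)

lemma pos_project_env:
  assumes "k \<le> length (snd (project_env J T w) x)"
  shows "pos x (snd (project_env J T w) x) k = walk w x k"
  using assms
  by (auto simp: pos_def walk_def project_env_def take_map sum_list_sum_nth atLeast0LessThan intro!: sum.cong split: if_splits)

lemma reach_passage_time:
  assumes "reach b (project_env J T w) Q x t" "occ w x"
  shows "passage_time w x b \<le> enat t"
  using assms
proof (induction rule: reach.induct)
  case (hit k x)
  then have "tau w x b \<le> enat k" by (intro tau_le) (simp_all add: pos_project_env)
  then show ?case using passage_time_jump[of w x b b] by (simp add: passage_time_refl)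
next
  case (jump k x y t)
  have "tau w x y \<le> enat k" using jump by (intro tau_le) (simp_all add: pos_project_env)
  moreover have "passage_time w y b \<le> enat t" using jump by (auto simp: project_env_def occ_def)
  ultimately have "tau w x y + passage_time w y b \<le> enat k + enat t" by (rule add_mono)
  then show ?case using passage_time_jump[of w x b y] by simp
qed

lemma pmf_replicate:
  "pmf (replicate_pmf n p) v = (if length v = n then \<Prod>i<n. pmf p (v ! i) else 0)"
proof (induction n arbitrary: v)
  case (Suc n)
  show ?case
  proof (cases v)
    case Nil
    then have "v \<notin> set_pmf (replicate_pmf (Suc n) p)" by (auto simp: set_replicate_pmf)
    then show ?thesis using Nil by (simp add: set_pmf_iff del: replicate_pmf.simps)
  next
    case (Cons x xs)
    have "replicate_pmf (Suc n) p = map_pmf (\<lambda>(x, xs). x # xs) (pair_pmf p (replicate_pmf n p))"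
      by (simp add: pair_pmf_def map_bind_pmf)
    then have "pmf (replicate_pmf (Suc n) p) v = pmf (map_pmf (\<lambda>(x, xs). x # xs) (pair_pmf p (replicate_pmf n p))) ((\<lambda>(x, xs). x # xs) (x, xs))"
      using Cons by simp
    also have "\<dots> = pmf p x * pmf (replicate_pmf n p) xs"
      by (subst pmf_map_inj') (auto simp: inj_def pmf_pair)
    finally show ?thesis using Cons Suc[of xs] by (simp add: prod.lessThan_Suc_shift del: replicate_pmf.simps prod.lessThan_Suc)
  qed
qed (auto simp: indicator_def)

lemma steps_space_list:
  fixes v :: "('d::finite) site list"
  defines "M \<equiv> \<Pi>\<^sub>M k\<in>(UNIV :: nat set). measure_pmf (step_pmf :: 'd site pmf)"
  shows "{s. map s [0..<T] = v} \<in> sets M"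
    and "emeasure M {s. map s [0..<T] = v} = ennreal (pmf (rw_pmf T) v)"
proof -
  interpret product_prob_space "\<lambda>_ :: nat. measure_pmf (step_pmf :: 'd site pmf)" UNIV ..
  have sp: "space M = UNIV" by (simp add: M_def space_PiM)
  have "{s. map s [0..<T] = v} \<in> sets M \<and> emeasure M {s. map s [0..<T] = v} = ennreal (pmf (rw_pmf T) v)"
  proof (cases "length v = T")
    case True
    have eq: "{s. map s [0..<T] = v} = {s \<in> space M. \<forall>i\<in>{..<T}. s i \<in> {v ! i}}"
      using True by (auto simp: sp list_eq_iff_nth_eq)
    have "{s \<in> space M. \<forall>i\<in>{..<T}. s i \<in> {v ! i}} \<in> sets M"
      unfolding M_def by measurable
    moreover have "emeasure M {s \<in> space M. \<forall>i\<in>{..<T}. s i \<in> {v ! i}} = (\<Prod>i\<in>{..<T}. emeasure (measure_pmf step_pmf) {v ! i})"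
      unfolding M_def by (rule emeasure_PiM_Collect) auto
    moreover have "\<dots> = ennreal (pmf (rw_pmf T) v)"
      using True by (simp add: pmf_replicate emeasure_pmf_single prod_ennreal)
    ultimately show ?thesis unfolding eq by simp
  next
    case False
    then have "{s. map s [0..<T] = v} = {}" by auto
    then show ?thesis using False by (simp add: pmf_replicate)
  qed
  then show "{s. map s [0..<T] = v} \<in> sets M" "emeasure M {s. map s [0..<T] = v} = ennreal (pmf (rw_pmf T) v)"
    by auto
qed

lemma site_space_event:
  fixes v :: "('d::finite) site list"
  shows "{y. fst y = a \<and> map (snd y) [0..<T] = v} \<in> sets (site_space r)"
    and "emeasure (site_space r) {y. fst y = a \<and> map (snd y) [0..<T] = v}
      = ennreal (pmf (bernoulli_pmf r) a * pmf (rw_pmf T) v)"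
proof -
  let ?M = "\<Pi>\<^sub>M k\<in>(UNIV :: nat set). measure_pmf (step_pmf :: 'd site pmf)"
  interpret P: prob_space ?M by (rule prob_space_PiM) (rule measure_pmf.prob_space_axioms)
  have eq: "{y. fst y = a \<and> map (snd y) [0..<T] = v} = {a} \<times> {s. map s [0..<T] = v}" by auto
  have ss: "site_space r = measure_pmf (bernoulli_pmf r) \<Otimes>\<^sub>M ?M" by (simp add: site_space_def step_pmf_def)
  show "{y. fst y = a \<and> map (snd y) [0..<T] = v} \<in> sets (site_space r)"
    unfolding eq ss by (intro pair_measureI steps_space_list) auto
  show "emeasure (site_space r) {y. fst y = a \<and> map (snd y) [0..<T] = v}
      = ennreal (pmf (bernoulli_pmf r) a * pmf (rw_pmf T) v)"
    unfolding eq ss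
    by (subst P.emeasure_pair_measure_Times) (auto simp: steps_space_list emeasure_pmf_single ennreal_mult)
qed

lemma prob_space_site: "prob_space (site_space r :: (bool \<times> (nat \<Rightarrow> ('d::finite) site)) measure)"
proof -
  let ?M = "\<Pi>\<^sub>M k\<in>(UNIV :: nat set). measure_pmf (pmf_of_set (srw_steps :: 'd site set))"
  interpret Q: prob_space ?M by (rule prob_space_PiM) (rule measure_pmf.prob_space_axioms)
  interpret pair_prob_space "measure_pmf (bernoulli_pmf r)" ?M ..
  show ?thesis unfolding site_space_def by (rule prob_space_axioms)
qed

lemma prob_space_frog: "prob_space (frog_space r)"
  unfolding frog_space_def by (rule prob_space_PiM) (rule prob_space_site)

text \<open>The image law under \<open>project_env\<close> is computed atom by atom: an atom with
  default values outside J is a finite-dimensional cylinder, and any other has empty preimage and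
  mass 0.\<close>

lemma project_env_measure:
  fixes J :: "('d::finite) site set"
  assumes J: "finite J"
  shows "{w. project_env J T w = e} \<in> sets (frog_space r)"
    and "measure (frog_space r) {w. project_env J T w = e} = pmf (env_pmf r J T) e"
proof -
  let ?S = "site_space r :: (bool \<times> (nat \<Rightarrow> 'd site)) measure"
  interpret S: prob_space ?S by (rule prob_space_site)
  interpret product_prob_space "\<lambda>_ :: 'd site. ?S" UNIV ..
  have sp: "space (frog_space r :: ('d site \<Rightarrow> _) measure) = UNIV"
    by (simp add: frog_space_def site_space_def space_PiM space_pair_measure)
  obtain \<omega> s where e: "e = (\<omega>, s)" by (cases e)
  have pmf_e: "pmf (env_pmf r J T) e = pmf (frogs_pmf r J) \<omega> * pmf (walks_pmf T J) s"
    by (simp add: e env_pmf_def pmf_pair)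
  have "{w. project_env J T w = e} \<in> sets (frog_space r) \<and> emeasure (frog_space r) {w. project_env J T w = e} = ennreal (pmf (env_pmf r J T) e)"
  proof (cases "\<forall>x. x \<notin> J \<longrightarrow> \<not> \<omega> x \<and> s x = []")
    case True
    let ?X = "\<lambda>x. {y. fst y = \<omega> x \<and> map (snd y) [0..<T] = s x}"
    have eq: "{w. project_env J T w = e} = {w \<in> space (frog_space r). \<forall>x\<in>J. w x \<in> ?X x}"
    proof (intro Collect_cong)
      fix w
      show "project_env J T w = e \<longleftrightarrow> (w \<in> space (frog_space r) \<and> (\<forall>x\<in>J. w x \<in> ?X x))"
      proof
        assume "project_env J T w = e"
        then have "\<omega> x \<longleftrightarrow> x \<in> J \<and> fst (w x)" "s x = (if x \<in> J then map (snd (w x)) [0..<T] else [])" for x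
          unfolding e project_env_def by auto
        then show "w \<in> space (frog_space r) \<and> (\<forall>x\<in>J. w x \<in> ?X x)" by (auto simp: sp)
      next
        assume "w \<in> space (frog_space r) \<and> (\<forall>x\<in>J. w x \<in> ?X x)"
        then show "project_env J T w = e" using True unfolding e project_env_def by (auto simp: fun_eq_iff)
      qed
    qed
    have "{w \<in> space (frog_space r). \<forall>x\<in>J. w x \<in> ?X x} \<in> sets (frog_space r)"
    proof -
      have "{w \<in> space (frog_space r). \<forall>x\<in>J. w x \<in> ?X x} = {w \<in> space (Pi\<^sub>M UNIV (\<lambda>_. ?S)). \<forall>x\<in>J. w x \<in> ?X x}"
        by (simp add: frog_space_def)
      also have "\<dots> \<in> sets (Pi\<^sub>M UNIV (\<lambda>_. ?S))"
        using J site_space_event(1) by (intro sets.sets_Collect_finite_All sets_Collect_single) auto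
      finally show ?thesis by (simp add: frog_space_def)
    qed
    moreover have "emeasure (frog_space r) {w \<in> space (frog_space r). \<forall>x\<in>J. w x \<in> ?X x} = (\<Prod>x\<in>J. emeasure ?S (?X x))"
      unfolding frog_space_def by (rule emeasure_PiM_Collect) (use J site_space_event(1) in auto)
    moreover have "\<dots> = ennreal (pmf (env_pmf r J T) e)"
      unfolding pmf_e site_space_event(2) using True J by (subst prod_ennreal) (auto simp: pmf_Pi prod.distrib)
    ultimately show ?thesis unfolding eq by simp
  next
    case False
    then have "{w. project_env J T w = e} = {}" by (auto simp: e project_env_def)
    moreover have "pmf (env_pmf r J T) e = 0" using False J unfolding pmf_e by (auto simp: pmf_Pi)
    ultimately show ?thesis by simp
  qed
  then show "{w. project_env J T w = e} \<in> sets (frog_space r)"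
    "measure (frog_space r) {w. project_env J T w = e} = pmf (env_pmf r J T) e"
    by (auto simp: measure_def)
qed

text \<open>Uniting the preimages of the finitely many atoms in the support yields a measurable
  subset of the event with the right measure. Measurability of the passage time itself is thereby
  bypassed.\<close>

lemma project_env_event:
  fixes J :: "('d::finite) site set"
  assumes J: "finite J"
  shows "\<exists>E\<in>sets (frog_space r). (\<forall>w\<in>E. Q (project_env J T w)) \<and>
    measure (frog_space r) E = pprob (env_pmf r J T) {e. Q e}"
proof -
  interpret prob_space "frog_space r :: ('d site \<Rightarrow> _) measure" by (rule prob_space_frog)
  let ?S = "{e. Q e} \<inter> set_pmf (env_pmf r J T)"
  let ?E = "\<Union>e\<in>?S. {w. project_env J T w = e}"
  have fin: "finite ?S" using finite_env_pmf[OF J] by auto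
  have "?E \<in> sets (frog_space r)" using fin project_env_measure(1)[OF J] by (intro sets.finite_UN) auto
  moreover have "\<forall>w\<in>?E. Q (project_env J T w)" by auto
  moreover have "measure (frog_space r) ?E = pprob (env_pmf r J T) {e. Q e}"
  proof -
    have "measure (frog_space r) ?E = (\<Sum>e\<in>?S. measure (frog_space r) {w. project_env J T w = e})"
      using fin project_env_measure(1)[OF J] by (intro finite_measure_finite_Union) (auto simp: disjoint_family_on_def)
    also have "\<dots> = (\<Sum>e\<in>?S. pmf (env_pmf r J T) e)" using project_env_measure(2)[OF J] by simp
    also have "\<dots> = pprob (env_pmf r J T) ?S" using fin by (simp add: measure_measure_pmf_finite)
    finally show ?thesis
      by (simp add: measure_Int_set_pmf)
  qed
  ultimately show ?thesis by blast
qed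

section \<open>Choice of the scale\<close>

lemma sum_inverse_sqrt_cubed_le: "(\<Sum>k<n. (1 / sqrt (real (Suc k))) ^ 3) \<le> 3"
proof -
  \<comment> \<open>The subtracted term makes the bound inductive: its decrease from n to n + 1
    dominates (n + 1)^(-3/2).\<close>
  have "n \<ge> 1 \<Longrightarrow> (\<Sum>k<n. (1 / sqrt (real (Suc k))) ^ 3) \<le> 3 - 2 / sqrt (real n)" for n
  proof (induction n rule: dec_induct)
    case (step n)
    define s t where "s = sqrt (real n)" and "t = sqrt (real (Suc n))"
    have st: "1 \<le> s" "s \<le> t" "t * t = s * s + 1" using step by (auto simp: s_def t_def)
    have "s * (s + t) \<le> t * (t + t)" using st by (intro mult_mono) auto
    then have "1 / (t * (t + t)) \<le> 1 / (s * (s + t))" using st by (intro divide_left_mono) auto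
    then have "2 / t * (1 / (t * (t + t))) \<le> 2 / t * (1 / (s * (s + t)))" using st by (intro mult_left_mono) auto
    also have "2 / t * (1 / (t * (t + t))) = (1 / t) ^ 3" using st by (simp add: power3_eq_cube field_simps)
    also have "2 / t * (1 / (s * (s + t))) = 2 / s - 2 / t"
    proof -
      have "(t - s) * (s + t) = 1" using st by (simp add: algebra_simps)
      then have "1 / (s + t) = t - s" using st by (simp add: field_simps)
      then have "2 / t * (1 / (s * (s + t))) = 2 * (t - s) / (t * s)" by (metis divide_divide_eq_left' times_divide_times_eq mult.right_neutral times_divide_eq_right)
      then show ?thesis using st by (simp add: field_simps)
    qed
    finally show ?case using step by (simp add: s_def t_def)
  qed simp
  note * = this
  show ?thesis
  proof (cases "n \<ge> 1")
    case True
    have "0 \<le> 2 / sqrt (real n)" by simp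
    with *[OF True] show ?thesis by linarith
  next
    case False
    then have "n = 0" by simp
    then show ?thesis by simp
  qed
qed

lemma sum_inverse_le_ln:
  assumes "n \<ge> 1"
  shows "(\<Sum>k<n. 1 / real (Suc k)) \<le> 1 + ln (real n)"
  using assms
proof (induction n rule: dec_induct)
  case (step n)
  have "ln (real n / real (Suc n)) \<le> real n / real (Suc n) - 1"
    using step by (intro ln_le_minus_one) auto
  also have "\<dots> = - 1 / real (Suc n)" by (simp add: field_simps)
  finally have "1 / real (Suc n) \<le> ln (real (Suc n)) - ln (real n)"
    using step by (simp add: ln_div)
  then show ?case using step by simp
qed simp

text \<open>Here \<open>delta_d\<close> originates: the number of steps, of order \<delta>^2, is
  what makes the range bound n / (32 G) reach M / r. For d \<ge> 3 the sum of return probabilities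
  is bounded, so n of order 1 / r suffices. For d = 2 it is of order ln n, comparable to the
  absolute value of ln r, which forces the logarithmic factor.\<close>

lemma delta_scale:
  assumes d: "CARD('d::finite) \<ge> 2" and M: "M > 0"
  shows "\<exists>B>0. \<exists>r0>0. \<forall>r. 0 < r \<and> r \<le> r0 \<longrightarrow> 1 \<le> delta_d CARD('d) r \<and>
    (\<exists>G>0. (\<Sum>l<nat \<lceil>B * (delta_d CARD('d) r)\<^sup>2\<rceil>. return_prob TYPE('d) l) \<le> G
      \<and> M / r \<le> real (nat \<lceil>B * (delta_d CARD('d) r)\<^sup>2\<rceil>) / (32 * G))"
  (is "\<exists>B>0. \<exists>r0>0. \<forall>r. 0 < r \<and> r \<le> r0 \<longrightarrow> ?P B r")
proof (cases "CARD('d) = 2")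
  case False
  define G where "G = (real CARD('d))\<^sup>2 * 3"
  have G: "G > 0" by (simp add: G_def)
  have ret: "(\<Sum>l<n. return_prob TYPE('d) l) \<le> G" for n
  proof -
    have "(\<Sum>k<n. (1 / sqrt (real (Suc k))) ^ CARD('d)) \<le> (\<Sum>k<n. (1 / sqrt (real (Suc k))) ^ 3)"
      using d False by (intro sum_mono power_decreasing) auto
    also have "\<dots> \<le> 3" by (rule sum_inverse_sqrt_cubed_le)
    finally have "(real CARD('d))\<^sup>2 * (\<Sum>k<n. (1 / sqrt (real (Suc k))) ^ CARD('d)) \<le> G"
      unfolding G_def by (intro mult_left_mono) auto
    then show ?thesis using sum_return_prob_le[where 'd = 'd, of n] by linarith
  qed
  have main: "?P (32 * G * M) r"
    if r: "0 < r \<and> r \<le> 1" for r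
  proof (rule conjI)
    from r have sq: "(delta_d CARD('d) r)\<^sup>2 = 1 / r" using False by (simp add: delta_d_def power_divide)
    show "1 \<le> delta_d CARD('d) r" using r False by (simp add: delta_d_def)
    have "32 * G * M * (1 / r) \<le> real (nat \<lceil>32 * G * M * (1 / r)\<rceil>)" by linarith
    then have "M / r \<le> real (nat \<lceil>32 * G * M * (1 / r)\<rceil>) / (32 * G)" using G by (simp add: field_simps)
    then show "\<exists>G'>0. (\<Sum>l<nat \<lceil>32 * G * M * (delta_d CARD('d) r)\<^sup>2\<rceil>. return_prob TYPE('d) l) \<le> G'
      \<and> M / r \<le> real (nat \<lceil>32 * G * M * (delta_d CARD('d) r)\<^sup>2\<rceil>) / (32 * G')"
      unfolding sq using G ret by blast
  qed
  have "\<exists>r0>0. \<forall>r. 0 < r \<and> r \<le> r0 \<longrightarrow> ?P (32 * G * M) r"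
    by (rule exI[of _ 1]) (use main in auto)
  moreover have "32 * G * M > 0" using G M by simp
  ultimately show ?thesis by blast
next
  case True
  \<comment> \<open>B appears on both sides because G depends on n and n on B; the dependence of G
    is only logarithmic. The factor 128 is 32 from the range bound times d^2 = 4.\<close>
  have "eventually (\<lambda>B :: real. 128 * M * (3 + ln (B + 1)) \<le> B) at_top" by real_asymp
  then have "eventually (\<lambda>B :: real. 128 * M * (3 + ln (B + 1)) \<le> B \<and> B > 1) at_top"
    by (intro eventually_conj eventually_gt_at_top)
  then obtain B :: real where B: "128 * M * (3 + ln (B + 1)) \<le> B" "B > 1"
    by (metis (mono_tags, lifting) eventually_happens trivial_limit_at_top_linorder)
  have main: "?P B r"
    if r: "0 < r \<and> r \<le> exp (-1)" for r
  proof (rule conjI)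
    define L where "L = \<bar>ln r\<bar>"
    have "ln r \<le> - 1" using r by (metis ln_exp ln_le_cancel_iff exp_gt_zero)
    then have L: "L \<ge> 1" "L = - ln r" by (auto simp: L_def)
    have r1: "r < 1" using r by (meson exp_less_one_iff le_less_trans neg_less_0_iff_less zero_less_one)
    have Lr: "1 \<le> L / r" using L(1) r r1 by (simp add: le_divide_eq)
    have sq: "(delta_d CARD('d) r)\<^sup>2 = L / r" using True r by (simp add: delta_d_def L_def)
    show "1 \<le> delta_d CARD('d) r" using Lr True by (simp add: delta_d_def L_def)
    define n where "n = nat \<lceil>B * (L / r)\<rceil>"
    have n: "B * (L / r) \<le> real n" unfolding n_def by linarith
    have "1 * 1 \<le> B * (L / r)" using B Lr by (intro mult_mono) auto
    then have n1: "1 \<le> n" using n by linarith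
    have "real n \<le> B * (L / r) + 1" using \<open>1 * 1 \<le> B * (L / r)\<close> unfolding n_def by linarith
    also have "\<dots> \<le> (B + 1) * (L / r)" using Lr unfolding distrib_right by linarith
    finally have "ln (real n) \<le> ln ((B + 1) * (L / r))" using n1 by simp
    also have "\<dots> = ln (B + 1) + ln L + L"
    proof -
      have "ln ((B + 1) * (L / r)) = ln (B + 1) + ln (L / r)" using B L(1) r by (intro ln_mult_pos) auto
      also have "ln (L / r) = ln L - ln r" using L(1) r by (intro ln_divide_pos) auto
      finally show ?thesis using L(2) by simp
    qed
    also have "\<dots> \<le> ln (B + 1) * L + L + L"
    proof -
      have "ln (B + 1) * 1 \<le> ln (B + 1) * L" using B L by (intro mult_left_mono) auto
      moreover have "ln L \<le> L - 1" using L by (intro ln_le_minus_one) auto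
      ultimately show ?thesis by simp
    qed
    finally have lnn: "1 + ln (real n) \<le> (3 + ln (B + 1)) * L" using L by (simp add: algebra_simps)
    define G where "G = 4 * (1 + ln (real n))"
    have G: "G > 0" using n1 by (simp add: G_def add_pos_nonneg)
    have "(\<Sum>l<n. return_prob TYPE('d) l) \<le> (real CARD('d))\<^sup>2 * (\<Sum>k<n. (1 / sqrt (real (Suc k))) ^ CARD('d))"
      by (rule sum_return_prob_le)
    also have "\<dots> = 4 * (\<Sum>k<n. 1 / real (Suc k))" using True by (simp add: power_divide del: of_nat_Suc)
    also have "\<dots> \<le> G" unfolding G_def using sum_inverse_le_ln[OF n1] by simp
    finally have ret: "(\<Sum>l<n. return_prob TYPE('d) l) \<le> G" .
    have "M / r * (32 * G) = 128 * M * (1 + ln (real n)) / r" by (simp add: G_def)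
    also have "\<dots> \<le> 128 * M * ((3 + ln (B + 1)) * L) / r"
      using lnn M r by (intro divide_right_mono mult_left_mono) auto
    also have "\<dots> = (128 * M * (3 + ln (B + 1))) * (L / r)" by simp
    also have "\<dots> \<le> B * (L / r)" using B(1) Lr by (intro mult_right_mono) auto
    also have "\<dots> \<le> real n" by (rule n)
    finally have "M / r \<le> real n / (32 * G)" using G by (simp add: pos_le_divide_eq)
    then show "\<exists>G>0. (\<Sum>l<nat \<lceil>B * (delta_d CARD('d) r)\<^sup>2\<rceil>. return_prob TYPE('d) l) \<le> G
      \<and> M / r \<le> real (nat \<lceil>B * (delta_d CARD('d) r)\<^sup>2\<rceil>) / (32 * G)"
      unfolding sq n_def[symmetric] using G ret by blast
  qed
  have "\<exists>r0>0. \<forall>r. 0 < r \<and> r \<le> r0 \<longrightarrow> ?P B r"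
    by (rule exI[of _ "exp (-1)"]) (use main in auto)
  moreover have "B > 0" using B by simp
  ultimately show ?thesis by blast
qed

section \<open>From events of positive probability to bounds on the norm\<close>

text \<open>By continuity from above the limsup of the events has measure at least \<eta>, so it
  meets every almost sure event. No independence is required.\<close>

lemma recurrent_events:
  assumes "prob_space M" and E: "\<And>n. n \<ge> n0 \<Longrightarrow> E n \<in> sets M" "\<And>n. n \<ge> n0 \<Longrightarrow> \<eta> \<le> measure M (E n)"
    and \<eta>: "\<eta> > 0" and ae: "AE w in M. P w"
  shows "\<exists>w. P w \<and> (\<exists>\<^sub>F n in sequentially. w \<in> E n)"
proof -
  interpret prob_space M by fact
  define F where "F k = (\<Union>n\<in>{k + n0..}. E n)" for k
  have F: "F k \<in> sets M" for k unfolding F_def using E(1) by (intro sets.countable_UN) auto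
  have "decseq F" unfolding decseq_def F_def by (force intro: le_trans)
  then have lim: "(\<lambda>k. measure M (F k)) \<longlonglongrightarrow> measure M (\<Inter>k. F k)"
    using F by (intro finite_Lim_measure_decseq) auto
  have "\<eta> \<le> measure M (F k)" for k
  proof -
    have "\<eta> \<le> measure M (E (k + n0))" using E(2) by simp
    also have "\<dots> \<le> measure M (F k)" using F by (intro finite_measure_mono) (auto simp: F_def)
    finally show ?thesis .
  qed
  then have "\<eta> \<le> measure M (\<Inter>k. F k)" using lim by (intro LIMSEQ_le_const) auto
  have "\<exists>w\<in>(\<Inter>k. F k). P w"
  proof (rule ccontr)
    assume "\<not> (\<exists>w\<in>(\<Inter>k. F k). P w)"
    then have "AE w in M. w \<notin> (\<Inter>k. F k)" using ae by (auto elim!: eventually_mono)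
    then have "measure M (\<Inter>k. F k) = 0" using F by (subst prob_eq_0) auto
    with \<open>\<eta> \<le> measure M (\<Inter>k. F k)\<close> \<eta> show False by simp
  qed
  then obtain w where w: "\<And>k. w \<in> F k" "P w" by blast
  have "\<exists>\<^sub>F n in sequentially. w \<in> E n"
    unfolding frequently_sequentially
  proof
    fix k
    from w(1)[of k] obtain n where "n \<ge> k + n0" "w \<in> E n" by (auto simp: F_def)
    then show "\<exists>n\<ge>k. w \<in> E n" by (intro exI[of _ n]) auto
  qed
  with w show ?thesis by blast
qed

abbreviation fast_passage :: "real \<Rightarrow> 'd::finite \<Rightarrow> nat \<Rightarrow> real \<Rightarrow> nat \<Rightarrow> bool" where
  "fast_passage r i n \<eta> u \<equiv> \<exists>E \<in> sets (frog_space r). \<eta> \<le> measure (frog_space r) E \<and>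
    (\<forall>w\<in>E. occ w 0 \<and> passage_time w 0 (axis i (int n) :: 'd site) \<le> enat u)"

text \<open>Since \<mu> is deterministic, one outcome with convergent ratios and infinitely many
  ratios below C already decides the bound.\<close>

lemma time_constant_axis_le:
  fixes \<mu> :: "real ^ 'd::finite \<Rightarrow> real"
  assumes tc: "is_time_constant r \<mu>" and \<eta>: "\<eta> > 0"
    and E: "\<And>n. n \<ge> n0 \<Longrightarrow> fast_passage r i n \<eta> (V n)"
    and V: "\<And>n. n \<ge> n0 \<Longrightarrow> real (V n) \<le> C * real n"
  shows "\<mu> (axis i 1) \<le> C"
proof -
  let ?q = "\<lambda>w n. real (the_enat (passage_time w 0 (axis i (int n) :: 'd site))) / real n"
  have "\<forall>n. \<exists>E. n \<ge> n0 \<longrightarrow> E \<in> sets (frog_space r) \<and> \<eta> \<le> measure (frog_space r) E \<and>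
      (\<forall>w\<in>E. occ w 0 \<and> passage_time w 0 (axis i (int n) :: 'd site) \<le> enat (V n))" using E by blast
  then obtain F where F: "\<And>n. n \<ge> n0 \<Longrightarrow> F n \<in> sets (frog_space r)" "\<And>n. n \<ge> n0 \<Longrightarrow> \<eta> \<le> measure (frog_space r) (F n)"
    "\<And>n w. n \<ge> n0 \<Longrightarrow> w \<in> F n \<Longrightarrow> occ w 0 \<and> passage_time w 0 (axis i (int n) :: 'd site) \<le> enat (V n)"
    by metis
  have x: "int_to_real_vec (axis i 1 :: 'd site) = axis i 1" by (simp add: int_to_real_vec_axis)
  have n: "int n *s (axis i 1 :: 'd site) = axis i (int n)" for n by (simp add: vec_eq_iff axis_def)
  have "AE w in (frog_space r :: ('d site \<Rightarrow> _) measure). occ w 0 \<longrightarrow>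
    (\<lambda>n. ?q w n) \<longlonglongrightarrow> \<mu> (axis i 1)"
    (is "AE w in _. ?Q w")
  proof -
    let ?C = "\<lambda>w. occ w 0 \<longrightarrow> (\<forall>x :: 'd site.
           (\<forall>\<^sub>F n in sequentially. passage_time w 0 (int n *s x) \<noteq> \<infinity>) \<and>
           ((\<lambda>n. real (the_enat (passage_time w 0 (int n *s x))) / real n) \<longlonglongrightarrow> \<mu> (int_to_real_vec x)))"
    have "AE w in (frog_space r :: ('d site \<Rightarrow> _) measure). ?C w"
      using tc unfolding is_time_constant_def by blast
    then show ?thesis
    proof (rule eventually_mono)
      fix w assume *: "?C w"
      show "?Q w"
      proof
        assume "occ w 0"
        with * have "(\<lambda>n. real (the_enat (passage_time w 0 (int n *s (axis i 1 :: 'd site)))) / real n) \<longlonglongrightarrow> \<mu> (int_to_real_vec (axis i 1 :: 'd site))"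
          by blast
        then show "(\<lambda>n. ?q w n) \<longlonglongrightarrow> \<mu> (axis i 1)"
          by (simp only: n x)
      qed
    qed
  qed
  from recurrent_events[of "frog_space r" n0 F, OF prob_space_frog F(1,2) \<eta> this]
  obtain w where w: "occ w 0 \<longrightarrow> (\<lambda>n. ?q w n) \<longlonglongrightarrow> \<mu> (axis i 1)"
    and freq: "\<exists>\<^sub>F n in sequentially. w \<in> F n" by blast
  show ?thesis
  proof (rule ccontr)
    assume "\<not> ?thesis"
    then have gt: "C < \<mu> (axis i 1)" by simp
    have "\<exists>\<^sub>F n in sequentially. w \<in> F n \<and> n \<ge> n0 \<and> n \<ge> 1"
      using freq by (rule frequently_eventually_frequently) (auto intro: eventually_conj eventually_ge_at_top)
    then have fr: "\<exists>\<^sub>F n in sequentially. ?q w n \<le> C \<and> occ w 0"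
    proof (rule frequently_elim1)
      fix n assume n: "w \<in> F n \<and> n \<ge> n0 \<and> n \<ge> 1"
      then have *: "occ w 0" "passage_time w 0 (axis i (int n) :: 'd site) \<le> enat (V n)" using F(3) by auto
      then have "the_enat (passage_time w 0 (axis i (int n) :: 'd site)) \<le> V n"
        by (cases "passage_time w 0 (axis i (int n) :: 'd site)") auto
      then have "real (the_enat (passage_time w 0 (axis i (int n) :: 'd site))) \<le> C * real n"
        using V[of n] n by linarith
      then show "?q w n \<le> C \<and> occ w 0"
        using n * by (simp add: divide_le_eq)
    qed
    then have "occ w 0" using frequently_ex by blast
    with w gt have "\<forall>\<^sub>F n in sequentially. C < ?q w n"
      by (auto intro: order_tendstoD)
    from frequently_ex[OF frequently_eventually_frequently[OF fr this]] show False by auto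
  qed
qed

lemma norm_fun_le_l1:
  fixes \<mu> :: "real ^ 'd::finite \<Rightarrow> real"
  assumes "is_norm_fun \<mu>" "\<And>i. \<mu> (axis i 1) \<le> C"
  shows "\<mu> x \<le> C * l1_norm x"
proof -
  have sub: "\<mu> (\<Sum>i\<in>S. f i) \<le> (\<Sum>i\<in>S. \<mu> (f i))" if "finite S" for S and f :: "'d \<Rightarrow> real ^ 'd"
    using that
  proof (induction S rule: finite_induct)
    case empty
    have "\<mu> 0 = 0" using assms(1) by (simp add: is_norm_fun_def)
    then show ?case by simp
  next
    case (insert i S)
    have "\<mu> (f i + (\<Sum>i\<in>S. f i)) \<le> \<mu> (f i) + \<mu> (\<Sum>i\<in>S. f i)" using assms(1) by (simp add: is_norm_fun_def)
    with insert show ?case by simp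
  qed
  have "\<mu> x = \<mu> (\<Sum>i\<in>UNIV. x $ i *\<^sub>R axis i 1)"
    using basis_expansion[of x] by (simp add: scalar_mult_eq_scaleR)
  also have "\<dots> \<le> (\<Sum>i\<in>UNIV. \<mu> (x $ i *\<^sub>R axis i 1))" by (rule sub) simp
  also have "\<dots> = (\<Sum>i\<in>UNIV. \<bar>x $ i\<bar> * \<mu> (axis i 1))" using assms(1) by (simp add: is_norm_fun_def)
  also have "\<dots> \<le> (\<Sum>i\<in>UNIV. \<bar>x $ i\<bar> * C)" using assms(2) by (intro sum_mono mult_left_mono) auto
  finally show ?thesis by (simp add: l1_norm_def sum_distrib_left mult.commute)
qed

section \<open>Choice of all constants and conclusion\<close>

lemma scale_exists:
  fixes p c :: real
  assumes "0 < p" "p \<le> 1" "0 \<le> c"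
  obtains \<kappa> :: real and m :: nat where "\<kappa> \<ge> 2" "(1 + c) / \<kappa>\<^sup>2 \<le> p / 4" "m \<ge> 1" "(1 - p / 4) ^ m * \<kappa>\<^sup>2 \<le> 1 / 2"
proof -
  define \<kappa> where "\<kappa> = 2 + 4 * (1 + c) / p"
  have k: "\<kappa> \<ge> 2" using assms by (simp add: \<kappa>_def)
  have "4 * (1 + c) / p \<le> \<kappa> * 1" by (simp add: \<kappa>_def)
  also have "\<dots> \<le> \<kappa> * \<kappa>" using k by (intro mult_left_mono) auto
  finally have "4 * (1 + c) \<le> p * \<kappa>\<^sup>2" using assms by (simp add: divide_le_eq power2_eq_square mult.commute)
  then have k': "(1 + c) / \<kappa>\<^sup>2 \<le> p / 4" using k by (simp add: divide_le_eq)
  have k2: "\<kappa>\<^sup>2 \<ge> 4" using power_mono[of 2 \<kappa> 2] k by simp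
  obtain m where m: "(1 - p / 4) ^ m < 1 / (2 * \<kappa>\<^sup>2)"
  proof -
    have "0 < 1 / (2 * \<kappa>\<^sup>2)" using k by simp
    then show ?thesis using real_arch_pow_inv[of "1 / (2 * \<kappa>\<^sup>2)" "1 - p / 4"] assms that by auto
  qed
  have "m \<noteq> 0"
  proof
    assume "m = 0"
    with m have "1 < 1 / (2 * \<kappa>\<^sup>2)" by simp
    also have "\<dots> \<le> 1 / 1" using k2 by (intro divide_left_mono) auto
    finally show False by simp
  qed
  moreover have "(1 - p / 4) ^ m * \<kappa>\<^sup>2 \<le> 1 / (2 * \<kappa>\<^sup>2) * \<kappa>\<^sup>2"
    using m by (intro mult_right_mono) auto
  then have "(1 - p / 4) ^ m * \<kappa>\<^sup>2 \<le> 1 / 2" using k by simp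
  ultimately show thesis using that[of \<kappa> m] k k' by simp
qed

text \<open>A window is the time to reach the sphere followed by n steps of discovery; p = 9/512 is
  9/256 halved by the range event. The ratio 600 d satisfies 256 * 37 \<le> 18 * 600, the
  requirement of \<open>hit_sphere_prob\<close>.\<close>

lemma hitting_window:
  fixes y b :: "('d::finite) site" and l \<rho> :: real
  assumes l: "1 \<le> l" "real n \<le> l\<^sup>2" and \<rho>: "600 * real CARD('d) * l \<le> \<rho>"
    and near: "\<bar>site_dist y b - \<rho>\<bar> \<le> 2 * l" and h: "a + 1 \<le> h"
    and range: "pprob (rw_pmf n) {xs :: 'd site list. K \<le> real (card (local_range n a xs))} \<ge> 1 / 2"
  shows "9 / 512 \<le> pprob (rw_pmf (nat \<lceil>36 * real CARD('d) * l\<^sup>2\<rceil> + n)) {ys. K \<le> card (annulus_visits b \<rho> h y ys)}"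
proof -
  let ?d = "real CARD('d)"
  define t where "t = nat \<lceil>36 * ?d * l\<^sup>2\<rceil>"
  have l2: "1 \<le> l\<^sup>2" using l by (simp add: one_le_power)
  have d: "1 \<le> ?d" by (simp add: Suc_leI)
  have dl: "?d \<le> ?d * l\<^sup>2" using l2 d mult_left_mono[of 1 "l\<^sup>2" ?d] by simp
  have t1: "36 * ?d * l\<^sup>2 \<le> real t" unfolding t_def by linarith
  have "0 \<le> 36 * ?d * l\<^sup>2" by simp
  then have t2: "real t \<le> 36 * ?d * l\<^sup>2 + 1" unfolding t_def by linarith
  have "36 * ?d * l\<^sup>2 \<ge> ?d" using dl by linarith
  then have t3: "CARD('d) \<le> t" using t1 by linarith
  have \<rho>0: "0 < \<rho>" using \<rho> l d mult_pos_pos[of "600 * ?d" l] by linarith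
  have "256 * real t \<le> 256 * (37 * ?d * l\<^sup>2)" 
  proof -
    have "36 * ?d * l\<^sup>2 = 36 * (?d * l\<^sup>2)" "37 * ?d * l\<^sup>2 = 37 * (?d * l\<^sup>2)" by auto
    then show ?thesis using t2 dl d by linarith
  qed
  also have "\<dots> \<le> 18 * (600 * ?d * l) * l" using d by (simp add: power2_eq_square)
  also have "\<dots> \<le> 18 * \<rho> * l" using \<rho> l by (intro mult_right_mono mult_left_mono) auto
  finally have t4: "256 * real t \<le> 18 * \<rho> * l" .
  have "9 / 256 \<le> pprob (rw_pmf t) {xs. hits_sphere b \<rho> y t xs}"
    by (rule hit_sphere_prob) (use l t1 t3 t4 \<rho>0 near in auto)
  then have "9 / 512 \<le> pprob (rw_pmf t) {xs. hits_sphere b \<rho> y t xs} / 2" by simp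
  also have "\<dots> \<le> pprob (rw_pmf (t + n)) {xs. K \<le> card (annulus_visits b \<rho> h y xs)}"
    by (rule annulus_visits_prob[OF range h])
  finally show ?thesis by (simp add: t_def)
qed

text \<open>The constants p, c, A, \<kappa>, m, \<gamma>, j0 and E are tied to one another without h
  or r, so r enters the speed only through h. In contrast \<eta> and n0 may depend on r. The summand
  m in h makes the initial m sites fit into a front of width 2 h.\<close>

lemma linear_passage:
  fixes r h p c \<kappa> K A a :: real and m n :: nat and i :: "'d::finite"
  assumes r: "0 < r" "r \<le> 1" and n: "n \<ge> 1" and a: "0 < a" "8 * real n \<le> a\<^sup>2"
    and h: "h = a + 1 + real m"
    and G: "(\<Sum>l<n. return_prob TYPE('d) l) \<le> G" "0 < G" "2 * (real m + 1) / r \<le> real n / (32 * G)"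
    and p: "p = 9 / 512" and c: "c = 37 * real CARD('d) + 1" and A: "A = 600 * real CARD('d)"
    and \<kappa>: "\<kappa> \<ge> 2" "(1 + c) / \<kappa>\<^sup>2 \<le> p / 4" and m: "m \<ge> 1" "(1 - p / 4) ^ m * \<kappa>\<^sup>2 \<le> 1 / 2"
    and \<gamma>: "\<gamma> = 256 * ((A + 1) * real m)\<^sup>2 / 4" and j0: "j0 = nat \<lceil>2 * \<gamma>\<rceil> + 1"
    and E: "E = 2 + 256 * c * (real m)\<^sup>2 + (1 + real j0) / 2 + \<gamma>"
  shows "\<exists>\<eta>>0. \<exists>n0. \<forall>N\<ge>n0. real (m + nat \<lceil>h * real N * E\<rceil>) \<le> h * (E + 1) * real N \<and>
    fast_passage r i N \<eta> (m + nat \<lceil>h * real N * E\<rceil>)"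
proof -
  let ?d = "real CARD('d)"
  define l where "l j = 8 * h * real m * \<kappa> ^ j" for j
  define W where "W j = nat \<lceil>36 * ?d * (l j)\<^sup>2\<rceil> + n" for j
  define R where "R = 2 * h * (real j0 + 1)"
  define K where "K = 2 * (real m + 1) / r"
  define ST where "ST j = (\<Sum>j'<j. W j')" for j
  have d: "1 \<le> ?d" by (simp add: Suc_leI)
  have h1: "1 \<le> h" "real m \<le> h" "a + 1 \<le> h" using a by (auto simp: h)
  have A1: "1 \<le> A" using d unfolding A by linarith
  have \<gamma>0: "0 \<le> \<gamma>" by (simp add: \<gamma>)
  have c0: "0 \<le> c" by (simp add: c)
  have E1: "1 \<le> E" using \<gamma>0 c0 by (simp add: E)
  have kp: "1 \<le> \<kappa> ^ j" for j using \<kappa> by (intro one_le_power) auto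
  have lh: "h \<le> l j" for j
  proof -
    have "h * 1 \<le> h * (8 * real m * \<kappa> ^ j)"
    proof (rule mult_left_mono)
      have "1 * 1 \<le> (8 * real m) * \<kappa> ^ j" using m kp[of j] by (intro mult_mono) auto
      then show "1 \<le> 8 * real m * \<kappa> ^ j" by simp
    qed (use h1 in auto)
    then show ?thesis by (simp add: l_def mult.assoc mult.commute mult.left_commute)
  qed
  have l1: "1 \<le> l j" for j using lh[of j] h1 by linarith
  have ln: "real n \<le> (l j)\<^sup>2" for j
  proof -
    have "real n \<le> a\<^sup>2" using a(2) by linarith
    also have "\<dots> \<le> (l j)\<^sup>2" using lh[of j] h1 a by (intro power_mono) auto
    finally show ?thesis .
  qed
  have range: "1 / 2 \<le> pprob (rw_pmf n) {xs :: 'd site list. K \<le> real (card (local_range n a xs))}"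
  proof -
    have "1 / 2 \<le> pprob (rw_pmf n) {xs :: 'd site list. real n / (32 * G) \<le> real (card (local_range n a xs))}"
      using n a G by (intro local_range_large) auto
    also have "\<dots> \<le> pprob (rw_pmf n) {xs :: 'd site list. K \<le> real (card (local_range n a xs))}"
      using G by (intro prob_mono) (auto simp: K_def)
    finally show ?thesis .
  qed
  have W: "real (W j) \<le> c * (l j)\<^sup>2" for j
  proof -
    have "0 \<le> 36 * ?d * (l j)\<^sup>2" by simp
    then have "real (W j) \<le> 36 * ?d * (l j)\<^sup>2 + 1 + real n" unfolding W_def by linarith
    moreover have "1 * 1 \<le> ?d * (l j)\<^sup>2" using d l1[of j] by (intro mult_mono one_le_power) auto
    ultimately have "real (W j) \<le> 37 * (?d * (l j)\<^sup>2) + (l j)\<^sup>2" using ln[of j] by linarith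
    then show ?thesis by (simp add: c algebra_simps)
  qed
  obtain k0 where k0: "\<And>v :: 'd site. norm (int_to_real_vec v) \<le> R \<Longrightarrow> \<exists>xs. length xs \<le> k0 \<and> set xs \<subseteq> srw_steps \<and> sum_list xs = v"
    using ex_short_steps[of R, where 'd = 'd] by blast
  define \<eta> where "\<eta> = r ^ (m + 1) * (1 / (2 * ?d)) ^ m * ((1 / (2 * ?d)) ^ k0 * exp (- (E + 1)))"
  have \<eta>: "\<eta> > 0" using r d by (simp add: \<eta>_def)
  \<comment> \<open>The last summand ensures a' \<le> 1/2 below; the others make N larger than m and
    at least k0.\<close>
  define n0 where "n0 = m + 1 + k0 + nat \<lceil>1024 * c * h * (real m)\<^sup>2\<rceil>"
  have "real (m + nat \<lceil>h * real N * E\<rceil>) \<le> h * (E + 1) * real N \<and>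
    fast_passage r i N \<eta> (m + nat \<lceil>h * real N * E\<rceil>)" if N: "N \<ge> n0" for N
  proof
    define U where "U = nat \<lceil>h * real N * E\<rceil>"
    have Nm: "m < N" "k0 \<le> N" "real m + 1 \<le> real N" using N by (auto simp: n0_def)
    then have N0: "0 < real N" "1 \<le> real N" by auto
    have "1024 * c * h * (real m)\<^sup>2 \<le> real (nat \<lceil>1024 * c * h * (real m)\<^sup>2\<rceil>)" by linarith
    also have "\<dots> \<le> real N" using N unfolding n0_def of_nat_le_iff by linarith
    finally have Nc: "1024 * c * h * (real m)\<^sup>2 \<le> real N" .
    have hNE: "0 \<le> h * real N * E" using h1 E1 N0 by simp
    have U1: "h * real N * E \<le> real U" unfolding U_def by linarith
    have U2: "real U \<le> h * real N * E + 1" using hNE unfolding U_def by linarith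
    have "1 * real N \<le> h * real N" using h1 N0 by (intro mult_right_mono) auto
    then have "real m + 1 \<le> h * real N" using Nm by linarith
    then show "real (m + nat \<lceil>h * real N * E\<rceil>) \<le> h * (E + 1) * real N"
      using U2 unfolding U_def[symmetric] by (simp add: algebra_simps)
    define b :: "'d site" where "b = axis i (int N)"
    define T where "T = k0 + m + ST (Suc N)"
    \<comment> \<open>With this rate the allotted time h N E has exponent E, while N / (2 h) stages
      of mean cost of order h^2 consume only a bounded exponent.\<close>
    define \<theta> where "\<theta> = 1 / (h * real N)"
    have \<theta>0: "0 < \<theta>" using h1 N0 by (simp add: \<theta>_def)
    have \<theta>h: "\<theta> * (h * real N) = 1" using h1 N0 by (simp add: \<theta>_def)
    interpret frog_stage b r h p c \<kappa> K A "real N" m T W l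
    proof
      fix i \<rho> and y :: "'d site" assume "A * l i \<le> \<rho>" "\<bar>site_dist y b - \<rho>\<bar> \<le> 2 * l i"
      then show "p \<le> pprob (rw_pmf (W i)) {ys. K \<le> card (annulus_visits b \<rho> h y ys)}"
        unfolding p W_def using l1 ln range h1 by (intro hitting_window) (auto simp: A)
    qed (use r h1 \<kappa> m W c0 A1 in \<open>auto simp: p K_def l_def\<close>)
    \<comment> \<open>The truncation T is deliberately wasteful: l_j \<ge> j, so every scale that
      fits into radius N has index at most N.\<close>
    have Tst: "start_time (Suc j) \<le> T" if "(A + 1) * l j \<le> real N" for j
    proof -
      have "real j < 2 ^ j" by (rule of_nat_less_two_power)
      also have "\<dots> \<le> \<kappa> ^ j" using \<kappa> by (intro power_mono) auto
      also have "1 * \<kappa> ^ j \<le> (8 * h * real m) * \<kappa> ^ j"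
      proof (rule mult_right_mono)
        have "1 * 1 \<le> (8 * h) * real m" using h1 m by (intro mult_mono) auto
        then show "1 \<le> 8 * h * real m" by simp
      qed (use kp[of j] in simp)
      finally have "real j \<le> 1 * l j" by (simp add: l_def)
      also have "\<dots> \<le> (A + 1) * l j" using A1 l1[of j] by (intro mult_right_mono) auto
      finally have "j \<le> N" using that by simp
      then have "(\<Sum>j'<Suc j. W j') \<le> (\<Sum>j'<Suc N. W j')" by (intro sum_mono2) auto
      then show ?thesis by (simp add: start_time_def T_def ST_def)
    qed
    let ?F = "(\<lambda>j. axis i (int j) :: 'd site) ` {1..m}"
    define \<rho> where "\<rho> = real N - real m"
    define j where "j = j0 + nat \<lceil>real N / (2 * h)\<rceil>"
    define a' where "a' = 8 * c * \<theta> * (l 0)\<^sup>2"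
    have a'_eq: "a' = 512 * c * h * (real m)\<^sup>2 / real N"
      using h1 N0 by (simp add: a'_def \<theta>_def l_def power2_eq_square field_simps)
    have a'0: "0 \<le> a'" using c0 \<theta>0 by (simp add: a'_def)
    have a'h: "a' \<le> 1 / 2" unfolding a'_eq using Nc N0 by (simp add: divide_le_eq)
    have front: "front \<rho> ?F"
    proof -
      have dist: "site_dist (axis i (int j)) b = real N - real j" if "j \<le> N" for j
        using that by (simp add: b_def site_dist_axis)
      have "card ?F = card {1..m}" by (intro card_image) (auto simp: inj_on_def axis_eq_axis)
      moreover have "real m - 1 \<le> 2 * h" using h1 by linarith
      ultimately show ?thesis using dist Nm by (auto simp: front_def \<rho>_def J_def)
    qed
    have j1: "1 \<le> j" "j0 \<le> j" by (auto simp: j_def j0)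
    have jN: "real N / (2 * h) \<le> real j" unfolding j_def by linarith
    have "0 \<le> real N / (2 * h)" using h1 by simp
    then have jle: "real j \<le> real j0 + (real N / (2 * h) + 1)" unfolding j_def by linarith
    have main: "(1 / (2 * ?d)) ^ k0 * exp (- \<theta> * real U)
      * (exp (- \<theta> * real k0 - a' * real j - \<gamma> + \<gamma> / real j) * exp (\<theta> * real U) - 1)
      \<le> reach_prob \<rho> ?F U"
    proof (rule front_induction[OF k0 R_def])
      show "k0 \<le> T" by (simp add: T_def)
      show "\<gamma> = 4 * ((A + 1) * l 0 / (2 * h))\<^sup>2"
        using h1 by (simp add: \<gamma> l_def power2_eq_square field_simps)
      show "2 * \<gamma> \<le> real j0" "1 \<le> j0" unfolding j0 by linarith+
      have "\<rho> \<le> 2 * h * (real N / (2 * h))" using h1 by (simp add: \<rho>_def)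
      also have "\<dots> \<le> 2 * h * real j" using jN h1 by (intro mult_left_mono) auto
      finally show "\<rho> \<le> 2 * h * real j" .
    qed (use Tst \<theta>0 a'h j1 front in \<open>auto simp: a'_def \<rho>_def\<close>)
    \<comment> \<open>The summands of E are read off here: \<theta> k0 \<le> 1, then the stages,
      then the rounding in j together with j0, then \<gamma>. The remaining unit yields exp 1 - 1
      \<ge> 1.\<close>
    have expo: "E - 1 \<ge> \<theta> * real k0 + a' * real j + \<gamma>"
    proof -
      have "real k0 \<le> 1 * real N" using Nm by simp
      also have "\<dots> \<le> h * real N" using h1 N0 by (intro mult_right_mono) auto
      finally have "\<theta> * real k0 \<le> \<theta> * (h * real N)" using \<theta>0 by (intro mult_left_mono) auto
      then have 1: "\<theta> * real k0 \<le> 1" using \<theta>h by simp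
      have "a' * real j \<le> a' * (real N / (2 * h)) + a' * (1 + real j0)"
        using mult_left_mono[OF jle a'0] by (simp add: algebra_simps)
      also have "a' * (real N / (2 * h)) = 256 * c * (real m)\<^sup>2"
        unfolding a'_eq using h1 N0 by (simp add: field_simps)
      also have "a' * (1 + real j0) \<le> 1 / 2 * (1 + real j0)" using a'h by (intro mult_right_mono) auto
      finally show ?thesis using 1 by (simp add: E)
    qed
    have "\<theta> * (h * real N * E) \<le> \<theta> * real U" using U1 \<theta>0 by (intro mult_left_mono) auto
    moreover have "\<theta> * (h * real N * E) = E" using \<theta>h by (metis mult.assoc mult.left_neutral)
    ultimately have \<theta>U1: "E \<le> \<theta> * real U" by simp
    have "\<theta> * real U \<le> \<theta> * (h * real N * E + 1)" using U2 \<theta>0 by (intro mult_left_mono) auto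
    also have "\<dots> = E + \<theta>" using \<open>\<theta> * (h * real N * E) = E\<close> by (simp add: distrib_left)
    also have "\<theta> \<le> 1"
    proof -
      have "1 \<le> h * real N" using \<open>1 * real N \<le> h * real N\<close> N0 by linarith
      then show ?thesis unfolding \<theta>_def by (simp add: divide_le_eq)
    qed
    finally have \<theta>U2: "\<theta> * real U \<le> E + 1" by simp
    have "exp 1 \<le> exp (- \<theta> * real k0 - a' * real j - \<gamma> + \<gamma> / real j) * exp (\<theta> * real U)"
    proof -
      have "0 \<le> \<gamma> / real j" using \<gamma>0 by simp
      then have "1 \<le> (- \<theta> * real k0 - a' * real j - \<gamma> + \<gamma> / real j) + \<theta> * real U"
        using expo \<theta>U1 by simp
      then show ?thesis by (simp only: exp_add[symmetric] exp_le_cancel_iff)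
    qed
    moreover have "(2 :: real) \<le> exp 1" using exp_ge_add_one_self[of 1] by simp
    ultimately have ge1: "1 \<le> exp (- \<theta> * real k0 - a' * real j - \<gamma> + \<gamma> / real j) * exp (\<theta> * real U) - 1" by linarith
    have "(1 / (2 * ?d)) ^ k0 * exp (- (E + 1)) * 1 \<le> (1 / (2 * ?d)) ^ k0 * exp (- \<theta> * real U)
      * (exp (- \<theta> * real k0 - a' * real j - \<gamma> + \<gamma> / real j) * exp (\<theta> * real U) - 1)"
      using ge1 \<theta>U2 by (intro mult_mono mult_left_mono) auto
    also note main
    finally have "r ^ (m + 1) * (1 / (2 * ?d)) ^ m * ((1 / (2 * ?d)) ^ k0 * exp (- (E + 1)))
       \<le> r ^ (m + 1) * (1 / (2 * ?d)) ^ m * reach_prob \<rho> ?F U"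
      using r by (intro mult_left_mono) auto
    also have "\<dots> \<le> pprob env {e. fst e 0 \<and> (\<exists>t\<le>m + U. reach b e UNIV 0 t)}"
      unfolding \<rho>_def by (rule start_prob) (use Nm in \<open>auto simp: b_def T_def\<close>)
    finally have \<eta>_le: "\<eta> \<le> pprob env {e. fst e 0 \<and> (\<exists>t\<le>m + U. reach b e UNIV 0 t)}" by (simp add: \<eta>_def)
    obtain Ev where Ev: "Ev \<in> sets (frog_space r)"
      "\<And>w. w \<in> Ev \<Longrightarrow> fst (project_env J T w) 0 \<and> (\<exists>t\<le>m + U. reach b (project_env J T w) UNIV 0 t)"
      "measure (frog_space r) Ev = pprob env {e. fst e 0 \<and> (\<exists>t\<le>m + U. reach b e UNIV 0 t)}"
      using project_env_event[OF finite_J, where r = r and T = T and Q = "\<lambda>e. fst e 0 \<and> (\<exists>t\<le>m + U. reach b e UNIV 0 t)"] by blast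
    have "occ w 0 \<and> passage_time w 0 (axis i (int N)) \<le> enat (m + U)" if "w \<in> Ev" for w
    proof
      from Ev(2)[OF that] obtain t where w: "fst (project_env J T w) 0" "t \<le> m + U" "reach b (project_env J T w) UNIV 0 t" by blast
      then show "occ w 0" by (simp add: project_env_def occ_def)
      then have "passage_time w 0 b \<le> enat t" using w(3) reach_passage_time by blast
      also have "\<dots> \<le> enat (m + U)" using w(2) by simp
      finally show "passage_time w 0 (axis i (int N)) \<le> enat (m + U)" by (simp add: b_def)
    qed
    then show "fast_passage r i N \<eta> (m + nat \<lceil>h * real N * E\<rceil>)"
      using Ev(1,3) \<eta>_le unfolding U_def by (intro bexI[of _ Ev]) auto
  qed
  then show ?thesis using \<eta> by blast
qed

theorem theorem1p2:
  assumes "CARD('d::finite) \<ge> 2"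
  shows "\<exists>A2 > 0. \<exists>r0 > 0. \<forall>r. 0 < r \<and> r \<le> 1 \<and> r \<le> r0 \<longrightarrow>
           (\<forall>\<mu> :: real ^ 'd \<Rightarrow> real. is_time_constant r \<mu> \<longrightarrow>
              (\<forall>x. \<mu> x \<le> A2 * delta_d CARD('d) r * l1_norm x))"
proof -
  \<comment> \<open>Everything down to \<open>B\<close> and \<open>H\<close> is fixed before r is
    introduced, so that the final constant depends on the dimension only.\<close>
  define p :: real where "p = 9 / 512"
  define c where "c = 37 * real CARD('d) + 1"
  define A where "A = 600 * real CARD('d)"
  have pc: "0 < p" "p \<le> 1" "0 \<le> c" by (auto simp: p_def c_def)
  obtain \<kappa> :: real and m :: nat where \<kappa>m: "\<kappa> \<ge> 2" "(1 + c) / \<kappa>\<^sup>2 \<le> p / 4" "m \<ge> 1" "(1 - p / 4) ^ m * \<kappa>\<^sup>2 \<le> 1 / 2"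
    by (rule scale_exists[OF pc])
  define \<gamma> where "\<gamma> = 256 * ((A + 1) * real m)\<^sup>2 / 4"
  define j0 where "j0 = nat \<lceil>2 * \<gamma>\<rceil> + 1"
  define E where "E = 2 + 256 * c * (real m)\<^sup>2 + (1 + real j0) / 2 + \<gamma>"
  have E: "E > 0" using pc by (simp add: E_def \<gamma>_def add_pos_nonneg)
  have "2 * (real m + 1) > 0" by simp
  from delta_scale[OF assms this] obtain B r0 where B: "B > 0" and r0: "r0 > 0" and scale:
    "\<And>r. 0 < r \<and> r \<le> r0 \<Longrightarrow> 1 \<le> delta_d CARD('d) r \<and>
    (\<exists>G>0. (\<Sum>l<nat \<lceil>B * (delta_d CARD('d) r)\<^sup>2\<rceil>. return_prob TYPE('d) l) \<le> G
      \<and> 2 * (real m + 1) / r \<le> real (nat \<lceil>B * (delta_d CARD('d) r)\<^sup>2\<rceil>) / (32 * G))"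
    by blast
  define H where "H = 3 * (B + 2) + 1 + real m"
  have H: "H > 0" using B by (simp add: H_def)
  have "\<mu> x \<le> H * (E + 1) * delta_d CARD('d) r * l1_norm x"
    if r: "0 < r \<and> r \<le> 1 \<and> r \<le> r0" and tc: "is_time_constant r \<mu>" for r and \<mu> :: "real ^ 'd \<Rightarrow> real" and x
  proof -
    define \<delta> where "\<delta> = delta_d CARD('d) r"
    define n where "n = nat \<lceil>B * \<delta>\<^sup>2\<rceil>"
    \<comment> \<open>The factor 3 gives a^2 = 9 n, which satisfies the requirement 8 n \<le> a^2 of
      the range bound.\<close>
    define a where "a = 3 * sqrt (real n)"
    define h where "h = a + 1 + real m"
    have "1 \<le> \<delta> \<and> (\<exists>G>0. (\<Sum>l<n. return_prob TYPE('d) l) \<le> G \<and> 2 * (real m + 1) / r \<le> real n / (32 * G))"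
      using scale[of r] r unfolding \<delta>_def n_def by blast
    then obtain G where \<delta>: "1 \<le> \<delta>" and G: "G > 0" "(\<Sum>l<n. return_prob TYPE('d) l) \<le> G" "2 * (real m + 1) / r \<le> real n / (32 * G)"
      by blast
    have pos: "0 < B * \<delta>\<^sup>2" using B \<delta> by simp
    then have n1: "1 \<le> n" unfolding n_def by linarith
    have a: "0 < a" "8 * real n \<le> a\<^sup>2" using n1 by (auto simp: a_def power_mult_distrib)
    have hH: "h \<le> H * \<delta>"
    proof -
      have "real n \<le> B * \<delta>\<^sup>2 + 1" using pos unfolding n_def by linarith
      also have "\<dots> \<le> ((B + 2) * \<delta>)\<^sup>2"
      proof -
        have "1 \<le> \<delta>\<^sup>2" using \<delta> by (simp add: one_le_power)
        moreover have "(B + 1) * \<delta>\<^sup>2 \<le> (B + 2)\<^sup>2 * \<delta>\<^sup>2"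
          using B by (intro mult_right_mono) (auto simp: power2_eq_square algebra_simps)
        moreover have "(B + 1) * \<delta>\<^sup>2 = B * \<delta>\<^sup>2 + \<delta>\<^sup>2" by (simp add: distrib_right)
        ultimately show ?thesis unfolding power_mult_distrib by linarith
      qed
      finally have "sqrt (real n) \<le> (B + 2) * \<delta>" using B \<delta> by (intro real_le_lsqrt) auto
      moreover have "(1 + real m) * 1 \<le> (1 + real m) * \<delta>" using \<delta> by (intro mult_left_mono) auto
      ultimately show ?thesis by (simp add: h_def a_def H_def algebra_simps)
    qed
    have axis: "\<mu> (axis i 1) \<le> h * (E + 1)" for i
    proof -
      from linear_passage[OF _ _ n1 a h_def G(2,1,3) p_def c_def A_def \<kappa>m \<gamma>_def j0_def E_def, where i = i] r
      obtain \<eta> n0 where \<eta>: "\<eta> > 0" and ev: "\<And>N. N \<ge> n0 \<Longrightarrow> real (m + nat \<lceil>h * real N * E\<rceil>) \<le> h * (E + 1) * real N \<and>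
        fast_passage r i N \<eta> (m + nat \<lceil>h * real N * E\<rceil>)"
        by blast
      show ?thesis
        by (rule time_constant_axis_le[OF tc \<eta>, of n0 i "\<lambda>N. m + nat \<lceil>h * real N * E\<rceil>"]) (use ev in auto)
    qed
    have "is_norm_fun \<mu>" using tc by (simp add: is_time_constant_def)
    then have "\<mu> x \<le> h * (E + 1) * l1_norm x" using axis by (rule norm_fun_le_l1)
    also have "\<dots> \<le> (H * \<delta>) * (E + 1) * l1_norm x"
      using hH E by (intro mult_right_mono) (auto simp: l1_norm_def sum_nonneg)
    finally show ?thesis by (simp add: \<delta>_def mult_ac)
  qed
  then show ?thesis using H E r0 by (intro exI[of _ "H * (E + 1)"] conjI exI[of _ r0]) auto
qed

end
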